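(* If a type-2 functional $\Psi$ is in $\mathrm{BFF}_2$, then there exists a finite orthogonal STRS $\mathcal{R}$ such that the distinguished symbol $\mathsf{F}$ computes $\Psi$ in $\mathcal{R}$ and $\mathcal{R}$ admits a polynomially bounded cost-size interpretation.
   Context: Type-2 complexity. $W=\{0,1\}^*$, $|w|$ its length; type-1 functions $W\to W$; type-2 functionals of rank $(k,l)$: $(W\to W)^k\to W^l\to W$; $|f|(n)=\max_{|y|\le n}|f(y)|$. OTMs: deterministic multi-tape Turing machines with a main tape and, per oracle $i$, a query tape, answer tape, query state $q_i$ and answer state $a_i$; entering $q_i$ moves in one step to $a_i$ with the answer tape containing $f_i(u)$, $u$ the (then erased) query-tape content. An OTM computes $\Psi$ if started with $x_1..x_l$ on its main tape and oracles $f_1..f_k$ it halts with $\Psi(\vec f,\vec x)$ on its main tape. Second-order polynomials: $P::=n\mid x\mid P+P\mid P*P\mid F(P)$. $\Psi\in\mathrm{BFF}_2$ iff some OTM computes $\Psi$ within time $P(|f_1|,..,|f_k|,|x_1|,..,|x_l|)$ for a second-order polynomial $P$. STRS: typed applicative terms, function symbols of type order $\le2$; rules $\ell\to r$ of base type, $\ell=\mathsf{f}\,\ell_1..\ell_m$, $\mathrm{vars}(r)\subseteq\mathrm{vars}(\ell)$; innermost rewriting; orthogonal = left-linear with no two distinct rules having left-hand sides with a common instance. Cost-size interpretations: quasi-ordered sets $\mathcal{S}_\iota$ per base type, pointwise-ordered monotone function spaces at arrows; cost sets $\mathcal{C}_\kappa=\mathbb{N}$, $\mathcal{C}_{\iota\Rightarrow\tau}=\mathcal{S}_\iota\Longrightarrow\mathcal{C}_\tau$,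 $\mathcal{C}_{\sigma\Rightarrow\tau}=\mathcal{C}_\sigma\Longrightarrow\mathcal{S}_\sigma\Longrightarrow\mathcal{C}_\tau$ ($\mathrm{ord}\sigma=1$); symbols get size $\mathcal{J}^{\mathsf{s}}$ and cost $\mathcal{J}^{\mathsf{c}}$; term size compositional; cost of $\mathsf{f}\,s_1..s_k\,t_1..t_n$ is $\mathcal{J}^{\mathsf{c}}_{\mathsf{f}}$ applied to cost and size of each order-1 argument and sizes of base-type arguments, cost of $x\,\vec s$ is $\zeta(x)$ of the sizes; compatible iff for every rule and all valuations, cost of $\ell$ $>$ sum of costs of non-variable base-type subterms of $r$, and size of $\ell\sqsupseteq$ size of $r$. Encoding: $\mathsf{o},\mathsf{i}:\mathsf{bit}$, $[]:\mathsf{word}$, $::\ :\mathsf{bit}\Rightarrow\mathsf{word}\Rightarrow\mathsf{word}$, words as lists $\underline{w}$; distinguished $\mathsf{F}:(\mathsf{word}\Rightarrow\mathsf{word})^k\Rightarrow\mathsf{word}^l\Rightarrow\mathsf{word}$. For $f$, fresh $\mathsf{S}_f:\mathsf{word}\Rightarrow\mathsf{word}$ with rules $\mathcal{R}_f=\{\mathsf{S}_f\,\underline{u}\to\underline{f(u)}\mid u\in W\}$; $\mathcal{R}_{+\vec f}=\mathcal{R}\cup\bigcup_i\mathcal{R}_{f_i}$. $\mathsf{F}$ computes $\Psi$ iff $\mathsf{F}\,\mathsf{S}_{f_1}..\mathsf{S}_{f_k}\,\underline{w_1}..\underline{w_l}\to^+_{\mathcal{R}_{+\vec f}}\underline{\Psi(\vec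 f,\vec w)}$ for all $\vec f,\vec w$. Polynomially bounded interpretation: compatible, $\mathcal{S}_{\mathsf{word}}=(\mathbb{N},\ge)$, costs of $\mathsf{o},\mathsf{i},[]$ zero, $\mathcal{J}^{\mathsf{c}}_{::}=\lambda xy.0$, $\mathcal{J}^{\mathsf{s}}_{::}=\lambda xy.x+y+c$ for some $c\ge1$, and $\mathcal{J}^{\mathsf{c}}_{\mathsf{F}}$ bounded by a second-order polynomial in $F_1^{\mathsf{c}},F_1^{\mathsf{s}},..,F_k^{\mathsf{c}},F_k^{\mathsf{s}};x_1..x_l$. *)

theory Defs
  imports Main "HOL-Library.FuncSet"
begin

section \<open>Words, type-2 functionals and second-order polynomials\<close>

type_synonym word = "bool list"

text \<open>
  A type-2 functional of rank \<open>(k, l)\<close> is represented by a function on lists, of which only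
  the values on argument lists of lengths \<open>k\<close> and \<open>l\<close> matter.
\<close>

type_synonym functional2 = "(word \<Rightarrow> word) list \<Rightarrow> word list \<Rightarrow> word"

definition fun_length :: "(word \<Rightarrow> word) \<Rightarrow> nat \<Rightarrow> nat" where
  "fun_length f n = Max ((\<lambda>y. length (f y)) ` {y. length y \<le> n})"

datatype sopoly =
    PConst nat
  | PVar nat
  | PAdd sopoly sopoly
  | PMul sopoly sopoly
  | PApp nat sopoly

primrec sopoly_over :: "nat \<Rightarrow> nat \<Rightarrow> sopoly \<Rightarrow> bool" where
  "sopoly_over k l (PConst n) \<longleftrightarrow> True"
| "sopoly_over k l (PVar j) \<longleftrightarrow> j < l"
| "sopoly_over k l (PAdd P Q) \<longleftrightarrow> sopoly_over k l P \<and> sopoly_over k l Q"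
| "sopoly_over k l (PMul P Q) \<longleftrightarrow> sopoly_over k l P \<and> sopoly_over k l Q"
| "sopoly_over k l (PApp i P) \<longleftrightarrow> i < k \<and> sopoly_over k l P"

primrec sopoly_eval :: "(nat \<Rightarrow> nat) list \<Rightarrow> nat list \<Rightarrow> sopoly \<Rightarrow> nat" where
  "sopoly_eval Fs xs (PConst n) = n"
| "sopoly_eval Fs xs (PVar j) = xs ! j"
| "sopoly_eval Fs xs (PAdd P Q) = sopoly_eval Fs xs P + sopoly_eval Fs xs Q"
| "sopoly_eval Fs xs (PMul P Q) = sopoly_eval Fs xs P * sopoly_eval Fs xs Q"
| "sopoly_eval Fs xs (PApp i P) = (Fs ! i) (sopoly_eval Fs xs P)"


section \<open>Oracle Turing machines and basic feasible functionals\<close>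

datatype tsym = Blank | Bit bool | Extra nat

datatype move = MLeft | MRight | MStay

text \<open>
  Tapes are infinite to the right only; moving left from cell 0 leaves the head in place.
\<close>

type_synonym tape = "(nat \<Rightarrow> tsym) \<times> nat"

text \<open>
  Tape 0 is the main tape; oracle \<open>i\<close> has query tape \<open>2 * i + 1\<close> and answer tape
  \<open>2 * i + 2\<close>; any further tapes are work tapes.
\<close>

record otm =
  states :: "nat set"
  alphabet :: "tsym set"
  ntapes :: nat
  start :: nat
  final :: "nat set"
  query :: "nat \<Rightarrow> nat"
  answer :: "nat \<Rightarrow> nat"
  delta :: "nat \<Rightarrow> tsym list \<Rightarrow> nat \<times> (tsym \<times> move) list"

definition otm :: "nat \<Rightarrow> otm \<Rightarrow> bool" where
  "otm k M \<longleftrightarrow>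
     finite (states M) \<and> finite (alphabet M) \<and> {Blank, Bit False, Bit True} \<subseteq> alphabet M \<and>
     2 * k + 1 \<le> ntapes M \<and>
     start M \<in> states M \<and> final M \<subseteq> states M \<and>
     query M ` {..<k} \<subseteq> states M - final M \<and> answer M ` {..<k} \<subseteq> states M \<and>
     inj_on (query M) {..<k} \<and> inj_on (answer M) {..<k} \<and>
     query M ` {..<k} \<inter> answer M ` {..<k} = {} \<and>
     (\<forall>q \<in> states M - final M - query M ` {..<k}. \<forall>cs.
        length cs = ntapes M \<and> set cs \<subseteq> alphabet M \<longrightarrow>
        (case delta M q cs of (q', acts) \<Rightarrow>
           q' \<in> states M \<and> length acts = ntapes M \<and> fst ` set acts \<subseteq> alphabet M))"

definition written :: "tsym list \<Rightarrow> tape" where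
  "written cs = (\<lambda>n. if n < length cs then cs ! n else Blank, 0)"

text \<open>
  The word on a tape is the maximal block of bits starting at cell 0. This gives every query
  tape a content, also one on which non-bit symbols have been written.
\<close>

definition tape_word :: "tape \<Rightarrow> word" where
  "tape_word t = map (\<lambda>n. fst t n = Bit True) [0..<(LEAST n. \<forall>b. fst t n \<noteq> Bit b)]"

fun act :: "tape \<Rightarrow> tsym \<times> move \<Rightarrow> tape" where
  "act (c, h) (a, m) =
     (c(h := a), case m of MLeft \<Rightarrow> h - 1 | MRight \<Rightarrow> h + 1 | MStay \<Rightarrow> h)"

type_synonym config = "nat \<times> tape list"

definition otm_step :: "otm \<Rightarrow> (word \<Rightarrow> word) list \<Rightarrow> config \<Rightarrow> config" where
  "otm_step M fs = (\<lambda>(q, ts).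
     if q \<in> final M then (q, ts)
     else case find (\<lambda>i. query M i = q) [0..<length fs] of
       Some i \<Rightarrow>
         (answer M i,
          ts[2 * i + 1 := written [],
             2 * i + 2 := written (map Bit ((fs ! i) (tape_word (ts ! (2 * i + 1)))))])
     | None \<Rightarrow>
         (case delta M q (map (\<lambda>(c, h). c h) ts) of (q', acts) \<Rightarrow> (q', map2 act ts acts)))"

definition otm_init :: "otm \<Rightarrow> word list \<Rightarrow> config" where
  "otm_init M xs =
     (start M, written (concat (map (\<lambda>x. map Bit x @ [Blank]) xs)) #
               replicate (ntapes M - 1) (written []))"

definition otm_run :: "otm \<Rightarrow> (word \<Rightarrow> word) list \<Rightarrow> word list \<Rightarrow> nat \<Rightarrow> config" where
  "otm_run M fs xs t = (otm_step M fs ^^ t) (otm_init M xs)"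

definition halted_at :: "otm \<Rightarrow> (word \<Rightarrow> word) list \<Rightarrow> word list \<Rightarrow> nat \<Rightarrow> bool" where
  "halted_at M fs xs t \<longleftrightarrow> fst (otm_run M fs xs t) \<in> final M"

definition otm_time :: "otm \<Rightarrow> (word \<Rightarrow> word) list \<Rightarrow> word list \<Rightarrow> nat" where
  "otm_time M fs xs = (LEAST t. halted_at M fs xs t)"

definition otm_computes :: "nat \<Rightarrow> nat \<Rightarrow> otm \<Rightarrow> functional2 \<Rightarrow> bool" where
  "otm_computes k l M \<Psi> \<longleftrightarrow>
     (\<forall>fs xs. length fs = k \<and> length xs = l \<longrightarrow>
        (\<exists>t. halted_at M fs xs t \<and> tape_word (snd (otm_run M fs xs t) ! 0) = \<Psi> fs xs))"

definition BFF2 :: "nat \<Rightarrow> nat \<Rightarrow> functional2 set" where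
  "BFF2 k l = {\<Psi>. \<exists>M P. otm k M \<and> sopoly_over k l P \<and> otm_computes k l M \<Psi> \<and>
     (\<forall>fs xs. length fs = k \<and> length xs = l \<longrightarrow>
        otm_time M fs xs \<le> sopoly_eval (map fun_length fs) (map length xs) P)}"


section \<open>Simply-typed term rewriting systems\<close>

datatype base = BitB | WordB | OtherB nat

datatype ty = Base base | Arrow ty ty (infixr "\<leadsto>" 60)

primrec ord :: "ty \<Rightarrow> nat" where
  "ord (Base \<iota>) = 0"
| "ord (\<sigma> \<leadsto> \<tau>) = max (1 + ord \<sigma>) (ord \<tau>)"

abbreviation "bitT \<equiv> Base BitB"
abbreviation "wordT \<equiv> Base WordB"

text \<open>
  \<open>Oracle f\<close> is the symbol written \<open>S\<^sub>f\<close> in the literature. The type \<open>symb\<close> is only a supply of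
  names; the symbols present in a system are those in the domain of its signature.
\<close>

datatype symb = SymO | SymI | SymNil | SymCons | SymF | Aux nat | Oracle "word \<Rightarrow> word"

type_synonym signature = "symb \<rightharpoonup> ty"

datatype trm = is_Var: Var nat ty | Sym symb | App trm trm

text \<open>
  Systems are second-order: variables have type order at most 1.
\<close>

primrec type_of :: "signature \<Rightarrow> trm \<Rightarrow> ty option" where
  "type_of \<Sigma> (Var n \<sigma>) = (if ord \<sigma> \<le> 1 then Some \<sigma> else None)"
| "type_of \<Sigma> (Sym g) = \<Sigma> g"
| "type_of \<Sigma> (App s t) =
     (case type_of \<Sigma> s of
        Some (\<sigma> \<leadsto> \<tau>) \<Rightarrow> if type_of \<Sigma> t = Some \<sigma> then Some \<tau> else None
      | _ \<Rightarrow> None)"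

abbreviation apps :: "trm \<Rightarrow> trm list \<Rightarrow> trm" where
  "apps \<equiv> foldl App"

primrec var_occs :: "trm \<Rightarrow> (nat \<times> ty) list" where
  "var_occs (Var n \<sigma>) = [(n, \<sigma>)]"
| "var_occs (Sym g) = []"
| "var_occs (App s t) = var_occs s @ var_occs t"

text \<open>All occurrences of subterms, with multiplicity.\<close>

primrec subterms :: "trm \<Rightarrow> trm list" where
  "subterms (Var n \<sigma>) = [Var n \<sigma>]"
| "subterms (Sym g) = [Sym g]"
| "subterms (App s t) = App s t # subterms s @ subterms t"

type_synonym subst = "nat \<Rightarrow> ty \<Rightarrow> trm"

definition substitution :: "signature \<Rightarrow> subst \<Rightarrow> bool" where
  "substitution \<Sigma> \<gamma> \<longleftrightarrow> (\<forall>n \<sigma>. ord \<sigma> \<le> 1 \<longrightarrow> type_of \<Sigma> (\<gamma> n \<sigma>) = Some \<sigma>)"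

primrec subst :: "trm \<Rightarrow> subst \<Rightarrow> trm" (infixl "\<cdot>" 80) where
  "Var n \<sigma> \<cdot> \<gamma> = \<gamma> n \<sigma>"
| "Sym g \<cdot> \<gamma> = Sym g"
| "App s t \<cdot> \<gamma> = App (s \<cdot> \<gamma>) (t \<cdot> \<gamma>)"

type_synonym rule = "trm \<times> trm"

definition is_rule :: "signature \<Rightarrow> rule \<Rightarrow> bool" where
  "is_rule \<Sigma> = (\<lambda>(\<l>, r).
     (\<exists>g args. \<l> = apps (Sym g) args) \<and>
     (\<exists>\<iota>. type_of \<Sigma> \<l> = Some (Base \<iota>) \<and> type_of \<Sigma> r = Some (Base \<iota>)) \<and>
     set (var_occs r) \<subseteq> set (var_occs \<l>))"

definition STRS :: "signature \<Rightarrow> rule set \<Rightarrow> bool" where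
  "STRS \<Sigma> R \<longleftrightarrow> (\<forall>\<sigma> \<in> ran \<Sigma>. ord \<sigma> \<le> 2) \<and> (\<forall>\<rho> \<in> R. is_rule \<Sigma> \<rho>)"

definition orthogonal :: "signature \<Rightarrow> rule set \<Rightarrow> bool" where
  "orthogonal \<Sigma> R \<longleftrightarrow>
     (\<forall>(\<l>, r) \<in> R. distinct (var_occs \<l>)) \<and>
     (\<forall>\<rho>\<^sub>1 \<in> R. \<forall>\<rho>\<^sub>2 \<in> R. \<rho>\<^sub>1 \<noteq> \<rho>\<^sub>2 \<longrightarrow>
        \<not> (\<exists>\<gamma> \<delta>. substitution \<Sigma> \<gamma> \<and> substitution \<Sigma> \<delta> \<and> fst \<rho>\<^sub>1 \<cdot> \<gamma> = fst \<rho>\<^sub>2 \<cdot> \<delta>))"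

definition redex :: "signature \<Rightarrow> rule set \<Rightarrow> trm \<Rightarrow> bool" where
  "redex \<Sigma> R s \<longleftrightarrow> (\<exists>(\<l>, r) \<in> R. \<exists>\<gamma>. substitution \<Sigma> \<gamma> \<and> s = \<l> \<cdot> \<gamma>)"

inductive innermost :: "signature \<Rightarrow> rule set \<Rightarrow> trm \<Rightarrow> trm \<Rightarrow> bool" for \<Sigma> R where
  root: "(\<l>, r) \<in> R \<Longrightarrow> substitution \<Sigma> \<gamma> \<Longrightarrow>
         (\<And>u. u \<in> set (subterms (\<l> \<cdot> \<gamma>)) \<Longrightarrow> u \<noteq> \<l> \<cdot> \<gamma> \<Longrightarrow> \<not> redex \<Sigma> R u) \<Longrightarrow>
         innermost \<Sigma> R (\<l> \<cdot> \<gamma>) (r \<cdot> \<gamma>)"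
| left: "innermost \<Sigma> R s s' \<Longrightarrow> innermost \<Sigma> R (App s t) (App s' t)"
| right: "innermost \<Sigma> R t t' \<Longrightarrow> innermost \<Sigma> R (App s t) (App s t')"


section \<open>Computing a type-2 functional\<close>

primrec enc :: "word \<Rightarrow> trm" where
  "enc [] = Sym SymNil"
| "enc (b # w) = App (App (Sym SymCons) (Sym (if b then SymI else SymO))) (enc w)"

text \<open>The typing of the distinguished symbols, and freshness of all oracle symbols.\<close>

definition type2_signature :: "nat \<Rightarrow> nat \<Rightarrow> signature \<Rightarrow> bool" where
  "type2_signature k l \<Sigma> \<longleftrightarrow>
     \<Sigma> SymO = Some bitT \<and> \<Sigma> SymI = Some bitT \<and>
     \<Sigma> SymNil = Some wordT \<and> \<Sigma> SymCons = Some (bitT \<leadsto> wordT \<leadsto> wordT) \<and>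
     \<Sigma> SymF = Some (foldr Arrow (replicate k (wordT \<leadsto> wordT) @ replicate l wordT) wordT) \<and>
     (\<forall>f. \<Sigma> (Oracle f) = None)"

definition oracle_signature :: "signature \<Rightarrow> (word \<Rightarrow> word) list \<Rightarrow> signature" where
  "oracle_signature \<Sigma> fs =
     \<Sigma> ++ (\<lambda>g. if g \<in> Oracle ` set fs then Some (wordT \<leadsto> wordT) else None)"

definition oracle_rules :: "(word \<Rightarrow> word) \<Rightarrow> rule set" where
  "oracle_rules f = {(App (Sym (Oracle f)) (enc u), enc (f u)) | u. True}"

definition STRS_computes :: "nat \<Rightarrow> nat \<Rightarrow> signature \<Rightarrow> rule set \<Rightarrow> functional2 \<Rightarrow> bool" where
  "STRS_computes k l \<Sigma> R \<Psi> \<longleftrightarrow>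
     (\<forall>fs ws. length fs = k \<and> length ws = l \<longrightarrow>
        (innermost (oracle_signature \<Sigma> fs) (R \<union> (\<Union>f \<in> set fs. oracle_rules f)))\<^sup>+\<^sup>+
          (apps (Sym SymF) (map (\<lambda>f. Sym (Oracle f)) fs @ map enc ws)) (enc (\<Psi> fs ws)))"


section \<open>Cost-size interpretations\<close>

text \<open>A carrier set with a relation on it, read as ``greater or equal''.\<close>

type_synonym 'x qset = "'x set \<times> ('x \<Rightarrow> 'x \<Rightarrow> bool)"

definition quasi_ordered :: "'x qset \<Rightarrow> bool" where
  "quasi_ordered X \<longleftrightarrow> fst X \<noteq> {} \<and> reflp_on (fst X) (snd X) \<and> transp_on (fst X) (snd X)"

definition mono_space :: "'x qset \<Rightarrow> 'y qset \<Rightarrow> ('x \<Rightarrow> 'y) qset" where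
  "mono_space X Y =
     ({h \<in> fst X \<rightarrow>\<^sub>E fst Y. monotone_on (fst X) (snd X) (snd Y) h},
      \<lambda>h h'. \<forall>x \<in> fst X. snd Y (h x) (h' x))"

definition qimage :: "('x \<Rightarrow> 'y) \<Rightarrow> 'x qset \<Rightarrow> 'y qset" where
  "qimage c X = (c ` fst X, \<lambda>u v. \<exists>x y. u = c x \<and> v = c y \<and> snd X x y)"

abbreviation nat_qset :: "nat qset" where
  "nat_qset \<equiv> (UNIV, \<lambda>x y. x \<ge> y)"

text \<open>
  The function spaces at all simple types have to live in one HOL type, and no HOL type contains
  its own function space, so orders at most 1 and at most 2 are separated. The
  datatype \<open>('a, 'r) fn1\<close> contains the curried functions of any arity from base-type sizes in
  \<open>'a\<close> to \<open>'r\<close>; order-1 elements appear among the order-2 ones via \<open>SLow\<close> and \<open>CLow\<close>.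
  The constructors are mere tags on the actual function spaces; \<open>qimage\<close> inserts them.
\<close>

datatype ('a, 'r) fn1 = Val 'r | Abs "'a \<Rightarrow> ('a, 'r) fn1"

type_synonym 'a size1 = "('a, 'a) fn1"
type_synonym 'a cost1 = "('a, nat) fn1"

datatype 'a size2 = SLow "'a size1" | SAbs "'a size1 \<Rightarrow> 'a size2"

datatype 'a cost2 =
    CLow "'a cost1"
  | CAbs0 "'a size1 \<Rightarrow> 'a cost2"
  | CAbs1 "'a cost1 \<Rightarrow> 'a size1 \<Rightarrow> 'a cost2"

fun space1 :: "(base \<Rightarrow> 'a qset) \<Rightarrow> (base \<Rightarrow> 'r qset) \<Rightarrow> ty \<Rightarrow> ('a, 'r) fn1 qset" where
  "space1 A B (Base \<iota>) = qimage Val (B \<iota>)"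
| "space1 A B (Base \<iota> \<leadsto> \<tau>) = qimage Abs (mono_space (A \<iota>) (space1 A B \<tau>))"
| "space1 A B ((_ \<leadsto> _) \<leadsto> _) = ({}, \<lambda>_ _. False)"

abbreviation size_space1 :: "(base \<Rightarrow> 'a qset) \<Rightarrow> ty \<Rightarrow> 'a size1 qset" where
  "size_space1 A \<equiv> space1 A A"

abbreviation cost_space1 :: "(base \<Rightarrow> 'a qset) \<Rightarrow> ty \<Rightarrow> 'a cost1 qset" where
  "cost_space1 A \<equiv> space1 A (\<lambda>_. nat_qset)"

primrec size_space :: "(base \<Rightarrow> 'a qset) \<Rightarrow> ty \<Rightarrow> 'a size2 qset" where
  "size_space A (Base \<iota>) = qimage SLow (size_space1 A (Base \<iota>))"
| "size_space A (\<sigma> \<leadsto> \<tau>) =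
     (if ord (\<sigma> \<leadsto> \<tau>) \<le> 1 then qimage SLow (size_space1 A (\<sigma> \<leadsto> \<tau>))
      else qimage SAbs (mono_space (size_space1 A \<sigma>) (size_space A \<tau>)))"

primrec cost_space :: "(base \<Rightarrow> 'a qset) \<Rightarrow> ty \<Rightarrow> 'a cost2 qset" where
  "cost_space A (Base \<kappa>) = qimage CLow (cost_space1 A (Base \<kappa>))"
| "cost_space A (\<sigma> \<leadsto> \<tau>) =
     (if ord (\<sigma> \<leadsto> \<tau>) \<le> 1 then qimage CLow (cost_space1 A (\<sigma> \<leadsto> \<tau>))
      else if ord \<sigma> = 0 then qimage CAbs0 (mono_space (size_space1 A \<sigma>) (cost_space A \<tau>))
      else qimage CAbs1
             (mono_space (cost_space1 A \<sigma>) (mono_space (size_space1 A \<sigma>) (cost_space A \<tau>))))"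

record 'a interp =
  base_set :: "base \<Rightarrow> 'a qset"
  size_of_sym :: "symb \<Rightarrow> 'a size2"
  cost_of_sym :: "symb \<Rightarrow> 'a cost2"

definition cost_size_interp :: "signature \<Rightarrow> 'a interp \<Rightarrow> bool" where
  "cost_size_interp \<Sigma> J \<longleftrightarrow>
     (\<forall>\<iota>. quasi_ordered (base_set J \<iota>)) \<and>
     (\<forall>g \<sigma>. \<Sigma> g = Some \<sigma> \<longrightarrow>
        size_of_sym J g \<in> fst (size_space (base_set J) \<sigma>) \<and>
        cost_of_sym J g \<in> fst (cost_space (base_set J) \<sigma>))"

fun sapp :: "'a size2 \<Rightarrow> 'a size1 \<Rightarrow> 'a size2" where
  "sapp (SLow (Abs h)) (Val a) = SLow (h a)"
| "sapp (SAbs h) v = h v"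

text \<open>
  The cost of an argument is used only if the argument has order 1, and only by function
  symbols, not by variables.
\<close>

fun capp :: "'a cost2 \<Rightarrow> 'a cost1 \<Rightarrow> 'a size1 \<Rightarrow> 'a cost2" where
  "capp (CLow (Abs h)) c (Val a) = CLow (h a)"
| "capp (CAbs0 h) c v = h v"
| "capp (CAbs1 h) c v = h c v"

fun slow :: "'a size2 \<Rightarrow> 'a size1" where
  "slow (SLow v) = v"

fun clow :: "'a cost2 \<Rightarrow> 'a cost1" where
  "clow (CLow c) = c"

fun cval :: "'a cost2 \<Rightarrow> nat" where
  "cval (CLow (Val n)) = n"

type_synonym 'a svaluation = "nat \<Rightarrow> ty \<Rightarrow> 'a size1"
type_synonym 'a cvaluation = "nat \<Rightarrow> ty \<Rightarrow> 'a cost1"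

definition valuations :: "(base \<Rightarrow> 'a qset) \<Rightarrow> 'a svaluation \<Rightarrow> 'a cvaluation \<Rightarrow> bool" where
  "valuations A \<alpha> \<zeta> \<longleftrightarrow>
     (\<forall>n \<sigma>. ord \<sigma> \<le> 1 \<longrightarrow> \<alpha> n \<sigma> \<in> fst (size_space1 A \<sigma>) \<and> \<zeta> n \<sigma> \<in> fst (cost_space1 A \<sigma>))"

primrec tsize :: "'a interp \<Rightarrow> 'a svaluation \<Rightarrow> trm \<Rightarrow> 'a size2" where
  "tsize J \<alpha> (Var n \<sigma>) = SLow (\<alpha> n \<sigma>)"
| "tsize J \<alpha> (Sym g) = size_of_sym J g"
| "tsize J \<alpha> (App s t) = sapp (tsize J \<alpha> s) (slow (tsize J \<alpha> t))"

primrec tcost :: "'a interp \<Rightarrow> 'a svaluation \<Rightarrow> 'a cvaluation \<Rightarrow> trm \<Rightarrow> 'a cost2" where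
  "tcost J \<alpha> \<zeta> (Var n \<sigma>) = CLow (\<zeta> n \<sigma>)"
| "tcost J \<alpha> \<zeta> (Sym g) = cost_of_sym J g"
| "tcost J \<alpha> \<zeta> (App s t) =
     capp (tcost J \<alpha> \<zeta> s) (clow (tcost J \<alpha> \<zeta> t)) (slow (tsize J \<alpha> t))"

definition total_cost ::
    "signature \<Rightarrow> 'a interp \<Rightarrow> 'a svaluation \<Rightarrow> 'a cvaluation \<Rightarrow> trm \<Rightarrow> nat" where
  "total_cost \<Sigma> J \<alpha> \<zeta> s =
     (\<Sum>t \<leftarrow> filter (\<lambda>t. \<not> is_Var t \<and> (\<exists>\<iota>. type_of \<Sigma> t = Some (Base \<iota>))) (subterms s).
        cval (tcost J \<alpha> \<zeta> t))"

definition compatible :: "signature \<Rightarrow> rule set \<Rightarrow> 'a interp \<Rightarrow> bool" where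
  "compatible \<Sigma> R J \<longleftrightarrow>
     (\<forall>(\<l>, r) \<in> R. \<forall>\<alpha> \<zeta> \<iota>.
        valuations (base_set J) \<alpha> \<zeta> \<and> type_of \<Sigma> \<l> = Some (Base \<iota>) \<longrightarrow>
        cval (tcost J \<alpha> \<zeta> \<l>) > total_cost \<Sigma> J \<alpha> \<zeta> r \<and>
        snd (size_space (base_set J) (Base \<iota>)) (tsize J \<alpha> \<l>) (tsize J \<alpha> r))"


section \<open>Polynomially bounded interpretations\<close>

definition unary :: "(nat \<Rightarrow> nat) \<Rightarrow> (nat, nat) fn1" where
  "unary h = Abs (\<lambda>n. Val (h n))"

text \<open>
  The value of the cost function of the main symbol at
  \<open>F\<^sub>1\<^sup>c, F\<^sub>1\<^sup>s, \<dots>, F\<^sub>k\<^sup>c, F\<^sub>k\<^sup>s, x\<^sub>1, \<dots>, x\<^sub>l\<close>, where \<open>Gs\<close> lists the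
  \<open>F\<^sub>i\<^sup>c\<close> and \<open>Hs\<close> the \<open>F\<^sub>i\<^sup>s\<close>. The cost component \<open>Val 0\<close> supplied with a base-type
  argument is ignored by \<open>capp\<close>.
\<close>

definition main_cost ::
    "nat cost2 \<Rightarrow> (nat \<Rightarrow> nat) list \<Rightarrow> (nat \<Rightarrow> nat) list \<Rightarrow> nat list \<Rightarrow> nat" where
  "main_cost j Gs Hs xs =
     cval (foldl (\<lambda>j (c, v). capp j c v) j
       (zip (map unary Gs) (map unary Hs) @ map (\<lambda>x. (Val 0, Val x)) xs))"

text \<open>
  The expression \<open>x + y + c\<close> for the size of \<open>SymCons\<close> adds a bit size to a word size, so the
  sizes of bits are natural numbers, too. Variable \<open>2 * i\<close> of the bounding polynomial
  stands for the cost, variable \<open>2 * i + 1\<close> for the size of the \<open>i\<close>-th function argument.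
\<close>

definition poly_bounded :: "nat \<Rightarrow> nat \<Rightarrow> signature \<Rightarrow> rule set \<Rightarrow> nat interp \<Rightarrow> bool" where
  "poly_bounded k l \<Sigma> R J \<longleftrightarrow>
     cost_size_interp \<Sigma> J \<and> compatible \<Sigma> R J \<and>
     base_set J WordB = nat_qset \<and> base_set J BitB = nat_qset \<and>
     cost_of_sym J SymO = CLow (Val 0) \<and>
     cost_of_sym J SymI = CLow (Val 0) \<and>
     cost_of_sym J SymNil = CLow (Val 0) \<and>
     cost_of_sym J SymCons = CLow (Abs (\<lambda>x. Abs (\<lambda>y. Val 0))) \<and>
     (\<exists>c \<ge> 1. size_of_sym J SymCons = SLow (Abs (\<lambda>x. Abs (\<lambda>y. Val (x + y + c))))) \<and>
     (\<exists>P. sopoly_over (2 * k) l P \<and>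
        (\<forall>Gs Hs xs. length Gs = k \<and> length Hs = k \<and> length xs = l \<and>
             (\<forall>h \<in> set Gs \<union> set Hs. mono h) \<longrightarrow>
           main_cost (cost_of_sym J SymF) Gs Hs xs
             \<le> sopoly_eval (concat (map2 (\<lambda>g h. [g, h]) Gs Hs)) xs P))"

end

theory Submission
  imports Defs
begin

text \<open>
  The system simulates an oracle Turing machine step by step, guarded by a clock. The time bound
  \<open>P(|f|, |x|)\<close> itself cannot serve as the clock, since \<open>|f|\<close> is not feasibly computable.
  Instead the system keeps the list of the words queried so far and replaces \<open>|f|(n)\<close> by the
  maximum of \<open>|f(take n a)|\<close> over the recorded words \<open>a\<close>. This is enough: up to any time
  \<open>t\<close> the machine behaves as with oracles that agree with \<open>f\<close> on the recorded words and are
  empty elsewhere, and the time bound for these oracles is below the value of the clock. So the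
  clock, reevaluated in each round, never runs out before the machine halts.

  The clock is easy to interpret: all oracle arguments in its evaluation are truncated to length
  \<open>n\<close>, so its size is the value of a second-order polynomial at the sizes of \<open>f\<close> and \<open>x\<close>,
  whatever the history is. With that bound \<open>B\<close> and a history of length \<open>h\<close>, at most \<open>B - h\<close>
  further rounds are possible, and the cost of a round is polynomial in \<open>B\<close> because tapes are
  only read with the rest of the clock as fuel.
\<close>

subsection \<open>Fully applied terms\<close>

text \<open>The obstacle is compatibility: sizes may not increase from left to right under any
  valuation of the variables, not only for reachable terms. A tape or a history whose size measured
  its contents would grow from round to round. So stacks and tapes get size \<open>0\<close>, a
  history gets only its number of entries, and whatever is read back from them is cut to a length
  that is visible in the size of another argument: words leave a tape only under fuel, and recorded
  words reach an oracle only through \<open>lim\<close>, whose size is a minimum. With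
  \<open>H\<close> the size of the oracle, monotonicity gives \<open>H (min m n) \<le> H n\<close>,
  and this keeps the clock below a polynomial. Truncation costs the time bound nothing, because a
  recorded word \<open>a\<close> of length at most \<open>n\<close> equals \<open>take n a\<close>.
  The clock cannot be a counter fixed at the start: its value has to grow when long answers turn up,
  and reevaluating it on a longer history does just that.\<close>

abbreviation "funT \<equiv> wordT \<leadsto> wordT"

text \<open>
  \<open>PF i t\<close> applies the function variable \<open>i\<close>, of type \<open>word \<leadsto> word\<close>, to \<open>t\<close>; in
  \<open>PS g js ts\<close> the list \<open>js\<close> holds the function variables passed to the symbol \<open>g\<close>.
\<close>

datatype pt = PV nat base | PF nat pt | PS symb "nat list" "pt list"

primrec tr :: "pt \<Rightarrow> trm" where
  "tr (PV n b) = Var n (Base b)"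
| "tr (PF i t) = App (Var i funT) (tr t)"
| "tr (PS g js ts) = apps (Sym g) (map (\<lambda>i. Var i funT) js @ map tr ts)"

primrec pvars :: "pt \<Rightarrow> (nat \<times> ty) list" where
  "pvars (PV n b) = [(n, Base b)]"
| "pvars (PF i t) = (i, funT) # pvars t"
| "pvars (PS g js ts) = map (\<lambda>i. (i, funT)) js @ concat (map pvars ts)"

type_synonym arity = "symb \<Rightarrow> (nat \<times> base list \<times> base) option"

definition fun_ty :: "nat \<Rightarrow> base list \<Rightarrow> base \<Rightarrow> ty" where
  "fun_ty k bs b = foldr Arrow (replicate k funT @ map Base bs) (Base b)"

definition sig_of :: "arity \<Rightarrow> signature" where
  "sig_of ar g = map_option (\<lambda>(k, bs, b). fun_ty k bs b) (ar g)"

primrec ptype :: "arity \<Rightarrow> pt \<Rightarrow> base option" where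
  "ptype ar (PV n b) = Some b"
| "ptype ar (PF i t) = (if ptype ar t = Some WordB then Some WordB else None)"
| "ptype ar (PS g js ts) = (case ar g of None \<Rightarrow> None | Some (k, bs, b) \<Rightarrow>
     if length js = k \<and> map (ptype ar) ts = map Some bs then Some b else None)"

lemma ord_fun_ty: "ord (fun_ty k bs b) \<le> 2"
proof -
  have 1: "ord (foldr Arrow (map Base bs) (Base b)) \<le> 1" by (induction bs) auto
  have "ord (foldr Arrow (replicate k funT @ map Base bs) (Base b)) \<le> 2"
  proof (induction k)
    case 0 then show ?case using 1 by simp
  qed simp
  then show ?thesis by (simp add: fun_ty_def)
qed

lemma type_of_apps:
  assumes "type_of \<Sigma> s = Some (foldr Arrow (tys @ rest) \<tau>)"
    and "map (type_of \<Sigma>) args = map Some tys"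
  shows "type_of \<Sigma> (apps s args) = Some (foldr Arrow rest \<tau>)"
  using assms
proof (induction args arbitrary: s tys)
  case (Cons a args)
  then obtain \<sigma> tys' where "tys = \<sigma> # tys'" "type_of \<Sigma> a = Some \<sigma>"
    "map (type_of \<Sigma>) args = map Some tys'" by (cases tys) auto
  with Cons.prems(1) Cons.IH[of "App s a" tys'] show ?case by simp
qed simp

lemma ptype_PS:
  assumes "ptype ar (PS g js ts) = Some b"
  obtains k bs where "ar g = Some (k, bs, b)" "length js = k" "length ts = length bs"
    "list_all2 (\<lambda>t b. ptype ar t = Some b) ts bs"
proof -
  obtain k bs where g: "ar g = Some (k, bs, b)" "length js = k" "map (ptype ar) ts = map Some bs"
    using assms by (auto split: option.splits if_splits)
  moreover have "list_all2 (\<lambda>t b. ptype ar t = Some b) ts bs"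
    using g(3) by (simp add: list_all2_map1 list_all2_map2 flip: list.rel_eq)
  ultimately show ?thesis using that by (auto dest: list_all2_lengthD)
qed

lemma type_of_tr:
  assumes "sig_of ar \<subseteq>\<^sub>m \<Sigma>" "ptype ar t = Some b"
  shows "type_of \<Sigma> (tr t) = Some (Base b)"
  using assms(2)
proof (induction t arbitrary: b)
  case (PS g js ts)
  obtain k bs where g: "ar g = Some (k, bs, b)" "length js = k" "length ts = length bs"
    "list_all2 (\<lambda>t b. ptype ar t = Some b) ts bs"
    using PS.prems by (rule ptype_PS)
  have "sig_of ar g = Some (fun_ty k bs b)" using g by (simp add: sig_of_def)
  then have "\<Sigma> g = Some (fun_ty k bs b)"
    using assms(1) by (metis domI map_le_def)
  moreover have "map (type_of \<Sigma>) (map tr ts) = map Some (map Base bs)"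
    using g(3,4) PS.IH by (intro nth_equalityI) (auto simp: list_all2_conv_all_nth)
  ultimately show ?case
    using type_of_apps[of \<Sigma> "Sym g" "replicate k funT @ map Base bs" "[]" "Base b"
        "map (\<lambda>i. Var i funT) js @ map tr ts"] g(2)
    by (simp add: fun_ty_def map_replicate_const comp_def)
qed (auto split: if_splits)

lemma var_occs_apps: "var_occs (apps s ts) = var_occs s @ concat (map var_occs ts)"
  by (induction ts arbitrary: s) auto

lemma var_occs_tr: "var_occs (tr t) = pvars t"
proof (induction t)
  case (PS g js ts)
  have "map (var_occs \<circ> tr) ts = map pvars ts" using PS by simp
  then have *: "concat (map (var_occs \<circ> tr) ts) = concat (map pvars ts)" by (rule arg_cong)
  have "concat (map (var_occs \<circ> (\<lambda>i. Var i funT)) js) = map (\<lambda>i. (i, funT)) js"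
    by (induction js) auto
  with * show ?case by (simp add: var_occs_apps)
qed auto

lemma subst_apps: "apps s ts \<cdot> \<gamma> = apps (s \<cdot> \<gamma>) (map (\<lambda>t. t \<cdot> \<gamma>) ts)"
  by (induction ts arbitrary: s) auto

lemma apps_Sym_eq_iff [simp]: "apps (Sym g) as = apps (Sym g') bs \<longleftrightarrow> g = g' \<and> as = bs"
proof (induction as arbitrary: bs rule: rev_induct)
  case Nil
  then show ?case by (cases bs rule: rev_cases) auto
next
  case (snoc a as)
  then show ?case by (cases bs rule: rev_cases) auto
qed

subsection \<open>Innermost steps of systems whose rules have a fixed number of arguments\<close>

primrec head_sym :: "trm \<Rightarrow> symb option" where
  "head_sym (Var n \<sigma>) = None"
| "head_sym (Sym g) = Some g"
| "head_sym (App s t) = head_sym s"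

primrec nargs :: "trm \<Rightarrow> nat" where
  "nargs (Var n \<sigma>) = 0"
| "nargs (Sym g) = 0"
| "nargs (App s t) = Suc (nargs s)"

lemma head_sym_apps [simp]: "head_sym (apps s ts) = head_sym s"
  by (induction ts arbitrary: s) auto

lemma nargs_apps [simp]: "nargs (apps s ts) = nargs s + length ts"
  by (induction ts arbitrary: s) auto

definition normal :: "signature \<Rightarrow> rule set \<Rightarrow> trm \<Rightarrow> bool" where
  "normal \<Sigma> R t \<longleftrightarrow> (\<forall>u \<in> set (subterms t). \<not> redex \<Sigma> R u)"

lemma normal_App: "normal \<Sigma> R (App s t) \<longleftrightarrow> normal \<Sigma> R s \<and> normal \<Sigma> R t \<and> \<not> redex \<Sigma> R (App s t)"
  by (auto simp: normal_def)

text \<open>All left-hand sides with the same head have the same number of arguments, so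
  applications to fewer arguments are never redexes. \<open>D g = None\<close> implies that
  \<open>g\<close> heads no rule.\<close>

locale fixed_arity =
  fixes \<Sigma> :: signature and R :: "rule set" and D :: "symb \<Rightarrow> nat option"
  assumes heads: "(\<l>, r) \<in> R \<Longrightarrow> \<exists>g args. \<l> = apps (Sym g) args \<and> D g = Some (length args)"
begin

lemma redex_head:
  assumes "redex \<Sigma> R s"
  shows "\<exists>g. head_sym s = Some g \<and> D g = Some (nargs s)"
proof -
  obtain \<l> r \<gamma> where lr: "(\<l>, r) \<in> R" "s = \<l> \<cdot> \<gamma>" using assms by (auto simp: redex_def)
  obtain g args where "\<l> = apps (Sym g) args" "D g = Some (length args)" using heads[OF lr(1)] by blast
  with lr(2) show ?thesis by (simp add: subst_apps)
qed

lemma normal_Var [simp]: "normal \<Sigma> R (Var n \<sigma>)"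
  using redex_head[of "Var n \<sigma>"] by (auto simp: normal_def)

lemma normal_apps:
  assumes "\<And>a. a \<in> set args \<Longrightarrow> normal \<Sigma> R a" "\<And>n. D g = Some n \<Longrightarrow> length args < n"
  shows "normal \<Sigma> R (apps (Sym g) args)"
  using assms
proof (induction args rule: rev_induct)
  case Nil
  then show ?case using redex_head[of "Sym g"] by (fastforce simp: normal_def)
next
  case (snoc a as)
  have "normal \<Sigma> R (apps (Sym g) as)" using snoc by fastforce
  moreover have "\<not> redex \<Sigma> R (App (apps (Sym g) as) a)"
    using redex_head[of "App (apps (Sym g) as) a"] snoc.prems(2) by fastforce
  ultimately show ?case using snoc.prems(1) by (simp add: normal_App)
qed

lemma subterms_apps:
  "u \<in> set (subterms (apps (Sym g) args)) \<Longrightarrow> u \<noteq> apps (Sym g) args \<Longrightarrow>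
   (\<exists>a \<in> set args. u \<in> set (subterms a)) \<or>
   (\<exists>n < length args. u = apps (Sym g) (take n args))"
proof (induction args rule: rev_induct)
  case (snoc a as)
  show ?case
  proof (cases "u = apps (Sym g) as")
    case True
    then show ?thesis by (intro disjI2 exI[of _ "length as"]) simp
  next
    case False
    with snoc.prems have "u \<in> set (subterms (apps (Sym g) as)) \<or> u \<in> set (subterms a)" by auto
    then show ?thesis
    proof
      assume "u \<in> set (subterms (apps (Sym g) as))"
      from snoc.IH[OF this False] show ?thesis
      proof
        assume "\<exists>n<length as. u = apps (Sym g) (take n as)"
        then obtain n where "n < length as" "u = apps (Sym g) (take n as)" by blast
        then show ?thesis by (intro disjI2 exI[of _ n]) simp
      qed auto
    qed auto
  qed
qed simp

text \<open>A proper subterm of the instance lies inside an argument, which is normal, or is a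
  prefix of the application, which has too few arguments to be a redex.\<close>

lemma innermost_rootI:
  assumes "(\<l>, r) \<in> R" "substitution \<Sigma> \<gamma>" "\<l> = apps (Sym g) ps"
    and "\<And>p. p \<in> set ps \<Longrightarrow> normal \<Sigma> R (p \<cdot> \<gamma>)"
  shows "innermost \<Sigma> R (\<l> \<cdot> \<gamma>) (r \<cdot> \<gamma>)"
proof (rule innermost.root[OF assms(1,2)])
  fix u assume u: "u \<in> set (subterms (\<l> \<cdot> \<gamma>))" "u \<noteq> \<l> \<cdot> \<gamma>"
  let ?as = "map (\<lambda>t. t \<cdot> \<gamma>) ps"
  have D: "D g = Some (length ps)" using heads[OF assms(1)] assms(3) by auto
  have "(\<exists>a \<in> set ?as. u \<in> set (subterms a)) \<or> (\<exists>n < length ?as. u = apps (Sym g) (take n ?as))"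
    using subterms_apps[of u g ?as] u assms(3) by (simp add: subst_apps)
  then show "\<not> redex \<Sigma> R u"
  proof
    assume "\<exists>a \<in> set ?as. u \<in> set (subterms a)"
    then show ?thesis using assms(4) by (auto simp: normal_def)
  next
    assume "\<exists>n < length ?as. u = apps (Sym g) (take n ?as)"
    then show ?thesis using redex_head[of u] D by auto
  qed
qed

lemma innermost_App_rtranclp:
  assumes "(innermost \<Sigma> R)\<^sup>*\<^sup>* s s'" "(innermost \<Sigma> R)\<^sup>*\<^sup>* t t'"
  shows "(innermost \<Sigma> R)\<^sup>*\<^sup>* (App s t) (App s' t')"
proof -
  have "(innermost \<Sigma> R)\<^sup>*\<^sup>* (App s t) (App s' t)"
    using assms(1) by induction (auto intro: rtranclp.rtrancl_into_rtrancl innermost.left)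
  moreover have "(innermost \<Sigma> R)\<^sup>*\<^sup>* (App s' t) (App s' t')"
    using assms(2) by induction (auto intro: rtranclp.rtrancl_into_rtrancl innermost.right)
  ultimately show ?thesis by (rule rtranclp_trans)
qed

lemma innermost_apps_rtranclp:
  assumes "list_all2 (innermost \<Sigma> R)\<^sup>*\<^sup>* ts ts'" "(innermost \<Sigma> R)\<^sup>*\<^sup>* s s'"
  shows "(innermost \<Sigma> R)\<^sup>*\<^sup>* (apps s ts) (apps s' ts')"
  using assms by (induction arbitrary: s s' rule: list_all2_induct) (auto intro: innermost_App_rtranclp)

end

subsection \<open>Interpretations given by functions on argument lists\<close>

text \<open>
  Base type \<open>OtherB 0\<close> will be that of histories. Its order is discrete, hence every function
  of the length of a history is monotone, also one that decreases along a computation. The sizes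
  of the remaining types carry no information.
\<close>

primrec relb :: "base \<Rightarrow> nat \<Rightarrow> nat \<Rightarrow> bool" where
  "relb BitB = (\<lambda>x y. x \<ge> y)"
| "relb WordB = (\<lambda>x y. x \<ge> y)"
| "relb (OtherB n) = (if n = 0 then (=) else (\<lambda>_ _. True))"

definition bset :: "base \<Rightarrow> nat qset" where
  "bset b = (UNIV, relb b)"

lemma bset_sel [simp]: "fst (bset b) = UNIV" "snd (bset b) = relb b"
  by (simp_all add: bset_def)

lemma relb_refl [simp]: "relb b x x"
  by (cases b) auto

lemma relb_trans: "relb b x y \<Longrightarrow> relb b y z \<Longrightarrow> relb b x z"
  by (cases b) (auto split: if_splits)

lemma quasi_ordered_bset: "quasi_ordered (bset b)"
  unfolding quasi_ordered_def bset_def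
  by (auto simp: reflp_on_def transp_on_def intro: relb_trans)

primrec lrel :: "base list \<Rightarrow> nat list \<Rightarrow> nat list \<Rightarrow> bool" where
  "lrel [] xs ys \<longleftrightarrow> xs = [] \<and> ys = []"
| "lrel (b # bs) xs ys \<longleftrightarrow>
     (\<exists>x xs' y ys'. xs = x # xs' \<and> ys = y # ys' \<and> relb b x y \<and> lrel bs xs' ys')"

lemma lrel_refl: "length xs = length bs \<Longrightarrow> lrel bs xs xs"
  by (induction bs arbitrary: xs) (auto simp: length_Suc_conv)

lemma lrel_iff: "lrel bs xs ys \<longleftrightarrow> length xs = length bs \<and> length ys = length bs \<and>
    (\<forall>i < length bs. relb (bs ! i) (xs ! i) (ys ! i))"
proof (induction bs arbitrary: xs ys)
  case (Cons b bs)
  show ?case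
  proof
    assume "lrel (b # bs) xs ys"
    then show "length xs = length (b # bs) \<and> length ys = length (b # bs) \<and>
       (\<forall>i < length (b # bs). relb ((b # bs) ! i) (xs ! i) (ys ! i))"
      using Cons.IH by (auto simp: nth_Cons split: nat.splits)
  next
    assume *: "length xs = length (b # bs) \<and> length ys = length (b # bs) \<and>
       (\<forall>i < length (b # bs). relb ((b # bs) ! i) (xs ! i) (ys ! i))"
    then obtain x xs' y ys' where xy: "xs = x # xs'" "ys = y # ys'" by (metis length_Suc_conv length_Cons)
    have "relb b x y" using * xy by (force dest: spec[of _ 0])
    moreover have "relb (bs ! i) (xs' ! i) (ys' ! i)" if "i < length bs" for i
      using * xy that by (auto dest: spec[of _ "Suc i"])
    ultimately show "lrel (b # bs) xs ys" using * xy Cons.IH by auto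
  qed
qed auto

primrec build1 :: "nat \<Rightarrow> (nat list \<Rightarrow> nat) \<Rightarrow> (nat, nat) fn1" where
  "build1 0 f = Val (f [])"
| "build1 (Suc n) f = Abs (\<lambda>x. build1 n (\<lambda>xs. f (x # xs)))"

abbreviation first_ty :: "base list \<Rightarrow> base \<Rightarrow> ty" where
  "first_ty bs b \<equiv> foldr Arrow (map Base bs) (Base b)"

lemma snd_space1_build1:
  assumes "fst (B b) = UNIV" "\<And>xs. length xs = length bs \<Longrightarrow> snd (B b) (f xs) (g xs)"
  shows "snd (space1 bset B (first_ty bs b)) (build1 (length bs) f) (build1 (length bs) g)"
  using assms(2)
  by (induction bs arbitrary: f g) (auto simp: qimage_def mono_space_def)

lemma fst_space1_build1:
  assumes "fst (B b) = UNIV" "\<And>xs ys. lrel bs xs ys \<Longrightarrow> snd (B b) (f xs) (f ys)"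
  shows "build1 (length bs) f \<in> fst (space1 bset B (first_ty bs b))"
  using assms(2)
proof (induction bs arbitrary: f)
  case Nil
  then show ?case using assms(1) by (simp add: qimage_def)
next
  case (Cons b' bs)
  let ?F = "\<lambda>x. build1 (length bs) (\<lambda>xs. f (x # xs))"
  have "?F x \<in> fst (space1 bset B (first_ty bs b))" for x
    by (rule Cons.IH) (auto intro!: Cons.prems)
  moreover have "snd (space1 bset B (first_ty bs b)) (?F x) (?F y)" if "relb b' x y" for x y
    by (rule snd_space1_build1[where B = B and b = b, OF assms(1)]) (use that in \<open>auto intro!: Cons.prems lrel_refl\<close>)
  ultimately show ?case
    by (auto simp: qimage_def mono_space_def monotone_on_def)
qed

text \<open>Inverse of \<open>unary\<close>. The value \<open>0\<close> is a default outside the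
  image of \<open>unary\<close>; valuations at type \<open>funT\<close> stay inside.\<close>

fun un1 :: "(nat, nat) fn1 \<Rightarrow> nat \<Rightarrow> nat" where
  "un1 (Abs h) n = (case h n of Val m \<Rightarrow> m | Abs _ \<Rightarrow> 0)"
| "un1 (Val m) n = 0"

lemma un1_unary [simp]: "un1 (unary h) = h"
  by (auto simp: unary_def)

definition unaries :: "(nat, nat) fn1 set" where
  "unaries = {unary h | h. mono h}"

lemma unary_in_unaries [simp]: "unary h \<in> unaries \<longleftrightarrow> mono h"
proof -
  have "unary h = unary h' \<Longrightarrow> h = h'" for h' by (metis un1_unary)
  then show ?thesis by (auto simp: unaries_def)
qed

text \<open>Two instances matter: \<open>B = bset\<close> for sizes and the constant
  \<open>nat_qset\<close> for costs. Words range over all of \<open>nat\<close>, so extensionality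
  imposes nothing, and the tagged space consists exactly of the monotone unary functions.\<close>

lemma fst_space1_funT:
  assumes "B WordB = nat_qset"
  shows "fst (space1 bset B funT) = unaries"
proof -
  have "fst (space1 bset B funT) =
      Abs ` {h \<in> UNIV \<rightarrow>\<^sub>E range Val. \<forall>x y. x \<ge> y \<longrightarrow> (\<exists>x' y'. h x = Val x' \<and> h y = Val y' \<and> x' \<ge> y')}"
    by (simp add: assms qimage_def mono_space_def monotone_on_def)
  also have "\<dots> = unaries"
  proof (intro equalityI subsetI)
    fix v :: "(nat, nat) fn1" assume "v \<in> Abs ` {h \<in> UNIV \<rightarrow>\<^sub>E range Val. \<forall>x y. x \<ge> y \<longrightarrow>
      (\<exists>x' y'. h x = Val x' \<and> h y = Val y' \<and> x' \<ge> y')}"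
    then obtain h where v: "v = Abs h"
      and h: "\<forall>x y. x \<ge> y \<longrightarrow> (\<exists>x' y'. h x = Val x' \<and> h y = Val y' \<and> x' \<ge> y')"
      by (elim imageE CollectE conjE)
    note m = h[rule_format]
    have eq: "v = unary (un1 v)"
    proof -
      have "h n = Val (un1 v n)" for n
        using m[of n n] v by auto
      then show ?thesis using v by (simp add: unary_def)
    qed
    have "mono (un1 v)"
    proof (rule monoI)
      fix x y :: nat assume "x \<le> y"
      from m[OF this] show "un1 v x \<le> un1 v y" using v by auto
    qed
    with eq show "v \<in> unaries" by (metis unary_in_unaries)
  next
    fix v assume "v \<in> unaries"
    then obtain h where "v = unary h" "mono h" by (auto simp: unaries_def)
    then show "v \<in> Abs ` {h \<in> UNIV \<rightarrow>\<^sub>E range Val. \<forall>x y. x \<ge> y \<longrightarrow>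
      (\<exists>x' y'. h x = Val x' \<and> h y = Val y' \<and> x' \<ge> y')}"
      by (auto simp: unary_def mono_def)
  qed
  finally show ?thesis .
qed

lemma snd_space1_funT:
  assumes "B WordB = nat_qset"
  shows "snd (space1 bset B funT) (unary g) (unary h) \<longleftrightarrow> (\<forall>n. g n \<ge> h n)"
  using assms by (auto simp: qimage_def mono_space_def bset_def unary_def)

lemma fst_mono_space_funT:
  assumes "B WordB = nat_qset"
    and "\<And>h. mono h \<Longrightarrow> F h \<in> fst Y"
    and "\<And>h h'. \<lbrakk>mono h; mono h'; \<And>n. h' n \<le> h n\<rbrakk> \<Longrightarrow> snd Y (F h) (F h')"
  shows "restrict (\<lambda>v. F (un1 v)) unaries \<in> fst (mono_space (space1 bset B funT) Y)"
proof -
  have "snd Y (F (un1 x)) (F (un1 y))"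
    if xy: "x \<in> unaries" "y \<in> unaries" "snd (space1 bset B funT) x y" for x y
  proof -
    obtain h h' where "x = unary h" "mono h" "y = unary h'" "mono h'"
      using xy by (auto simp: unaries_def)
    then show ?thesis using xy(3) assms(3) snd_space1_funT[of B h h', OF assms(1)]
      by (simp del: space1.simps)
  qed
  then show ?thesis using assms(2)
    by (auto simp: mono_space_def fst_space1_funT[of B, OF assms(1)] monotone_on_def unaries_def
        simp del: space1.simps)
qed

lemma snd_mono_space_funT:
  assumes "B WordB = nat_qset" "\<And>h. mono h \<Longrightarrow> snd Y (F h) (F' h)"
  shows "snd (mono_space (space1 bset B funT) Y)
    (restrict (\<lambda>v. F (un1 v)) unaries) (restrict (\<lambda>v. F' (un1 v)) unaries)"
  using assms(2) by (auto simp: mono_space_def fst_space1_funT[of B, OF assms(1)] unaries_def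
        simp del: space1.simps)

text \<open>\<open>restrict\<close> is there because the elements of \<open>mono_space\<close> are
  extensional functions, here on the set \<open>unaries\<close>. Base-type arguments range over all
  of \<open>nat\<close>, so \<open>build1\<close> can do without it.\<close>

primrec sizeb :: "nat \<Rightarrow> nat \<Rightarrow> ((nat \<Rightarrow> nat) list \<Rightarrow> nat list \<Rightarrow> nat) \<Rightarrow> nat size2" where
  "sizeb 0 n f = SLow (build1 n (f []))"
| "sizeb (Suc k) n f = SAbs (restrict (\<lambda>v. sizeb k n (\<lambda>Hs. f (un1 v # Hs))) unaries)"

primrec costb :: "nat \<Rightarrow> nat \<Rightarrow>
    ((nat \<Rightarrow> nat) list \<Rightarrow> (nat \<Rightarrow> nat) list \<Rightarrow> nat list \<Rightarrow> nat) \<Rightarrow> nat cost2" where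
  "costb 0 n f = CLow (build1 n (f [] []))"
| "costb (Suc k) n f = CAbs1 (restrict (\<lambda>c. restrict (\<lambda>v.
     costb k n (\<lambda>Gs Hs. f (un1 c # Gs) (un1 v # Hs))) unaries) unaries)"

text \<open>Monotonicity is part of the relation: it holds for all elements of the function spaces,
  and together with the pointwise order it yields \<open>h x \<ge> h' y\<close> whenever
  \<open>x \<ge> y\<close>.\<close>

definition frel :: "(nat \<Rightarrow> nat) list \<Rightarrow> (nat \<Rightarrow> nat) list \<Rightarrow> bool" where
  "frel = list_all2 (\<lambda>h h'. mono h \<and> mono h' \<and> (\<forall>n. h n \<ge> h' n))"

lemma frel_Nil [simp]: "frel [] []" by (simp add: frel_def)

lemma frel_Cons [simp]:
  "frel (h # hs) (h' # hs') \<longleftrightarrow> mono h \<and> mono h' \<and> (\<forall>n. h n \<ge> h' n) \<and> frel hs hs'"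
  by (auto simp: frel_def)

lemma frel_refl: "(\<And>h. h \<in> set hs \<Longrightarrow> mono h) \<Longrightarrow> frel hs hs"
  by (auto simp: frel_def intro: list_all2_refl list.rel_refl_strong)

lemma ord_first_ty: "ord (first_ty bs b) \<le> 1"
  by (induction bs) auto

lemma ord_funT_Arrow: "\<not> ord (funT \<leadsto> \<tau>) \<le> 1" "ord funT = 1"
  by auto

lemma size_space_low: "ord \<sigma> \<le> 1 \<Longrightarrow> size_space A \<sigma> = qimage SLow (size_space1 A \<sigma>)"
  by (cases \<sigma>) auto

lemma cost_space_low: "ord \<sigma> \<le> 1 \<Longrightarrow> cost_space A \<sigma> = qimage CLow (cost_space1 A \<sigma>)"
  by (cases \<sigma>) auto

lemma size_space_funT: "size_space A (funT \<leadsto> \<tau>) =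
    qimage SAbs (mono_space (size_space1 A funT) (size_space A \<tau>))"
  using ord_funT_Arrow(1)[of \<tau>] by (simp del: ord.simps space1.simps)

lemma cost_space_funT: "cost_space A (funT \<leadsto> \<tau>) =
    qimage CAbs1 (mono_space (cost_space1 A funT) (mono_space (size_space1 A funT) (cost_space A \<tau>)))"
  using ord_funT_Arrow(1)[of \<tau>] by (simp del: ord.simps space1.simps add: ord_funT_Arrow(2))

lemma fun_ty_0: "fun_ty 0 bs b = first_ty bs b"
  and fun_ty_Suc: "fun_ty (Suc k) bs b = funT \<leadsto> fun_ty k bs b"
  by (simp_all add: fun_ty_def)

lemma bset_WordB: "bset WordB = nat_qset"
  by (auto simp: bset_def)

lemma snd_size_space_sizeb:
  assumes "\<And>Hs xs. \<lbrakk>length Hs = k; \<And>h. h \<in> set Hs \<Longrightarrow> mono h; length xs = length bs\<rbrakk>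
      \<Longrightarrow> relb b (f Hs xs) (g Hs xs)"
  shows "snd (size_space bset (fun_ty k bs b)) (sizeb k (length bs) f) (sizeb k (length bs) g)"
  using assms
proof (induction k arbitrary: f g)
  case 0
  have "snd (size_space1 bset (first_ty bs b)) (build1 (length bs) (f [])) (build1 (length bs) (g []))"
    by (rule snd_space1_build1) (use 0 in \<open>auto simp: bset_def\<close>)
  then show ?case by (auto simp: fun_ty_0 size_space_low[OF ord_first_ty] qimage_def)
next
  case (Suc k)
  have "snd (size_space bset (fun_ty k bs b)) (sizeb k (length bs) (\<lambda>Hs. f (h # Hs)))
      (sizeb k (length bs) (\<lambda>Hs. g (h # Hs)))" if "mono h" for h
    by (rule Suc.IH) (use that in \<open>auto intro!: Suc.prems\<close>)
  then have "snd (mono_space (size_space1 bset funT) (size_space bset (fun_ty k bs b)))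
      (restrict (\<lambda>v. sizeb k (length bs) (\<lambda>Hs. f (un1 v # Hs))) unaries)
      (restrict (\<lambda>v. sizeb k (length bs) (\<lambda>Hs. g (un1 v # Hs))) unaries)"
    by (rule snd_mono_space_funT[where B = bset, OF bset_WordB])
  then show ?case unfolding fun_ty_Suc size_space_funT by (auto simp: qimage_def)
qed

text \<open>By induction on the number of function arguments. Monotonicity in the first argument is
  a pointwise comparison of two functions of the remaining ones, which
  \<open>snd_size_space_sizeb\<close> supplies.\<close>

lemma fst_size_space_sizeb:
  assumes "\<And>Hs Hs' xs xs'. \<lbrakk>length Hs = k; frel Hs Hs'; lrel bs xs xs'\<rbrakk>
      \<Longrightarrow> relb b (f Hs xs) (f Hs' xs')"
  shows "sizeb k (length bs) f \<in> fst (size_space bset (fun_ty k bs b))"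
  using assms
proof (induction k arbitrary: f)
  case 0
  have "build1 (length bs) (f []) \<in> fst (size_space1 bset (first_ty bs b))"
    by (rule fst_space1_build1) (use 0 in \<open>auto simp: bset_def\<close>)
  then show ?case by (auto simp: fun_ty_0 size_space_low[OF ord_first_ty] qimage_def)
next
  case (Suc k)
  let ?F = "\<lambda>h. sizeb k (length bs) (\<lambda>Hs. f (h # Hs))"
  have "?F h \<in> fst (size_space bset (fun_ty k bs b))" if "mono h" for h
    by (rule Suc.IH) (use that in \<open>auto intro!: Suc.prems\<close>)
  moreover have "snd (size_space bset (fun_ty k bs b)) (?F h) (?F h')"
    if "mono h" "mono h'" "\<And>n. h' n \<le> h n" for h h'
    by (rule snd_size_space_sizeb)
      (use that in \<open>auto intro!: Suc.prems frel_refl lrel_refl\<close>)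
  ultimately have "restrict (\<lambda>v. ?F (un1 v)) unaries
      \<in> fst (mono_space (size_space1 bset funT) (size_space bset (fun_ty k bs b)))"
    by (rule fst_mono_space_funT[where B = bset, OF bset_WordB])
  then show ?case unfolding fun_ty_Suc size_space_funT by (auto simp: qimage_def)
qed

lemma snd_cost_space_costb:
  assumes "\<And>Gs Hs xs. \<lbrakk>length Gs = k; length Hs = k; \<And>h. h \<in> set Gs \<union> set Hs \<Longrightarrow> mono h;
      length xs = length bs\<rbrakk> \<Longrightarrow> f Gs Hs xs \<ge> g Gs Hs xs"
  shows "snd (cost_space bset (fun_ty k bs b)) (costb k (length bs) f) (costb k (length bs) g)"
  using assms
proof (induction k arbitrary: f g)
  case 0
  have "snd (cost_space1 bset (first_ty bs b)) (build1 (length bs) (f [] [])) (build1 (length bs) (g [] []))"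
    by (rule snd_space1_build1) (use 0 in \<open>auto simp: bset_def\<close>)
  then show ?case by (auto simp: fun_ty_0 cost_space_low[OF ord_first_ty] qimage_def)
next
  case (Suc k)
  have "snd (cost_space bset (fun_ty k bs b)) (costb k (length bs) (\<lambda>Gs Hs. f (c # Gs) (h # Hs)))
      (costb k (length bs) (\<lambda>Gs Hs. g (c # Gs) (h # Hs)))" if "mono c" "mono h" for c h
    by (rule Suc.IH) (use that in \<open>auto intro!: Suc.prems\<close>)
  then have "snd (mono_space (cost_space1 bset funT) (mono_space (size_space1 bset funT) (cost_space bset (fun_ty k bs b))))
      (restrict (\<lambda>c. restrict (\<lambda>v. costb k (length bs) (\<lambda>Gs Hs. f (un1 c # Gs) (un1 v # Hs))) unaries) unaries)
      (restrict (\<lambda>c. restrict (\<lambda>v. costb k (length bs) (\<lambda>Gs Hs. g (un1 c # Gs) (un1 v # Hs))) unaries) unaries)"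
    by (intro snd_mono_space_funT[where B = "\<lambda>_. nat_qset", OF refl] snd_mono_space_funT[where B = bset, OF bset_WordB])
  then show ?case unfolding fun_ty_Suc cost_space_funT by (auto simp: qimage_def)
qed

lemma fst_cost_space_costb:
  assumes "\<And>Gs Gs' Hs Hs' xs xs'. \<lbrakk>length Gs = k; length Hs = k; frel Gs Gs'; frel Hs Hs';
      lrel bs xs xs'\<rbrakk> \<Longrightarrow> f Gs Hs xs \<ge> f Gs' Hs' xs'"
  shows "costb k (length bs) f \<in> fst (cost_space bset (fun_ty k bs b))"
  using assms
proof (induction k arbitrary: f)
  case 0
  have "build1 (length bs) (f [] []) \<in> fst (cost_space1 bset (first_ty bs b))"
    by (rule fst_space1_build1) (use 0 in \<open>auto simp: bset_def\<close>)
  then show ?case by (auto simp: fun_ty_0 cost_space_low[OF ord_first_ty] qimage_def)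
next
  case (Suc k)
  let ?F = "\<lambda>c h. costb k (length bs) (\<lambda>Gs Hs. f (c # Gs) (h # Hs))"
  have "?F c h \<in> fst (cost_space bset (fun_ty k bs b))" if "mono c" "mono h" for c h
    by (rule Suc.IH) (use that in \<open>auto intro!: Suc.prems\<close>)
  moreover have "snd (cost_space bset (fun_ty k bs b)) (?F c h) (?F c' h')"
    if "mono c" "mono c'" "\<And>n. c' n \<le> c n" "mono h" "mono h'" "\<And>n. h' n \<le> h n" for c c' h h'
    by (rule snd_cost_space_costb)
      (use that in \<open>auto intro!: Suc.prems frel_refl lrel_refl\<close>)
  ultimately have "restrict (\<lambda>c. restrict (\<lambda>v. ?F (un1 c) (un1 v)) unaries) unaries
      \<in> fst (mono_space (cost_space1 bset funT)
          (mono_space (size_space1 bset funT) (cost_space bset (fun_ty k bs b))))"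
    by (intro fst_mono_space_funT[where B = "\<lambda>_. nat_qset", OF refl] fst_mono_space_funT[where B = bset, OF bset_WordB]
        snd_mono_space_funT[where B = bset, OF bset_WordB]) auto
  then show ?case unfolding fun_ty_Suc cost_space_funT by (auto simp: qimage_def)
qed

lemma sapp_build1:
  "length xs = n \<Longrightarrow> foldl sapp (SLow (build1 n f)) (map Val xs) = SLow (Val (f xs))"
  by (induction xs arbitrary: n f) auto

lemma sapp_sizeb:
  assumes "length Hs = k" "length xs = n" "\<And>h. h \<in> set Hs \<Longrightarrow> mono h"
  shows "foldl sapp (sizeb k n f) (map unary Hs @ map Val xs) = SLow (Val (f Hs xs))"
  using assms
proof (induction Hs arbitrary: k f)
  case (Cons h Hs)
  then obtain k' where "k = Suc k'" by auto
  with Cons show ?case by simp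
qed (auto simp: sapp_build1)

lemma capp_build1:
  "length ps = n \<Longrightarrow> map snd ps = map Val xs \<Longrightarrow>
    foldl (\<lambda>j (c, v). capp j c v) (CLow (build1 n f)) ps = CLow (Val (f xs))"
  by (induction ps arbitrary: n f xs) auto

text \<open>The first components of \<open>ps\<close> are arbitrary because \<open>capp\<close>
  discards the cost of a base-type argument. This covers both the costs of subterms in
  \<open>tcost\<close> and the \<open>Val 0\<close> in \<open>main_cost\<close>.\<close>

lemma capp_costb:
  assumes "length Gs = k" "length Hs = k" "length ps = n" "map snd ps = map Val xs"
    and "\<And>h. h \<in> set Gs \<union> set Hs \<Longrightarrow> mono h"
  shows "foldl (\<lambda>j (c, v). capp j c v) (costb k n f) (zip (map unary Gs) (map unary Hs) @ ps)
    = CLow (Val (f Gs Hs xs))"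
  using assms
proof (induction Hs arbitrary: Gs k f)
  case (Cons h Hs)
  then obtain k' g Gs' where "k = Suc k'" "Gs = g # Gs'" by (cases Gs) auto
  with Cons show ?case by simp
qed (auto simp: capp_build1)

type_synonym size_fun = "symb \<Rightarrow> (nat \<Rightarrow> nat) list \<Rightarrow> nat list \<Rightarrow> nat"
type_synonym cost_fun = "symb \<Rightarrow> (nat \<Rightarrow> nat) list \<Rightarrow> (nat \<Rightarrow> nat) list \<Rightarrow> nat list \<Rightarrow> nat"

definition interp_of :: "arity \<Rightarrow> size_fun \<Rightarrow> cost_fun \<Rightarrow> nat interp" where
  "interp_of ar S C =
     \<lparr>base_set = bset,
      size_of_sym = (\<lambda>g. case ar g of Some (k, bs, b) \<Rightarrow> sizeb k (length bs) (S g) | None \<Rightarrow> undefined),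
      cost_of_sym = (\<lambda>g. case ar g of Some (k, bs, b) \<Rightarrow> costb k (length bs) (C g) | None \<Rightarrow> undefined)\<rparr>"

lemma size_of_sym_interp: "ar g = Some (k, bs, b) \<Longrightarrow>
    size_of_sym (interp_of ar S C) g = sizeb k (length bs) (S g)"
  and cost_of_sym_interp: "ar g = Some (k, bs, b) \<Longrightarrow>
    cost_of_sym (interp_of ar S C) g = costb k (length bs) (C g)"
  by (simp_all add: interp_of_def)

lemma cost_size_interp_of:
  assumes "\<And>g k bs b Hs Hs' xs xs'. \<lbrakk>ar g = Some (k, bs, b); length Hs = k; frel Hs Hs'; lrel bs xs xs'\<rbrakk>
      \<Longrightarrow> relb b (S g Hs xs) (S g Hs' xs')"
    and "\<And>g k bs b Gs Gs' Hs Hs' xs xs'. \<lbrakk>ar g = Some (k, bs, b); length Gs = k; length Hs = k;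
      frel Gs Gs'; frel Hs Hs'; lrel bs xs xs'\<rbrakk> \<Longrightarrow> C g Gs Hs xs \<ge> C g Gs' Hs' xs'"
  shows "cost_size_interp (sig_of ar) (interp_of ar S C)"
  unfolding cost_size_interp_def
proof (intro conjI allI impI)
  fix g \<sigma> assume "sig_of ar g = Some \<sigma>"
  then obtain k bs b where *: "ar g = Some (k, bs, b)" "\<sigma> = fun_ty k bs b"
    by (auto simp: sig_of_def)
  show "size_of_sym (interp_of ar S C) g \<in> fst (size_space (base_set (interp_of ar S C)) \<sigma>)"
    using fst_size_space_sizeb[of k bs b "S g"] assms(1)[OF *(1)] * by (simp add: interp_of_def)
  show "cost_of_sym (interp_of ar S C) g \<in> fst (cost_space (base_set (interp_of ar S C)) \<sigma>)"
    using fst_cost_space_costb[of k bs "C g" b] assms(2)[OF *(1)] * by (simp add: interp_of_def)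
qed (simp add: interp_of_def quasi_ordered_bset)

section \<open>Sizes and costs of fully applied terms as natural numbers\<close>

primrec psize :: "size_fun \<Rightarrow> (nat \<Rightarrow> nat \<Rightarrow> nat) \<Rightarrow> (nat \<Rightarrow> base \<Rightarrow> nat) \<Rightarrow> pt \<Rightarrow> nat" where
  "psize S H V (PV n b) = V n b"
| "psize S H V (PF i t) = H i (psize S H V t)"
| "psize S H V (PS g js ts) = S g (map H js) (map (psize S H V) ts)"

text \<open>The value \<open>0\<close> for variables is arbitrary: their cost is never counted.\<close>

primrec pcost :: "size_fun \<Rightarrow> cost_fun \<Rightarrow> (nat \<Rightarrow> nat \<Rightarrow> nat) \<Rightarrow> (nat \<Rightarrow> nat \<Rightarrow> nat) \<Rightarrow>
    (nat \<Rightarrow> base \<Rightarrow> nat) \<Rightarrow> pt \<Rightarrow> nat" where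
  "pcost S C G H V (PV n b) = 0"
| "pcost S C G H V (PF i t) = G i (psize S H V t)"
| "pcost S C G H V (PS g js ts) = C g (map G js) (map H js) (map (psize S H V) ts)"

primrec ptotal :: "size_fun \<Rightarrow> cost_fun \<Rightarrow> (nat \<Rightarrow> nat \<Rightarrow> nat) \<Rightarrow> (nat \<Rightarrow> nat \<Rightarrow> nat) \<Rightarrow>
    (nat \<Rightarrow> base \<Rightarrow> nat) \<Rightarrow> pt \<Rightarrow> nat" where
  "ptotal S C G H V (PV n b) = 0"
| "ptotal S C G H V (PF i t) = G i (psize S H V t) + ptotal S C G H V t"
| "ptotal S C G H V (PS g js ts) = C g (map G js) (map H js) (map (psize S H V) ts)
     + sum_list (map (ptotal S C G H V) ts)"

lemma tsize_apps: "tsize J \<alpha> (apps s ts) = foldl sapp (tsize J \<alpha> s) (map (slow \<circ> tsize J \<alpha>) ts)"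
  by (induction ts arbitrary: s) auto

lemma tcost_apps: "tcost J \<alpha> \<zeta> (apps s ts) = foldl (\<lambda>j (c, v). capp j c v) (tcost J \<alpha> \<zeta> s)
    (map (\<lambda>t. (clow (tcost J \<alpha> \<zeta> t), slow (tsize J \<alpha> t))) ts)"
  by (induction ts arbitrary: s) auto

definition base_cost :: "signature \<Rightarrow> nat interp \<Rightarrow> nat svaluation \<Rightarrow> nat cvaluation \<Rightarrow> trm \<Rightarrow> nat" where
  "base_cost \<Sigma> J \<alpha> \<zeta> s = (if \<not> is_Var s \<and> (\<exists>\<iota>. type_of \<Sigma> s = Some (Base \<iota>)) then cval (tcost J \<alpha> \<zeta> s) else 0)"

lemma total_cost_simps:
  "total_cost \<Sigma> J \<alpha> \<zeta> (Var n \<sigma>) = 0"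
  "total_cost \<Sigma> J \<alpha> \<zeta> (Sym g) = base_cost \<Sigma> J \<alpha> \<zeta> (Sym g)"
  "total_cost \<Sigma> J \<alpha> \<zeta> (App s t) =
     base_cost \<Sigma> J \<alpha> \<zeta> (App s t) + total_cost \<Sigma> J \<alpha> \<zeta> s + total_cost \<Sigma> J \<alpha> \<zeta> t"
  by (simp_all add: total_cost_def base_cost_def del: type_of.simps)

text \<open>Proper prefixes of the application have an arrow type and contribute nothing, so along
  the spine only the full application can count.\<close>

lemma total_cost_apps:
  assumes "\<Sigma> g = Some (foldr Arrow (tys @ rest) (Base b))" "map (type_of \<Sigma>) args = map Some tys"
  shows "total_cost \<Sigma> J \<alpha> \<zeta> (apps (Sym g) args) =
    base_cost \<Sigma> J \<alpha> \<zeta> (apps (Sym g) args) + sum_list (map (total_cost \<Sigma> J \<alpha> \<zeta>) args)"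
  using assms
proof (induction args arbitrary: tys rest rule: rev_induct)
  case (snoc a as)
  then obtain tys' \<sigma> where tys: "tys = tys' @ [\<sigma>]" "map (type_of \<Sigma>) as = map Some tys'"
    by (cases tys rule: rev_cases) auto
  have "type_of \<Sigma> (apps (Sym g) as) = Some (foldr Arrow (\<sigma> # rest) (Base b))"
    by (rule type_of_apps[OF _ tys(2)]) (use snoc.prems tys in simp)
  then have "base_cost \<Sigma> J \<alpha> \<zeta> (apps (Sym g) as) = 0" by (simp add: base_cost_def)
  with snoc.IH[of tys' "\<sigma> # rest"] snoc.prems tys show ?case
    by (simp add: total_cost_simps)
qed (simp add: total_cost_simps)

context
  fixes ar S C \<alpha> \<zeta> J H G V
  assumes J: "J = interp_of ar S C"
    and val: "valuations bset \<alpha> \<zeta>"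
    and H: "H = (\<lambda>i. un1 (\<alpha> i funT))" and G: "G = (\<lambda>i. un1 (\<zeta> i funT))"
    and V: "V = (\<lambda>n b. case \<alpha> n (Base b) of Val x \<Rightarrow> x)"
begin

lemma val_funT: "\<alpha> i funT = unary (H i)" "mono (H i)" "\<zeta> i funT = unary (G i)" "mono (G i)"
proof -
  have "\<alpha> i funT \<in> unaries" "\<zeta> i funT \<in> unaries"
    using val fst_space1_funT[of bset, OF bset_WordB] fst_space1_funT[of "\<lambda>_. nat_qset", OF refl]
    by (auto simp: valuations_def simp del: space1.simps)
  then show "\<alpha> i funT = unary (H i)" "mono (H i)" "\<zeta> i funT = unary (G i)" "mono (G i)"
    unfolding H G unaries_def by force+
qed

lemma val_Base: "\<alpha> n (Base b) = Val (V n b)"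
proof -
  have "\<forall>n \<sigma>. ord \<sigma> \<le> 1 \<longrightarrow> \<alpha> n \<sigma> \<in> fst (size_space1 bset \<sigma>)"
    using val by (auto simp: valuations_def)
  from this[rule_format, of "Base b" n] show ?thesis by (auto simp: V qimage_def)
qed

lemma tsize_tr:
  assumes "ptype ar t = Some b"
  shows "tsize J \<alpha> (tr t) = SLow (Val (psize S H V t))"
  using assms
proof (induction t arbitrary: b)
  case (PF i t)
  then show ?case by (auto simp: val_funT(1) unary_def split: if_splits)
next
  case (PS g js ts)
  obtain k bs where g: "ar g = Some (k, bs, b)" "length js = k" and len: "length ts = length bs"
    and ty: "list_all2 (\<lambda>t b. ptype ar t = Some b) ts bs"
    using PS.prems by (rule ptype_PS)
  have "tsize J \<alpha> (tr t) = SLow (Val (psize S H V t))" if "t \<in> set ts" for t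
    using PS.IH[OF that] ty that by (auto simp: list_all2_conv_all_nth in_set_conv_nth)
  then have args: "map (slow \<circ> tsize J \<alpha>) (map (\<lambda>i. Var i funT) js @ map tr ts)
      = map unary (map H js) @ map Val (map (psize S H V) ts)"
    by (auto simp: val_funT)
  have "foldl sapp (sizeb k (length bs) (S g)) (map unary (map H js) @ map Val (map (psize S H V) ts))
      = SLow (Val (S g (map H js) (map (psize S H V) ts)))"
    by (rule sapp_sizeb) (use g len val_funT in auto)
  then show ?case
    using size_of_sym_interp[where ar = ar, OF g(1), of S C]
    by (simp only: tr.simps tsize_apps args[unfolded J] J tsize.simps psize.simps)
qed (simp add: val_Base)

lemma tcost_tr:
  assumes "ptype ar t = Some b" "\<not> is_Var (tr t)"
  shows "tcost J \<alpha> \<zeta> (tr t) = CLow (Val (pcost S C G H V t))"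
proof (cases t)
  case (PV n b)
  then show ?thesis using assms by simp
next
  case (PF i t')
  then show ?thesis using assms tsize_tr[of t' b]
    by (auto simp: val_funT(3) unary_def split: if_splits)
next
  case (PS g js ts)
  obtain k bs where g: "ar g = Some (k, bs, b)" "length js = k" and len: "length ts = length bs"
    and ty: "list_all2 (\<lambda>t b. ptype ar t = Some b) ts bs"
    using assms(1)[unfolded PS] by (rule ptype_PS)
  have "tsize J \<alpha> (tr t) = SLow (Val (psize S H V t))" if "t \<in> set ts" for t
    using tsize_tr ty that by (auto simp: list_all2_conv_all_nth in_set_conv_nth)
  then have 1: "map snd (map (\<lambda>t. (clow (tcost J \<alpha> \<zeta> t), slow (tsize J \<alpha> t))) (map tr ts))
      = map Val (map (psize S H V) ts)" by auto
  have 2: "map (\<lambda>t. (clow (tcost J \<alpha> \<zeta> t), slow (tsize J \<alpha> t))) (map (\<lambda>i. Var i funT) js) =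
      zip (map unary (map G js)) (map unary (map H js))"
    by (simp add: val_funT zip_map_map zip_same_conv_map)
  have "foldl (\<lambda>j (c, v). capp j c v) (costb k (length bs) (C g))
      (zip (map unary (map G js)) (map unary (map H js)) @
       map (\<lambda>t. (clow (tcost J \<alpha> \<zeta> t), slow (tsize J \<alpha> t))) (map tr ts))
      = CLow (Val (C g (map G js) (map H js) (map (psize S H V) ts)))"
    by (rule capp_costb[OF _ _ _ 1]) (use g len val_funT in auto)
  then show ?thesis
    using cost_of_sym_interp[where ar = ar, OF g(1), of S C]
    by (simp only: PS tr.simps tcost_apps map_append 2[unfolded J] J tcost.simps pcost.simps)
qed

lemma total_cost_tr:
  assumes "sig_of ar \<subseteq>\<^sub>m \<Sigma>" "ptype ar t = Some b"
  shows "total_cost \<Sigma> J \<alpha> \<zeta> (tr t) = ptotal S C G H V t"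
  using assms(2)
proof (induction t arbitrary: b)
  case (PF i t)
  then have t: "ptype ar t = Some WordB" by (auto split: if_splits)
  have "type_of \<Sigma> (tr (PF i t)) = Some (Base b)" by (rule type_of_tr[OF assms(1) PF.prems])
  then have "base_cost \<Sigma> J \<alpha> \<zeta> (tr (PF i t)) = pcost S C G H V (PF i t)"
    using tcost_tr[OF PF.prems] by (simp add: base_cost_def del: tcost.simps type_of.simps)
  then show ?case using PF.IH[OF t] by (simp add: total_cost_simps)
next
  case (PS g js ts)
  obtain k bs where g: "ar g = Some (k, bs, b)" "length js = k" and len: "length ts = length bs"
    and ty: "list_all2 (\<lambda>t b. ptype ar t = Some b) ts bs"
    using PS.prems by (rule ptype_PS)
  have nth: "ptype ar (ts ! i) = Some (bs ! i)" if "i < length ts" for i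
    using ty that by (simp add: list_all2_conv_all_nth)
  have "total_cost \<Sigma> J \<alpha> \<zeta> (tr t) = ptotal S C G H V t" if "t \<in> set ts" for t
    using that nth PS.IH[OF that] by (auto simp: in_set_conv_nth)
  then have 1: "map (total_cost \<Sigma> J \<alpha> \<zeta> \<circ> tr) ts = map (ptotal S C G H V) ts" by simp
  have 2: "\<Sigma> g = Some (foldr Arrow ((replicate k funT @ map Base bs) @ []) (Base b))"
  proof -
    have "sig_of ar g = Some (fun_ty k bs b)" using g(1) by (simp add: sig_of_def)
    then show ?thesis using assms(1) by (metis append_Nil2 domI fun_ty_def map_le_def)
  qed
  have 3: "map (type_of \<Sigma>) (map (\<lambda>i. Var i funT) js @ map tr ts) = map Some (replicate k funT @ map Base bs)"
    using g(2) nth type_of_tr[OF assms(1)] len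
    by (auto simp: map_replicate_const comp_def intro!: nth_equalityI)
  have 4: "\<not> is_Var (tr (PS g js ts))"
    by (cases "map (\<lambda>i. Var i funT) js @ map tr ts" rule: rev_cases) (simp_all del: map_append)
  have "sum_list (map (total_cost \<Sigma> J \<alpha> \<zeta>) (map (\<lambda>i. Var i funT) js)) = 0"
    by (induction js) (auto simp: total_cost_simps)
  moreover have "base_cost \<Sigma> J \<alpha> \<zeta> (tr (PS g js ts)) = pcost S C G H V (PS g js ts)"
    using tcost_tr[OF PS.prems 4] type_of_tr[OF assms(1) PS.prems] 4
    by (simp add: base_cost_def del: tr.simps)
  ultimately show ?case using total_cost_apps[OF 2 3, of J \<alpha> \<zeta>] 1 by simp
qed (simp add: total_cost_simps)

end

text \<open>Turns compatibility into inequalities between natural numbers. A valuation enters only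
  through the monotone functions \<open>G\<close> and \<open>H\<close> and the numbers
  \<open>V\<close> decoded from it.\<close>

lemma compatible_interp_of:
  assumes "\<And>\<l> r. (\<l>, r) \<in> R \<Longrightarrow> \<not> is_Var (tr \<l>) \<and> (\<exists>b. ptype ar \<l> = Some b \<and> ptype ar r = Some b)"
    and "\<And>\<l> r b G H V. (\<lbrakk>(\<l>, r) \<in> R; ptype ar \<l> = Some b; \<And>i. mono (G i); \<And>i. mono (H i)\<rbrakk> \<Longrightarrow>
      pcost S C G H V \<l> > ptotal S C G H V r \<and> relb b (psize S H V \<l>) (psize S H V r))"
  shows "compatible (sig_of ar) ((\<lambda>(\<l>, r). (tr \<l>, tr r)) ` R) (interp_of ar S C)"
proof -
  { fix \<l> r \<alpha> \<zeta>
    assume lr: "(\<l>, r) \<in> R" and val: "valuations bset \<alpha> \<zeta>"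
    obtain b where v: "\<not> is_Var (tr \<l>)" and b: "ptype ar \<l> = Some b" "ptype ar r = Some b"
      using assms(1)[OF lr] by blast
    let ?J = "interp_of ar S C"
    let ?H = "\<lambda>i. un1 (\<alpha> i funT)" and ?G = "\<lambda>i. un1 (\<zeta> i funT)"
      and ?V = "\<lambda>n b. case \<alpha> n (Base b) of Val x \<Rightarrow> x"
    have m: "mono (?H i)" "mono (?G i)" for i
      using val_funT[OF refl val refl refl refl] by auto
    have 1: "tcost ?J \<alpha> \<zeta> (tr \<l>) = CLow (Val (pcost S C ?G ?H ?V \<l>))"
      by (rule tcost_tr[OF refl val refl refl refl b(1) v])
    have 2: "total_cost (sig_of ar) ?J \<alpha> \<zeta> (tr r) = ptotal S C ?G ?H ?V r"
      by (rule total_cost_tr[OF refl val refl refl refl _ b(2)]) simp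
    have 3: "tsize ?J \<alpha> (tr \<l>) = SLow (Val (psize S ?H ?V \<l>))"
      "tsize ?J \<alpha> (tr r) = SLow (Val (psize S ?H ?V r))"
      using tsize_tr[OF refl val refl refl refl] b by auto
    have 4: "type_of (sig_of ar) (tr \<l>) = Some (Base b)"
      by (rule type_of_tr[OF _ b(1)]) simp
    have "pcost S C ?G ?H ?V \<l> > ptotal S C ?G ?H ?V r \<and> relb b (psize S ?H ?V \<l>) (psize S ?H ?V r)"
      by (rule assms(2)[OF lr b(1) m(2) m(1)])
    then have "cval (tcost ?J \<alpha> \<zeta> (tr \<l>)) > total_cost (sig_of ar) ?J \<alpha> \<zeta> (tr r) \<and>
      (\<forall>\<iota>. type_of (sig_of ar) (tr \<l>) = Some (Base \<iota>) \<longrightarrow>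
         snd (size_space bset (Base \<iota>)) (tsize ?J \<alpha> (tr \<l>)) (tsize ?J \<alpha> (tr r)))"
      using 1 2 3 4 by (auto simp: qimage_def)
  }
  then show ?thesis unfolding compatible_def
    by (auto simp: interp_of_def simp del: size_space.simps)
qed

subsection \<open>The rewriting system of an oracle Turing machine\<close>

abbreviation "histB \<equiv> OtherB 0"
abbreviation "stkB \<equiv> OtherB 5"
abbreviation "symB \<equiv> OtherB 2"
abbreviation "tapeB \<equiv> OtherB 3"
abbreviation "stateB \<equiv> OtherB 4"

text \<open>
  A tape is a zipper of two stacks of cells. The stack \<open>inp w s\<close> stands for the bits of \<open>w\<close>, a
  blank, and the cells of \<open>s\<close>; it is unpacked on demand, which avoids copying words onto tapes.
\<close>

abbreviation "appS \<equiv> Aux 0"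
abbreviation "mulS \<equiv> Aux 18"
abbreviation "mxS \<equiv> Aux 2"
abbreviation "limS \<equiv> Aux 3"
abbreviation "drpS \<equiv> Aux 4"
abbreviation "tryS \<equiv> Aux 5"
abbreviation "hnilS \<equiv> Aux 6"
abbreviation "hconsS \<equiv> Aux 7"
abbreviation "botS \<equiv> Aux 8"
abbreviation "pushS \<equiv> Aux 9"
abbreviation "inpS \<equiv> Aux 10"
abbreviation "tapeS \<equiv> Aux 11"
abbreviation "popS \<equiv> Aux 12"
abbreviation "pullS \<equiv> Aux 13"
abbreviation "readS \<equiv> Aux 14"
abbreviation "rewS \<equiv> Aux 15"
abbreviation "runS \<equiv> Aux 16"
abbreviation "goS \<equiv> Aux 17"

primrec tcode :: "tsym \<Rightarrow> nat" where
  "tcode Blank = 0"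
| "tcode (Bit b) = (if b then 1 else 2)"
| "tcode (Extra n) = n + 3"

lemma inj_tcode: "tcode a = tcode b \<Longrightarrow> a = b"
  by (cases a; cases b) (auto split: if_splits)

text \<open>Tape symbols get even codes and states odd codes, all at least \<open>100\<close>; the
  other auxiliary symbols lie below \<open>100\<close>.\<close>

definition symS :: "tsym \<Rightarrow> symb" where "symS a = Aux (2 * tcode a + 100)"
definition stateS :: "nat \<Rightarrow> symb" where "stateS q = Aux (2 * q + 101)"

lemma symS_eq [simp]: "symS a = symS b \<longleftrightarrow> a = b"
  using inj_tcode by (auto simp: symS_def)

lemma stateS_eq [simp]: "stateS a = stateS b \<longleftrightarrow> a = b"
  by (auto simp: stateS_def)

lemma symS_neq [simp]: "n < 100 \<Longrightarrow> symS a \<noteq> Aux n" "symS a \<noteq> stateS q" "symS a \<noteq> SymO"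
    "symS a \<noteq> SymI" "symS a \<noteq> SymNil" "symS a \<noteq> SymCons" "symS a \<noteq> SymF" "symS a \<noteq> Oracle f"
  and stateS_neq [simp]: "n < 100 \<Longrightarrow> stateS q \<noteq> Aux n" "stateS q \<noteq> symS a" "stateS q \<noteq> SymO"
    "stateS q \<noteq> SymI" "stateS q \<noteq> SymNil" "stateS q \<noteq> SymCons" "stateS q \<noteq> SymF" "stateS q \<noteq> Oracle f"
proof -
  have "2 * x + 100 \<noteq> 2 * q + (101::nat)" for x q by presburger
  then show "symS a \<noteq> stateS q" "stateS q \<noteq> symS a" by (metis stateS_def symS_def symb.inject(1))+
qed (auto simp: symS_def stateS_def)

lemmas symS_neq_sym [simp] = symS_neq[symmetric]
lemmas stateS_neq_sym [simp] = stateS_neq[symmetric]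

definition bitp :: "bool \<Rightarrow> pt" where "bitp b = PS (if b then SymI else SymO) [] []"
abbreviation "nilp \<equiv> PS SymNil [] []"
abbreviation "consp y m \<equiv> PS SymCons [] [y, m]"
abbreviation "appp m n \<equiv> PS appS [] [m, n]"
abbreviation "mulp m n \<equiv> PS mulS [] [m, n]"
abbreviation "mxp m n \<equiv> PS mxS [] [m, n]"
abbreviation "limp m n \<equiv> PS limS [] [m, n]"
abbreviation "drpp h n \<equiv> PS drpS [] [h, n]"
abbreviation "tryp i h n \<equiv> PS tryS [i] [h, n]"
abbreviation "hnilp \<equiv> PS hnilS [] []"
abbreviation "hconsp m h \<equiv> PS hconsS [] [m, h]"
abbreviation "botp \<equiv> PS botS [] []"
abbreviation "pushp c s \<equiv> PS pushS [] [c, s]"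
abbreviation "inpp m s \<equiv> PS inpS [] [m, s]"
abbreviation "tapep s c r \<equiv> PS tapeS [] [s, c, r]"
abbreviation "popp s r \<equiv> PS popS [] [s, r]"
abbreviation "pullp s c r \<equiv> PS pullS [] [s, c, r]"
abbreviation "readp n s \<equiv> PS readS [] [n, s]"
abbreviation "rewp m n s r \<equiv> PS rewS [] [m, n, s, r]"
abbreviation "cellp c \<equiv> PS (symS c) [] []"
abbreviation "statep q \<equiv> PS (stateS q) [] []"

type_synonym prule = "pt \<times> pt"

abbreviation "vm \<equiv> PV 0 WordB"
abbreviation "vn \<equiv> PV 2 WordB"
abbreviation "vy \<equiv> PV 0 BitB"
abbreviation "vz \<equiv> PV 2 BitB"
abbreviation "vh \<equiv> PV 0 histB"
abbreviation "vs \<equiv> PV 0 stkB"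
abbreviation "vr \<equiv> PV 2 stkB"
abbreviation "vc \<equiv> PV 0 symB"
abbreviation "vd \<equiv> PV 2 symB"

definition app_rules :: "prule set" where
  "app_rules = {(appp nilp vn, vn), (appp (consp vy vm) vn, consp vy (appp vm vn))}"

definition mul_rules :: "prule set" where
  "mul_rules = {(mulp nilp vn, nilp), (mulp (consp vy vm) vn, appp vn (mulp vm vn))}"

text \<open>Only the length of the result matters. The last rule emits \<open>False\<close> because
  copying \<open>vy\<close> would break the size condition: with bit sizes \<open>y\<close> and
  \<open>z\<close>, the sum \<open>y + max m n + 1\<close> may exceed
  \<open>max (y + m + 1) (z + n + 1)\<close>.\<close>

definition mx_rules :: "prule set" where
  "mx_rules = {(mxp nilp vn, vn), (mxp (consp vy vm) nilp, consp vy vm),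
     (mxp (consp vy vm) (consp vz vn), consp (bitp False) (mxp vm vn))}"

text \<open>The bit to be copied is matched literally and so has size \<open>0\<close>. With a
  variable of size \<open>y\<close> in its place, \<open>y + min m n + 1\<close> could exceed
  \<open>min (y + m + 1) (z + n + 1)\<close>, where \<open>z\<close> is the size of the other
  bit.\<close>

definition lim_rules :: "prule set" where
  "lim_rules = {(limp nilp vn, nilp), (limp (consp vy vm) nilp, nilp)} \<union>
     range (\<lambda>b. (limp (consp (bitp b) vm) (consp vy vn), consp (bitp b) (limp vm vn)))"

definition drp_rules :: "prule set" where
  "drp_rules = {(drpp hnilp vn, vn), (drpp (hconsp vm vh) nilp, nilp),
     (drpp (hconsp vm vh) (consp vy vn), drpp vh vn)}"

text \<open>Because of \<open>lim\<close> the argument of the oracle has size at most that of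
  \<open>vn\<close>, whatever the entry \<open>vm\<close> is. This is why \<open>try\<close> can be
  given a size that does not mention the history.\<close>

definition try_rules :: "prule set" where
  "try_rules = {(tryp 0 hnilp vn, nilp),
     (tryp 0 (hconsp vm vh) vn, mxp (PF 0 (limp vm vn)) (tryp 0 vh vn))}"

text \<open>Builds a tape from its left stack and a stack that begins at the scanned cell. It serves
  moves to the right as well as tapes freshly filled with the input or with an answer; the empty
  stack delivers a blank.\<close>

definition pop_rules :: "prule set" where
  "pop_rules = {(popp vs botp, tapep vs (cellp Blank) botp), (popp vs (pushp vc vr), tapep vs vc vr),
     (popp vs (inpp nilp vr), tapep vs (cellp Blank) vr)} \<union>
     range (\<lambda>b. (popp vs (inpp (consp (bitp b) vm) vr), tapep vs (cellp (Bit b)) (inpp vm vr)))"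

text \<open>On \<open>bot\<close> the head is at cell 0 and stays there. Input blocks occur only in
  right stacks: whatever lies to the left of the head has been pushed cell by cell.\<close>

definition pull_rules :: "prule set" where
  "pull_rules = {(pullp botp vc vr, tapep botp vc vr),
     (pullp (pushp vd vs) vc vr, tapep vs vd (pushp vc vr))}"

text \<open>
  The word arguments of \<open>read\<close> and \<open>rew\<close> are fuel. They bound the cost and the size of the
  extracted word independently of the stacks, whose sizes carry no information.
\<close>

definition read_rules :: "tsym set \<Rightarrow> prule set" where
  "read_rules A = {(readp nilp vs, nilp), (readp (consp vy vn) botp, nilp),
      (readp (consp vy vn) (inpp nilp vs), nilp)} \<union>
     range (\<lambda>b. (readp (consp vy vn) (inpp (consp (bitp b) vm) vs), consp (bitp b) (readp vn (inpp vm vs)))) \<union>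
     range (\<lambda>b. (readp (consp vy vn) (pushp (cellp (Bit b)) vs), consp (bitp b) (readp vn vs))) \<union>
     (\<lambda>c. (readp (consp vy vn) (pushp (cellp c) vs), nilp)) ` (A - range Bit)"

definition rew_rules :: "prule set" where
  "rew_rules = {(rewp vm nilp vs vr, nilp), (rewp vm (consp vy vn) botp vr, readp vm vr),
     (rewp vm (consp vy vn) (pushp vc vs) vr, rewp vm vn vs (pushp vc vr))}"

primrec lit :: "nat \<Rightarrow> pt" where
  "lit 0 = nilp"
| "lit (Suc n) = consp (bitp False) (lit n)"

text \<open>
  The term computing the value of a second-order polynomial at the functions
  \<open>n \<mapsto> Max {|f\<^sub>i (take n a)| | a in the history}\<close>, as the length of a word.
\<close>

primrec theta :: "sopoly \<Rightarrow> pt" where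
  "theta (PConst n) = lit n"
| "theta (PVar j) = PV j WordB"
| "theta (PAdd P Q) = appp (theta P) (theta Q)"
| "theta (PMul P Q) = mulp (theta P) (theta Q)"
| "theta (PApp i P) = tryp i vh (theta P)"

primrec sum_vars :: "nat \<Rightarrow> sopoly" where
  "sum_vars 0 = PConst 0"
| "sum_vars (Suc j) = PAdd (sum_vars j) (PVar j)"

lemma sum_vars_over: "j \<le> l \<Longrightarrow> sopoly_over k l (sum_vars j)"
  by (induction j) auto

lemma sum_vars_eval: "sopoly_eval Fs xs (sum_vars j) = (\<Sum>i<j. xs ! i)"
  by (induction j) auto

locale machine =
  fixes k l :: nat and M :: otm and P :: sopoly
  assumes M: "otm k M" and P: "sopoly_over k l P"
begin

text \<open>
  \<open>P\<close> is counted twice so that, at a time bounded by \<open>P\<close>, the rest of the clock still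
  suffices as fuel for extracting a word from a tape.
\<close>

definition clock :: sopoly where
  "clock = PAdd (PAdd P P) (PAdd (sum_vars l) (PConst (l + 2)))"

lemma clock_over: "sopoly_over k l clock"
  using P sum_vars_over[of l l k] by (simp add: clock_def)

abbreviation "K \<equiv> ntapes M"

definition fixed_ar :: "(symb \<times> nat \<times> base list \<times> base) list" where
  "fixed_ar = [
    (SymO, 0, [], BitB), (SymI, 0, [], BitB),
    (SymNil, 0, [], WordB), (SymCons, 0, [BitB, WordB], WordB),
    (SymF, k, replicate l WordB, WordB),
    (appS, 0, [WordB, WordB], WordB), (mulS, 0, [WordB, WordB], WordB),
    (mxS, 0, [WordB, WordB], WordB), (limS, 0, [WordB, WordB], WordB),
    (drpS, 0, [histB, WordB], WordB), (tryS, 1, [histB, WordB], WordB),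
    (hnilS, 0, [], histB), (hconsS, 0, [WordB, histB], histB),
    (botS, 0, [], stkB), (pushS, 0, [symB, stkB], stkB), (inpS, 0, [WordB, stkB], stkB),
    (tapeS, 0, [stkB, symB, stkB], tapeB),
    (popS, 0, [stkB, stkB], tapeB), (pullS, 0, [stkB, symB, stkB], tapeB),
    (readS, 0, [WordB, stkB], WordB), (rewS, 0, [WordB, WordB, stkB, stkB], WordB),
    (runS, k, replicate l WordB @ [histB, stateB] @ replicate K tapeB, WordB),
    (goS, k, replicate l WordB @ [WordB, histB, stateB] @ replicate K tapeB, WordB)]"

definition ar :: arity where
  "ar g = (case map_of fixed_ar g of Some x \<Rightarrow> Some x | None \<Rightarrow>
     if g \<in> symS ` alphabet M then Some (0, [], symB)
     else if g \<in> stateS ` states M then Some (0, [], stateB) else None)"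

lemma ar_fixed: "list_all (\<lambda>(g, x). ar g = Some x) fixed_ar"
  by (simp add: ar_def fixed_ar_def)

lemmas ar_fixed_simps [simp] = ar_fixed[unfolded fixed_ar_def list.pred_inject prod.case]

lemma ar_simps [simp]:
  "a \<in> alphabet M \<Longrightarrow> ar (symS a) = Some (0, [], symB)"
  "q \<in> states M \<Longrightarrow> ar (stateS q) = Some (0, [], stateB)"
  "ar (Oracle f) = None"
  by (auto simp: ar_def fixed_ar_def)

lemma ar_cases:
  assumes "ar g = Some x"
  obtains "(g, x) \<in> set fixed_ar"
  | a where "a \<in> alphabet M" "g = symS a" "x = (0, [], symB)"
  | q where "q \<in> states M" "g = stateS q" "x = (0, [], stateB)"
  using assms unfolding ar_def
  by (auto split: option.splits if_splits dest: map_of_SomeD)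

lemma finite_dom_sig: "finite (dom (sig_of ar))"
proof -
  have "dom (sig_of ar) \<subseteq> fst ` set fixed_ar \<union> symS ` alphabet M \<union> stateS ` states M"
    by (auto simp: sig_of_def elim!: ar_cases) (metis fst_conv image_eqI)
  moreover have "finite (alphabet M)" "finite (states M)" using M by (auto simp: otm_def)
  ultimately show ?thesis by (auto intro: finite_subset)
qed

definition Fvars :: "nat list" where "Fvars = [0..<k]"
definition xvars :: "pt list" where "xvars = map (\<lambda>j. PV j WordB) [0..<l]"
definition tapes_of :: "(nat \<Rightarrow> pt) \<Rightarrow> pt list" where "tapes_of t = map t [0..<K]"

definition lvar :: "nat \<Rightarrow> pt" where "lvar j = PV (2 * j) stkB"
definition rvar :: "nat \<Rightarrow> pt" where "rvar j = PV (2 * j + 1) stkB"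

abbreviation "fuelp \<equiv> PV l WordB"

definition runp :: "pt \<Rightarrow> pt \<Rightarrow> (nat \<Rightarrow> pt) \<Rightarrow> pt" where
  "runp h q t = PS runS Fvars (xvars @ [h, q] @ tapes_of t)"

definition gop :: "pt \<Rightarrow> pt \<Rightarrow> pt \<Rightarrow> (nat \<Rightarrow> pt) \<Rightarrow> pt" where
  "gop n h q t = PS goS Fvars (xvars @ [n, h, q] @ tapes_of t)"

definition input_stack :: pt where
  "input_stack = foldr inpp xvars botp"

definition F_rules :: "prule set" where
  "F_rules = {(PS SymF Fvars xvars,
     runp hnilp (statep (start M))
       (\<lambda>j. if j = 0 then popp botp input_stack else tapep botp (cellp Blank) botp))}"

definition run_rules :: "prule set" where
  "run_rules = {(runp vh (PV 0 stateB) (\<lambda>j. PV j tapeB),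
     gop (drpp vh (theta clock)) vh (PV 0 stateB) (\<lambda>j. PV j tapeB))}"

text \<open>The pattern \<open>consp vy fuelp\<close> takes one unit off the clock, so no rule for
  \<open>go\<close> applies to an exhausted clock. In the interpretation this unit becomes the
  hypothesis \<open>n > 0\<close> of \<open>go_cost_decrease\<close>.\<close>

definition go_lhs :: "nat \<Rightarrow> (nat \<Rightarrow> pt) \<Rightarrow> pt" where
  "go_lhs q c = gop (consp vy fuelp) vh (statep q) (\<lambda>j. tapep (lvar j) (c j) (rvar j))"

fun actp :: "nat \<Rightarrow> tsym \<times> move \<Rightarrow> pt" where
  "actp j (a, MLeft) = pullp (lvar j) (cellp a) (rvar j)"
| "actp j (a, MRight) = popp (pushp (cellp a) (lvar j)) (rvar j)"
| "actp j (a, MStay) = tapep (lvar j) (cellp a) (rvar j)"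

text \<open>The scanned cell goes back onto the right stack, so that rewinding ends with the whole
  tape to the right. The same fuel bounds the rewinding and the reading.\<close>

definition extractp :: "nat \<Rightarrow> pt" where
  "extractp j = rewp fuelp fuelp (lvar j) (pushp (PV j symB) (rvar j))"

definition queries :: "nat set" where "queries = query M ` {..<k}"

text \<open>
  The history gets an entry in every step, the empty word if nothing is asked, so that its length
  counts the steps.
\<close>

definition step_rule :: "nat \<Rightarrow> tsym list \<Rightarrow> prule" where
  "step_rule q cs = (go_lhs q (\<lambda>j. cellp (cs ! j)),
     runp (hconsp nilp vh) (statep (fst (delta M q cs))) (\<lambda>j. actp j (snd (delta M q cs) ! j)))"

text \<open>The query word is extracted twice, as a rule cannot share subterms: once for the
  history, once as argument of the oracle. The answer is laid on its tape as an input block; since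
  stacks have size \<open>0\<close>, its length enters no size.\<close>

definition query_rule :: "nat \<Rightarrow> prule" where
  "query_rule i = (go_lhs (query M i) (\<lambda>j. PV j symB),
     runp (hconsp (extractp (2 * i + 1)) vh) (statep (answer M i))
       (\<lambda>j. if j = 2 * i + 1 then tapep botp (cellp Blank) botp
            else if j = 2 * i + 2 then popp botp (inpp (PF i (extractp (2 * i + 1))) botp)
            else tapep (lvar j) (PV j symB) (rvar j)))"

definition final_rule :: "nat \<Rightarrow> prule" where
  "final_rule q = (go_lhs q (\<lambda>j. PV j symB), extractp 0)"

text \<open>A transition depends on the scanned symbols, so step rules enumerate them over the
  finite alphabet; queries and halting depend on the state alone and keep variables for the
  cells.\<close>

definition go_rules :: "prule set" where
  "go_rules = (\<lambda>(q, cs). step_rule q cs) ` ((states M - final M - queries) \<times>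
       {cs. set cs \<subseteq> alphabet M \<and> length cs = K}) \<union>
     query_rule ` {..<k} \<union> final_rule ` final M"

definition fixed_groups :: "(symb \<times> prule set) list" where
  "fixed_groups = [(appS, app_rules), (mulS, mul_rules), (mxS, mx_rules), (limS, lim_rules),
     (drpS, drp_rules), (tryS, try_rules), (popS, pop_rules), (pullS, pull_rules),
     (readS, read_rules (alphabet M)), (rewS, rew_rules)]"

definition groups :: "(symb \<times> prule set) list" where
  "groups = fixed_groups @ [(SymF, F_rules), (runS, run_rules), (goS, go_rules)]"

lemmas fixed_rule_defs = app_rules_def mul_rules_def mx_rules_def lim_rules_def drp_rules_def
  try_rules_def pop_rules_def pull_rules_def read_rules_def rew_rules_def

definition rules :: "prule set" where
  "rules = (\<Union>(g, G) \<in> set groups. G)"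

definition sys :: "rule set" where
  "sys = (\<lambda>(\<l>, r). (tr \<l>, tr r)) ` rules"

section \<open>Finiteness, typing and left-linearity of the rules\<close>

lemma machine_simps:
  "finite (states M)" "finite (alphabet M)" "Blank \<in> alphabet M" "Bit b \<in> alphabet M"
  "2 * k + 1 \<le> K" "start M \<in> states M" "q \<in> final M \<Longrightarrow> q \<in> states M"
  "i < k \<Longrightarrow> query M i \<in> states M" "i < k \<Longrightarrow> query M i \<notin> final M" "i < k \<Longrightarrow> answer M i \<in> states M"
  using M by (auto simp: otm_def) (cases b; simp)+

lemma delta_wf:
  assumes "q \<in> states M - final M - queries" "set cs \<subseteq> alphabet M" "length cs = K"
  shows "fst (delta M q cs) \<in> states M" "length (snd (delta M q cs)) = K"
    "fst ` set (snd (delta M q cs)) \<subseteq> alphabet M"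
proof -
  have "\<forall>q \<in> states M - final M - query M ` {..<k}. \<forall>cs.
        length cs = ntapes M \<and> set cs \<subseteq> alphabet M \<longrightarrow>
        (case delta M q cs of (q', acts) \<Rightarrow>
           q' \<in> states M \<and> length acts = ntapes M \<and> fst ` set acts \<subseteq> alphabet M)"
    using M unfolding otm_def by (elim conjE) assumption
  with assms show "fst (delta M q cs) \<in> states M" "length (snd (delta M q cs)) = K"
    "fst ` set (snd (delta M q cs)) \<subseteq> alphabet M"
    unfolding queries_def by (auto simp: split_def)
qed

lemma finite_sys: "finite sys"
proof -
  have "finite {cs. set cs \<subseteq> alphabet M \<and> length cs = K}"
    using machine_simps(2) by (rule finite_lists_length_eq)
  then have "finite go_rules"
    using machine_simps(1,2) finite_subset[of "final M" "states M"] machine_simps(7)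
    unfolding go_rules_def by (auto intro!: finite_imageI finite_cartesian_product)
  then have "finite rules"
    using machine_simps(2)
    by (simp add: rules_def groups_def fixed_groups_def fixed_rule_defs F_rules_def run_rules_def)
  then show ?thesis by (simp add: sys_def)
qed

text \<open>Gathers the typing, the variable condition and left-linearity, so that each group is
  checked once. The head \<open>g\<close> is included since orthogonality compares heads
  first.\<close>

definition good_rule :: "symb \<Rightarrow> prule \<Rightarrow> bool" where
  "good_rule g = (\<lambda>(\<l>, r). (\<exists>js ts. \<l> = PS g js ts) \<and>
     ptype ar \<l> = Some (case ar g of Some (k, bs, b) \<Rightarrow> b) \<and>
     ptype ar r = ptype ar \<l> \<and> set (pvars r) \<subseteq> set (pvars \<l>) \<and> distinct (pvars \<l>))"

lemma ptype_bitp [simp]: "ptype ar (bitp b) = Some BitB"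
  by (simp add: bitp_def)

lemma pvars_bitp [simp]: "pvars (bitp b) = []"
  by (simp add: bitp_def)

lemma ptype_lit [simp]: "ptype ar (lit n) = Some WordB"
  by (induction n) auto

lemma pvars_lit [simp]: "pvars (lit n) = []"
  by (induction n) auto

lemma ptype_theta [simp]: "ptype ar (theta Q) = Some WordB"
  by (induction Q) auto

lemma pvars_theta: "sopoly_over k l Q \<Longrightarrow> set (pvars (theta Q)) \<subseteq>
    {(j, wordT) | j. j < l} \<union> {(i, funT) | i. i < k} \<union> {(0, Base histB)}"
  by (induction Q) auto

lemma length_xvars [simp]: "length xvars = l" "length Fvars = k" "length (tapes_of t) = K"
  by (auto simp: xvars_def Fvars_def tapes_of_def)

lemma ptype_xvars [simp]: "map (ptype ar) xvars = replicate l (Some WordB)"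
  by (auto simp: xvars_def map_replicate_const comp_def)

lemma pvars_xvars: "map pvars xvars = map (\<lambda>j. [(j, wordT)]) [0..<l]"
  by (simp add: xvars_def)

lemma concat_singletons: "concat (map (\<lambda>j. [f j]) js) = map f js"
  by (induction js) auto

lemma ptype_tapes: "(\<And>j. j < K \<Longrightarrow> ptype ar (t j) = Some tapeB) \<Longrightarrow>
    map (ptype ar) (tapes_of t) = replicate K (Some tapeB)"
  by (auto simp: tapes_of_def intro!: nth_equalityI)

lemma ptype_runp:
  assumes "ptype ar h = Some histB" "ptype ar q = Some stateB"
    "\<And>j. j < K \<Longrightarrow> ptype ar (t j) = Some tapeB"
  shows "ptype ar (runp h q t) = Some WordB"
  using assms ptype_tapes[of t] by (simp add: runp_def)

lemma ptype_gop:
  assumes "ptype ar n = Some WordB" "ptype ar h = Some histB" "ptype ar q = Some stateB"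
    "\<And>j. j < K \<Longrightarrow> ptype ar (t j) = Some tapeB"
  shows "ptype ar (gop n h q t) = Some WordB"
  using assms ptype_tapes[of t] by (simp add: gop_def)

definition argvars :: "(nat \<times> ty) list" where
  "argvars = map (\<lambda>i. (i, funT)) [0..<k] @ map (\<lambda>j. (j, wordT)) [0..<l]"

lemma pvars_runp: "pvars (runp h q t) = argvars @ pvars h @ pvars q @ concat (map (\<lambda>j. pvars (t j)) [0..<K])"
  and pvars_gop: "pvars (gop n h q t) =
    argvars @ pvars n @ pvars h @ pvars q @ concat (map (\<lambda>j. pvars (t j)) [0..<K])"
  by (simp_all add: runp_def gop_def argvars_def pvars_xvars concat_singletons tapes_of_def comp_def Fvars_def)

lemma distinct_argvars: "distinct argvars"
  by (auto simp: argvars_def distinct_map inj_on_def)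

lemma set_argvars: "set argvars = {(i, funT) | i. i < k} \<union> {(j, wordT) | j. j < l}"
  by (auto simp: argvars_def)

lemma ptype_input_stack: "ptype ar input_stack = Some stkB"
proof -
  have "ptype ar (foldr inpp ts botp) = Some stkB" if "\<forall>t \<in> set ts. ptype ar t = Some WordB" for ts
    using that by (induction ts) auto
  then show ?thesis by (simp add: input_stack_def xvars_def)
qed

lemma pvars_input_stack: "pvars input_stack = map (\<lambda>j. (j, wordT)) [0..<l]"
proof -
  have "pvars (foldr inpp ts botp) = concat (map pvars ts)" for ts
    by (induction ts) auto
  then show ?thesis by (simp add: input_stack_def pvars_xvars concat_singletons)
qed

lemma lrvar [simp]: "ptype ar (lvar j) = Some stkB" "ptype ar (rvar j) = Some stkB"
  "pvars (lvar j) = [(2 * j, Base stkB)]" "pvars (rvar j) = [(2 * j + 1, Base stkB)]"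
  by (simp_all add: lvar_def rvar_def)

lemma ptype_extractp [simp]: "ptype ar (extractp j) = Some WordB"
  by (simp add: extractp_def)

lemma ptype_actp: "fst a \<in> alphabet M \<Longrightarrow> ptype ar (actp j a) = Some tapeB"
  by (cases a; cases "snd a") auto

lemma pvars_actp: "set (pvars (actp j a)) \<subseteq> {(2 * j, Base stkB), (2 * j + 1, Base stkB)}"
  by (cases a; cases "snd a") auto

lemma ptype_go_lhs:
  assumes "q \<in> states M" "\<And>j. j < K \<Longrightarrow> ptype ar (c j) = Some symB"
  shows "ptype ar (go_lhs q c) = Some WordB"
  unfolding go_lhs_def using assms by (intro ptype_gop) auto

lemma pvars_go_lhs: "pvars (go_lhs q c) = argvars @ [(0, bitT), (l, wordT), (0, Base histB)] @
    concat (map (\<lambda>j. (2 * j, Base stkB) # pvars (c j) @ [(2 * j + 1, Base stkB)]) [0..<K])"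
  by (simp add: go_lhs_def pvars_gop)

text \<open>The two stacks of a tape have indices of different parity, different tapes have
  different indices, and the fuel \<open>l\<close> comes after the word arguments. All remaining
  clashes are excluded by the types, which belong to the identity of a variable.\<close>

lemma distinct_go_lhs:
  assumes "\<And>j. j < K \<Longrightarrow> pvars (c j) = [] \<or> pvars (c j) = [(j, Base symB)]"
  shows "distinct (pvars (go_lhs q c))"
proof -
  define v where "v j = (2 * j, Base stkB) # pvars (c j) @ [(2 * j + 1, Base stkB)]" for j
  have s: "set (v j) \<subseteq> {(2 * j, Base stkB), (2 * j + 1, Base stkB), (j, Base symB)}" if "j < K" for j
    using assms[OF that] by (auto simp: v_def)
  have d: "distinct (v j)" if "j < K" for j
    using assms[OF that] by (auto simp: v_def)
  have disj: "set (v i) \<inter> set (v j) = {}" if "i < K" "j < K" "i \<noteq> j" for i j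
  proof -
    have "2 * i \<noteq> Suc (2 * j)" "2 * j \<noteq> Suc (2 * i)" by presburger+
    then show ?thesis using s[of i] s[of j] that by fastforce
  qed
  have "distinct (concat (map v [0..<n]))" if "n \<le> K" for n
    using that
  proof (induction n)
    case (Suc n)
    have "\<forall>i<n. set (v i) \<inter> set (v n) = {}" using disj Suc.prems by simp
    then have "set (concat (map v [0..<n])) \<inter> set (v n) = {}" by auto
    with Suc d[of n] show ?case by auto
  qed simp
  then have "distinct (concat (map v [0..<K]))" by simp
  moreover have "\<forall>p \<in> set (concat (map v [0..<K])). snd p \<in> {Base stkB, Base symB}"
    using s by fastforce
  then have "(n, funT) \<notin> set (concat (map v [0..<K]))" "(n, wordT) \<notin> set (concat (map v [0..<K]))"
    "(n, bitT) \<notin> set (concat (map v [0..<K]))" "(n, Base histB) \<notin> set (concat (map v [0..<K]))" for n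
    by fastforce+
  ultimately show ?thesis
    unfolding pvars_go_lhs v_def[symmetric] using distinct_argvars
    by (auto simp: set_argvars simp del: set_concat)
qed

lemma good_step_rule:
  assumes "q \<in> states M - final M - queries" "set cs \<subseteq> alphabet M" "length cs = K"
  shows "good_rule goS (step_rule q cs)"
proof -
  note wf = delta_wf[OF assms]
  have al: "cs ! j \<in> alphabet M" if "j < K" for j using assms that by (metis nth_mem subsetD)
  have t1: "ptype ar (go_lhs q (\<lambda>j. cellp (cs ! j))) = Some WordB"
    using assms al by (intro ptype_go_lhs) auto
  have t2: "ptype ar (runp (hconsp nilp vh) (statep (fst (delta M q cs))) (\<lambda>j. actp j (snd (delta M q cs) ! j))) = Some WordB"
    using wf by (intro ptype_runp ptype_actp) auto
  have "set (pvars (runp (hconsp nilp vh) (statep (fst (delta M q cs))) (\<lambda>j. actp j (snd (delta M q cs) ! j))))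
     \<subseteq> set (pvars (go_lhs q (\<lambda>j. cellp (cs ! j))))"
    unfolding pvars_runp pvars_go_lhs using al pvars_actp by (auto dest!: subsetD[OF pvars_actp])
  then show ?thesis using t1 t2 distinct_go_lhs[of "\<lambda>j. cellp (cs ! j)" q]
    by (auto simp: good_rule_def step_rule_def go_lhs_def gop_def)
qed

lemma good_query_rule:
  assumes "i < k"
  shows "good_rule goS (query_rule i)"
proof -
  let ?r = "snd (query_rule i)"
  have t1: "ptype ar (go_lhs (query M i) (\<lambda>j. PV j symB)) = Some WordB"
    using assms machine_simps by (intro ptype_go_lhs) auto
  have t2: "ptype ar ?r = Some WordB"
    using assms machine_simps unfolding query_rule_def snd_conv by (intro ptype_runp) auto
  have i: "2 * i + 1 < K" "2 * i + 2 < K" using assms machine_simps(5) by auto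
  let ?L = "set (pvars (go_lhs (query M i) (\<lambda>j. PV j symB)))"
  have L: "{(2 * j, Base stkB), (j, Base symB), (2 * j + 1, Base stkB)} \<subseteq> ?L" if "j < K" for j
    unfolding pvars_go_lhs using that by auto
  have L': "set argvars \<subseteq> ?L" "(0, Base histB) \<in> ?L" "(l, wordT) \<in> ?L" "(i, funT) \<in> ?L"
    unfolding pvars_go_lhs using assms by (auto simp: set_argvars)
  have ext: "set (pvars (extractp (2 * i + 1))) \<subseteq> ?L"
    using L[OF i(1)] L' by (simp add: extractp_def)
  define t where "t j = (if j = 2 * i + 1 then tapep botp (cellp Blank) botp
            else if j = 2 * i + 2 then popp botp (inpp (PF i (extractp (2 * i + 1))) botp)
            else tapep (lvar j) (PV j symB) (rvar j))" for j
  have "set (pvars (t j)) \<subseteq> ?L" if "j < K" for j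
    using L[OF that] L' ext by (auto simp: t_def)
  then have "(\<Union>j<K. set (pvars (t j))) \<subseteq> ?L" by blast
  moreover have "set (pvars ?r) \<subseteq> set argvars \<union> set (pvars (extractp (2 * i + 1))) \<union> {(0, Base histB)} \<union>
      (\<Union>j<K. set (pvars (t j)))"
    unfolding query_rule_def snd_conv t_def[symmetric] pvars_runp by auto
  ultimately have "set (pvars ?r) \<subseteq> ?L" using L' ext by blast
  then show ?thesis using t1 t2 distinct_go_lhs[of "\<lambda>j. PV j symB" "query M i"]
    by (auto simp: good_rule_def query_rule_def go_lhs_def gop_def)
qed

lemma good_final_rule:
  assumes "q \<in> final M"
  shows "good_rule goS (final_rule q)"
proof -
  have t1: "ptype ar (go_lhs q (\<lambda>j. PV j symB)) = Some WordB"
    using assms machine_simps by (intro ptype_go_lhs) auto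
  have i: "0 < K" using machine_simps(5) by auto
  have "set (pvars (extractp 0)) \<subseteq> set (pvars (go_lhs q (\<lambda>j. PV j symB)))"
    unfolding pvars_go_lhs extractp_def using i by (auto intro!: bexI[of _ 0])
  then show ?thesis using t1 distinct_go_lhs[of "\<lambda>j. PV j symB" q]
    by (auto simp: good_rule_def final_rule_def go_lhs_def gop_def)
qed

lemma good_F_rule: "\<rho> \<in> F_rules \<Longrightarrow> good_rule SymF \<rho>"
proof -
  have t: "ptype ar (runp hnilp (statep (start M))
       (\<lambda>j. if j = 0 then popp botp input_stack else tapep botp (cellp Blank) botp)) = Some WordB"
    using machine_simps ptype_input_stack by (intro ptype_runp) auto
  have "pvars (PS SymF Fvars xvars) = argvars"
    by (simp add: argvars_def pvars_xvars concat_singletons Fvars_def)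
  then show "\<rho> \<in> F_rules \<Longrightarrow> good_rule SymF \<rho>"
    using t distinct_argvars
    by (auto simp: F_rules_def good_rule_def pvars_runp pvars_input_stack set_argvars
        simp del: pvars.simps(3) split: if_splits)
       (auto simp: pvars_input_stack)
qed

lemma good_run_rule: "\<rho> \<in> run_rules \<Longrightarrow> good_rule runS \<rho>"
proof -
  let ?l = "runp vh (PV 0 stateB) (\<lambda>j. PV j tapeB)"
    and ?r = "gop (drpp vh (theta clock)) vh (PV 0 stateB) (\<lambda>j. PV j tapeB)"
  have t: "ptype ar ?l = Some WordB" "ptype ar ?r = Some WordB"
    by (intro ptype_runp ptype_gop; simp)+
  have l: "pvars ?l = argvars @ [(0, Base histB), (0, Base stateB)] @ map (\<lambda>j. (j, Base tapeB)) [0..<K]"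
    by (simp add: pvars_runp concat_singletons)
  then have "distinct (pvars ?l)"
    using distinct_argvars by (auto simp: set_argvars distinct_map inj_on_def)
  moreover have "set (pvars ?r) \<subseteq> set (pvars ?l)"
    unfolding l using pvars_theta[OF clock_over]
    by (auto simp: pvars_gop set_argvars concat_singletons)
  ultimately show "\<rho> \<in> run_rules \<Longrightarrow> good_rule runS \<rho>"
    using t by (auto simp: run_rules_def good_rule_def) (simp add: runp_def)
qed

lemma good_rules:
  assumes "(g, G) \<in> set groups" "\<rho> \<in> G"
  shows "good_rule g \<rho>"
proof -
  have "(g, G) \<in> set fixed_groups \<Longrightarrow> good_rule g \<rho>"
    using assms(2) machine_simps(3,4)
    by (auto simp: fixed_groups_def good_rule_def fixed_rule_defs)
  moreover have "\<rho> \<in> go_rules \<Longrightarrow> good_rule goS \<rho>"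
    using good_step_rule good_query_rule good_final_rule by (auto simp: go_rules_def)
  ultimately show ?thesis
    using assms good_F_rule[of \<rho>] good_run_rule[of \<rho>] by (auto simp: groups_def)
qed

lemma rules_cases:
  assumes "\<rho> \<in> rules"
  obtains g G where "(g, G) \<in> set groups" "\<rho> \<in> G"
  using assms by (auto simp: rules_def)

lemma is_rule_sys: "\<rho> \<in> sys \<Longrightarrow> is_rule (sig_of ar) \<rho>"
proof -
  assume "\<rho> \<in> sys"
  then obtain \<l> r g G where lr: "(\<l>, r) \<in> G" "(g, G) \<in> set groups" "\<rho> = (tr \<l>, tr r)"
    by (auto simp: sys_def elim!: rules_cases)
  have g: "good_rule g (\<l>, r)" by (rule good_rules[OF lr(2,1)])
  obtain b where "ptype ar \<l> = Some b" "ptype ar r = Some b" using g by (auto simp: good_rule_def)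
  then have "type_of (sig_of ar) (tr \<l>) = Some (Base b)" "type_of (sig_of ar) (tr r) = Some (Base b)"
    using type_of_tr[of ar "sig_of ar"] by auto
  moreover obtain js ts where "\<l> = PS g js ts" using g by (auto simp: good_rule_def)
  ultimately show ?thesis using g lr(3) unfolding is_rule_def good_rule_def
    by (auto simp only: var_occs_tr split: prod.splits) (metis tr.simps(3))+
qed

lemma STRS_sys: "STRS (sig_of ar) sys"
  using is_rule_sys ord_fun_ty by (auto simp: STRS_def ran_def sig_of_def)

lemma type2_signature_sys: "type2_signature k l (sig_of ar)"
  by (auto simp: type2_signature_def sig_of_def fun_ty_def)

section \<open>Orthogonality\<close>

lemma distinct_groups: "distinct (map fst groups)"
  by (simp add: groups_def fixed_groups_def)

lemma tr_bitp [simp]: "tr (bitp b) = Sym (if b then SymI else SymO)"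
  by (simp add: bitp_def)

lemma go_lhs_overlap:
  assumes "tr (go_lhs q c) \<cdot> \<gamma> = tr (go_lhs q' c') \<cdot> \<delta>"
  shows "q = q'" "\<And>j. j < K \<Longrightarrow> tr (c j) \<cdot> \<gamma> = tr (c' j) \<cdot> \<delta>"
  using assms by (simp_all add: go_lhs_def gop_def subst_apps tapes_of_def del: foldl_append)

text \<open>The state separates step, query and final rules. Two query rules with the same state
  have the same index because \<open>query M\<close> is injective on \<open>{..<k}\<close>, and two
  step rules with the same state differ in some scanned symbol or are equal.\<close>

lemma overlap_go_rules:
  assumes "(l1, r1) \<in> go_rules" "(l2, r2) \<in> go_rules" "tr l1 \<cdot> \<gamma> = tr l2 \<cdot> \<delta>"
  shows "(l1, r1) = (l2, r2)"
proof -
  have kind: "(\<exists>q cs. q \<in> states M - final M - queries \<and> set cs \<subseteq> alphabet M \<and> length cs = K \<and>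
      (\<l>, r) = step_rule q cs) \<or> (\<exists>i<k. (\<l>, r) = query_rule i) \<or> (\<exists>q\<in>final M. (\<l>, r) = final_rule q)"
    if "(\<l>, r) \<in> go_rules" for \<l> r
    using that by (auto simp: go_rules_def)
  have st: "\<exists>c. \<l> = go_lhs q c" if "(\<l>, r) = step_rule q cs \<or> (\<l>, r) = query_rule i \<and> q = query M i \<or>
     (\<l>, r) = final_rule q" for \<l> r q cs i
    using that by (auto simp: step_rule_def query_rule_def final_rule_def)
  have inj: "i = i'" if "i < k" "i' < k" "query M i = query M i'" for i i'
    using that M by (auto simp: otm_def inj_on_def)
  have q: "query M i \<in> queries" if "i < k" for i using that by (auto simp: queries_def)
  from kind[OF assms(1)] kind[OF assms(2)] assms(3) show ?thesis
  proof (elim disjE exE conjE bexE)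
    fix q cs q' cs'
    assume a: "length cs = K" "length cs' = K" "(l1, r1) = step_rule q cs" "(l2, r2) = step_rule q' cs'"
      "tr l1 \<cdot> \<gamma> = tr l2 \<cdot> \<delta>"
    then have eq: "q = q'" "\<And>j. j < K \<Longrightarrow> cs ! j = cs' ! j"
      using go_lhs_overlap[of q "\<lambda>j. cellp (cs ! j)" \<gamma> q' "\<lambda>j. cellp (cs' ! j)" \<delta>]
      by (auto simp: step_rule_def)
    then have "cs = cs'" using a by (auto intro: nth_equalityI)
    then show ?thesis using a eq by simp
  qed (use q inj machine_simps(9) in \<open>auto simp: step_rule_def query_rule_def final_rule_def
    dest!: go_lhs_overlap(1)\<close>)
qed

lemma overlap_fixed:
  assumes "tr l1 \<cdot> \<gamma> = tr l2 \<cdot> \<delta>" "(g, G) \<in> set fixed_groups" "(l1, r1) \<in> G" "(l2, r2) \<in> G"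
  shows "(l1, r1) = (l2, r2)"
  using assms unfolding fixed_groups_def
  by (auto simp: fixed_rule_defs bitp_def simp del: apps_Sym_eq_iff split: if_splits)

lemma overlap_group:
  assumes "(g, G) \<in> set groups" "(l1, r1) \<in> G" "(l2, r2) \<in> G" "tr l1 \<cdot> \<gamma> = tr l2 \<cdot> \<delta>"
  shows "(l1, r1) = (l2, r2)"
proof -
  have "(g, G) \<in> set fixed_groups \<or> G = F_rules \<or> G = run_rules \<or> G = go_rules"
    using assms(1) by (auto simp: groups_def)
  then show ?thesis
  proof (elim disjE)
    assume "(g, G) \<in> set fixed_groups"
    then show ?thesis by (rule overlap_fixed[OF assms(4) _ assms(2,3)])
  next
    assume "G = go_rules"
    then show ?thesis using overlap_go_rules[OF _ _ assms(4)] assms(2,3) by simp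
  qed (use assms(2,3) in \<open>simp_all add: F_rules_def run_rules_def\<close>)
qed

lemma orthogonal_sys: "orthogonal (sig_of ar) sys"
proof -
  { fix \<l> r assume "(\<l>, r) \<in> rules"
    then have "distinct (pvars \<l>)" using good_rules by (fastforce simp: good_rule_def elim!: rules_cases) }
  moreover
  { fix l1 r1 l2 r2 \<gamma> \<delta>
    assume 1: "(l1, r1) \<in> rules" and 2: "(l2, r2) \<in> rules" and eq: "tr l1 \<cdot> \<gamma> = tr l2 \<cdot> \<delta>"
    obtain g1 G1 where g1: "(g1, G1) \<in> set groups" "(l1, r1) \<in> G1" using 1 by (rule rules_cases)
    obtain g2 G2 where g2: "(g2, G2) \<in> set groups" "(l2, r2) \<in> G2" using 2 by (rule rules_cases)
    \<comment> \<open>Left-hand sides with a common instance have the same head symbol, and a head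
      symbol determines its group.\<close>
    have "g1 = g2"
      using eq good_rules[OF g1] good_rules[OF g2] by (auto simp: good_rule_def subst_apps simp del: foldl_append)
    then have "G1 = G2" using g1(1) g2(1) distinct_groups eq_key_imp_eq_value by fastforce
    then have "(l1, r1) = (l2, r2)" using overlap_group g1 g2 eq by blast }
  ultimately show ?thesis
    unfolding orthogonal_def by (auto simp: sys_def var_occs_tr) blast+
qed

end

subsection \<open>The cost-size interpretation\<close>

lemma sopoly_eval_mono:
  assumes "frel Hs Hs'" "list_all2 (\<ge>) xs xs'" "sopoly_over (length Hs) (length xs) Q"
  shows "sopoly_eval Hs xs Q \<ge> sopoly_eval Hs' xs' Q"
  using assms(3)
proof (induction Q)
  case (PApp i Q)
  then have "mono (Hs ! i)" "\<And>n. (Hs ! i) n \<ge> (Hs' ! i) n" "sopoly_eval Hs xs Q \<ge> sopoly_eval Hs' xs' Q"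
    using assms(1) by (auto simp: frel_def list_all2_conv_all_nth)
  then show ?case by (simp, meson monoD order_trans)
qed (use assms(2) in \<open>auto simp: list_all2_conv_all_nth intro: add_mono mult_mono\<close>)

text \<open>The cost of computing \<^term>\<open>theta Q\<close> with a history of length \<open>z\<close>.\<close>

primrec cth :: "(nat \<Rightarrow> nat) list \<Rightarrow> (nat \<Rightarrow> nat) list \<Rightarrow> nat list \<Rightarrow> nat \<Rightarrow> sopoly \<Rightarrow> nat" where
  "cth Gs Hs xs z (PConst n) = 0"
| "cth Gs Hs xs z (PVar j) = 0"
| "cth Gs Hs xs z (PAdd P Q) = cth Gs Hs xs z P + cth Gs Hs xs z Q + (sopoly_eval Hs xs P + 1)"
| "cth Gs Hs xs z (PMul P Q) = cth Gs Hs xs z P + cth Gs Hs xs z Q +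
     (sopoly_eval Hs xs P * (sopoly_eval Hs xs Q + 2) + 1)"
| "cth Gs Hs xs z (PApp i P) = cth Gs Hs xs z P + (z + 1) *
     ((Gs ! i) (sopoly_eval Hs xs P) + sopoly_eval Hs xs P + (Hs ! i) (sopoly_eval Hs xs P) + 5)"

lemma cth_mono:
  assumes "frel Gs Gs'" "frel Hs Hs'" "list_all2 (\<ge>) xs xs'" "z \<ge> z'"
    "length Gs = length Hs" "sopoly_over (length Hs) (length xs) Q"
  shows "cth Gs Hs xs z Q \<ge> cth Gs' Hs' xs' z' Q"
  using assms(6)
proof (induction Q)
  case (PAdd P Q)
  then have "sopoly_eval Hs xs P \<ge> sopoly_eval Hs' xs' P"
    using sopoly_eval_mono[OF assms(2,3)] by simp
  with PAdd show ?case by simp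
next
  case (PMul P Q)
  then have "sopoly_eval Hs xs P \<ge> sopoly_eval Hs' xs' P" "sopoly_eval Hs xs Q \<ge> sopoly_eval Hs' xs' Q"
    using sopoly_eval_mono[OF assms(2,3)] by simp_all
  with PMul show ?case by (simp del: mult_Suc_right add_2_eq_Suc' add: add_mono mult_le_mono)
next
  case (PApp i Q)
  let ?x = "sopoly_eval Hs xs Q" and ?x' = "sopoly_eval Hs' xs' Q"
  have x: "?x \<ge> ?x'" using sopoly_eval_mono[OF assms(2,3)] PApp by simp
  have "i < length Gs" "i < length Hs" using PApp.prems assms(5) by auto
  then have "mono (Gs ! i)" "\<And>n. (Gs ! i) n \<ge> (Gs' ! i) n" "mono (Hs ! i)" "\<And>n. (Hs ! i) n \<ge> (Hs' ! i) n"
    using assms(1,2) by (auto simp: frel_def list_all2_conv_all_nth)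
  then have "(Gs ! i) ?x \<ge> (Gs' ! i) ?x'" "(Hs ! i) ?x \<ge> (Hs' ! i) ?x'"
    using x by (meson monoD order_trans)+
  then have "(z + 1) * ((Gs ! i) ?x + ?x + (Hs ! i) ?x + 5) \<ge> (z' + 1) * ((Gs' ! i) ?x' + ?x' + (Hs' ! i) ?x' + 5)"
    using x assms(4) by (intro mult_le_mono add_mono) auto
  moreover have "cth Gs Hs xs z Q \<ge> cth Gs' Hs' xs' z' Q" using PApp by simp
  ultimately show ?case by (simp only: cth.simps add_mono)
qed auto

text \<open>A bound on the cost of the remaining subterms of the right-hand side of a rule for \<open>go\<close>.\<close>

definition stepc :: "nat \<Rightarrow> (nat \<Rightarrow> nat) list \<Rightarrow> nat \<Rightarrow> nat" where
  "stepc K Gs v = 4 * v + (\<Sum>G \<leftarrow> Gs. G v) + K + 10"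

lemma stepc_mono:
  assumes "frel Gs Gs'" "v \<ge> v'"
  shows "stepc K Gs v \<ge> stepc K Gs' v'"
proof -
  have "(\<Sum>G \<leftarrow> Gs. G v) \<ge> (\<Sum>G \<leftarrow> Gs'. G v')"
    using assms(1) unfolding frel_def
  proof (induction rule: list_all2_induct)
    case (Cons h hs h' hs')
    then have "h v \<ge> h' v'" using assms(2) by (meson monoD order_trans)
    with Cons show ?case by simp
  qed simp
  then show ?thesis using assms(2) by (simp add: stepc_def)
qed

section \<open>The cost bound as a second-order polynomial\<close>

lemma interleave_nth:
  assumes "length Gs = length Hs" "i < length Gs"
  shows "concat (map2 (\<lambda>g h. [g, h]) Gs Hs) ! (2 * i) = Gs ! i"
    "concat (map2 (\<lambda>g h. [g, h]) Gs Hs) ! Suc (2 * i) = Hs ! i"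
  using assms
proof (induction Gs Hs arbitrary: i rule: list_induct2)
  case (Cons g Gs h Hs)
  { case 1 then show ?case using Cons.IH(1)[of "i - 1"] by (cases i) auto }
  { case 2 then show ?case using Cons.IH(2)[of "i - 1"] by (cases i) auto }
qed auto

primrec sizeP :: "sopoly \<Rightarrow> sopoly" where
  "sizeP (PConst n) = PConst n"
| "sizeP (PVar j) = PVar j"
| "sizeP (PAdd P Q) = PAdd (sizeP P) (sizeP Q)"
| "sizeP (PMul P Q) = PMul (sizeP P) (sizeP Q)"
| "sizeP (PApp i P) = PApp (2 * i + 1) (sizeP P)"

text \<open>The polynomial counterpart of \<open>cth\<close>, with \<open>Z\<close> standing for the
  length of the history. Even function indices refer to costs and odd ones to sizes, as
  \<open>poly_bounded\<close> prescribes.\<close>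

primrec cthP :: "sopoly \<Rightarrow> sopoly \<Rightarrow> sopoly" where
  "cthP Z (PConst n) = PConst 0"
| "cthP Z (PVar j) = PConst 0"
| "cthP Z (PAdd P Q) = PAdd (PAdd (cthP Z P) (cthP Z Q)) (PAdd (sizeP P) (PConst 1))"
| "cthP Z (PMul P Q) = PAdd (PAdd (cthP Z P) (cthP Z Q))
     (PAdd (PMul (sizeP P) (PAdd (sizeP Q) (PConst 2))) (PConst 1))"
| "cthP Z (PApp i P) = PAdd (cthP Z P) (PMul (PAdd Z (PConst 1))
     (PAdd (PAdd (PAdd (PApp (2 * i) (sizeP P)) (sizeP P)) (PApp (2 * i + 1) (sizeP P))) (PConst 5)))"

primrec sum_costP :: "nat \<Rightarrow> sopoly \<Rightarrow> sopoly" where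
  "sum_costP 0 Z = PConst 0"
| "sum_costP (Suc i) Z = PAdd (sum_costP i Z) (PApp (2 * i) Z)"

definition stepP :: "nat \<Rightarrow> nat \<Rightarrow> sopoly \<Rightarrow> sopoly" where
  "stepP K k Z = PAdd (PAdd (PMul (PConst 4) Z) (sum_costP k Z)) (PConst (K + 10))"

lemma sizeP_over: "sopoly_over k l Q \<Longrightarrow> sopoly_over (2 * k) l (sizeP Q)"
  by (induction Q) auto

lemma cthP_over: "sopoly_over (2 * k) l Z \<Longrightarrow> sopoly_over k l Q \<Longrightarrow> sopoly_over (2 * k) l (cthP Z Q)"
  by (induction Q) (auto simp: sizeP_over)

lemma sum_costP_over: "j \<le> k \<Longrightarrow> sopoly_over (2 * k) l Z \<Longrightarrow> sopoly_over (2 * k) l (sum_costP j Z)"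
  by (induction j) auto

lemma stepP_over: "sopoly_over (2 * k) l Z \<Longrightarrow> sopoly_over (2 * k) l (stepP K k Z)"
  by (simp add: stepP_def sum_costP_over)

context
  fixes Gs Hs fs :: "(nat \<Rightarrow> nat) list" and xs :: "nat list" and k l :: nat
  assumes len: "length Gs = k" "length Hs = k" and fs: "fs = concat (map2 (\<lambda>g h. [g, h]) Gs Hs)"
begin

lemma sizeP_eval: "sopoly_over k l Q \<Longrightarrow> sopoly_eval fs xs (sizeP Q) = sopoly_eval Hs xs Q"
  by (induction Q) (auto simp: interleave_nth len fs)

lemma cthP_eval: "sopoly_over k l Q \<Longrightarrow>
    sopoly_eval fs xs (cthP Z Q) = cth Gs Hs xs (sopoly_eval fs xs Z) Q"
  by (induction Q) (auto simp: sizeP_eval interleave_nth[of Gs Hs, folded fs] len)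

lemma stepP_eval: "sopoly_eval fs xs (stepP K k Z) = stepc K Gs (sopoly_eval fs xs Z)"
proof -
  have "sopoly_eval fs xs (sum_costP j Z) = (\<Sum>G \<leftarrow> take j Gs. G (sopoly_eval fs xs Z))" if "j \<le> k" for j
    using that
  proof (induction j)
    case (Suc j)
    then show ?case by (simp add: interleave_nth[of Gs Hs, folded fs] len take_Suc_conv_app_nth)
  qed simp
  from this[of k] show ?thesis using len by (simp add: stepP_def stepc_def)
qed

end

context machine
begin

definition bound :: "(nat \<Rightarrow> nat) list \<Rightarrow> nat list \<Rightarrow> nat" where
  "bound Hs xs = sopoly_eval Hs xs clock"

definition round_cost :: "(nat \<Rightarrow> nat) list \<Rightarrow> (nat \<Rightarrow> nat) list \<Rightarrow> nat list \<Rightarrow> nat \<Rightarrow> nat" where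
  "round_cost Gs Hs xs z = stepc K Gs z + cth Gs Hs xs z clock + bound Hs xs + 3"

text \<open>There are at most \<open>bound Hs xs - h\<close> rounds to come, and one more
  \<open>round_cost\<close> pays for evaluating the clock now. The argument
  \<open>h + 2 * (bound Hs xs - h)\<close> dominates the lengths of all histories up to the bound
  and does not increase with \<open>h\<close> below the bound.\<close>

definition run_cost :: "(nat \<Rightarrow> nat) list \<Rightarrow> (nat \<Rightarrow> nat) list \<Rightarrow> nat list \<Rightarrow> nat \<Rightarrow> nat" where
  "run_cost Gs Hs xs h = (bound Hs xs - h + 1) * round_cost Gs Hs xs (h + 2 * (bound Hs xs - h))"

text \<open>The rules for \<open>go\<close> have to decrease for every \<open>n\<close>, also one
  unrelated to the clock. The maximum with \<open>bound Hs xs - h\<close> is needed because the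
  following \<open>run\<close> charges for all rounds that the bound allows, regardless of
  \<open>n\<close>.\<close>

definition go_cost :: "(nat \<Rightarrow> nat) list \<Rightarrow> (nat \<Rightarrow> nat) list \<Rightarrow> nat list \<Rightarrow> nat \<Rightarrow> nat \<Rightarrow> nat" where
  "go_cost Gs Hs xs n h = (let m = max n (bound Hs xs - h) in
     m * round_cost Gs Hs xs (h + 2 * m) + stepc K Gs m + 1)"

context
  fixes Gs Gs' Hs Hs' :: "(nat \<Rightarrow> nat) list" and xs xs' :: "nat list"
  assumes rel: "frel Gs Gs'" "frel Hs Hs'" "list_all2 (\<ge>) xs xs'"
    and len: "length Gs = k" "length Hs = k" "length xs = l"
begin

lemma bound_mono: "bound Hs xs \<ge> bound Hs' xs'"
  using sopoly_eval_mono[OF rel(2,3)] len clock_over by (simp add: bound_def)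

lemma round_cost_mono: "z \<ge> z' \<Longrightarrow> round_cost Gs Hs xs z \<ge> round_cost Gs' Hs' xs' z'"
  unfolding round_cost_def using len clock_over
  by (intro add_mono bound_mono cth_mono[OF rel] stepc_mono[OF rel(1)]) auto

lemma run_cost_mono: "run_cost Gs Hs xs h \<ge> run_cost Gs' Hs' xs' h"
  unfolding run_cost_def using bound_mono by (intro mult_le_mono round_cost_mono) auto

lemma go_cost_mono:
  assumes "n \<ge> n'" shows "go_cost Gs Hs xs n h \<ge> go_cost Gs' Hs' xs' n' h"
proof -
  have "max n (bound Hs xs - h) \<ge> max n' (bound Hs' xs' - h)" using assms bound_mono by auto
  then show ?thesis unfolding go_cost_def Let_def
    by (intro add_mono mult_le_mono round_cost_mono stepc_mono[OF rel(1)]) auto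
qed

end

lemma round_cost_mono':
  assumes "\<And>h. h \<in> set Gs \<union> set Hs \<Longrightarrow> mono h" "length Gs = k" "length Hs = k" "length xs = l" "z \<ge> z'"
  shows "round_cost Gs Hs xs z \<ge> round_cost Gs Hs xs z'"
  using assms by (intro round_cost_mono) (auto intro!: frel_refl list.rel_refl_strong)

text \<open>For this fuel the maximum in \<open>go_cost\<close> is \<open>bound Hs xs - h\<close>,
  so \<open>run_cost\<close> has one factor \<open>round_cost\<close> more. That factor contains the
  cost \<open>cth\<close> of the clock, the \<open>bound Hs xs + 1\<close> for dropping as many
  units as there are entries, and the \<open>stepc\<close> of the round.\<close>

lemma run_cost_decrease:
  assumes "\<And>h. h \<in> set Gs \<union> set Hs \<Longrightarrow> mono h" "length Gs = k" "length Hs = k" "length xs = l"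
  shows "run_cost Gs Hs xs h > go_cost Gs Hs xs (bound Hs xs - h) h + cth Gs Hs xs h clock + (bound Hs xs + 1)"
proof -
  let ?d = "bound Hs xs - h"
  have "stepc K Gs (h + 2 * ?d) \<ge> stepc K Gs ?d"
    using assms(1) by (intro stepc_mono frel_refl) auto
  moreover have "cth Gs Hs xs (h + 2 * ?d) clock \<ge> cth Gs Hs xs h clock"
    using assms clock_over by (intro cth_mono) (auto intro!: frel_refl list.rel_refl_strong)
  ultimately have "round_cost Gs Hs xs (h + 2 * ?d) > stepc K Gs ?d + 1 + cth Gs Hs xs h clock + (bound Hs xs + 1)"
    unfolding round_cost_def by linarith
  then show ?thesis unfolding run_cost_def go_cost_def Let_def by simp
qed

text \<open>From \<open>n > 0\<close> follows \<open>bound Hs xs - Suc h + 1 \<le> m\<close>, even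
  if \<open>h\<close> has passed the bound and the difference is cut off at \<open>0\<close>. Hence
  both factors of \<open>run_cost\<close> at \<open>Suc h\<close> are dominated by those in
  \<open>go_cost\<close>.\<close>

lemma go_cost_decrease:
  assumes "\<And>h. h \<in> set Gs \<union> set Hs \<Longrightarrow> mono h" "length Gs = k" "length Hs = k" "length xs = l"
    "n > 0"
  shows "go_cost Gs Hs xs n h > run_cost Gs Hs xs (Suc h) + stepc K Gs n"
proof -
  define m where "m = max n (bound Hs xs - h)"
  let ?d = "bound Hs xs - Suc h"
  have m: "?d + 1 \<le> m" "n \<le> m" using assms(5) by (auto simp: m_def)
  have "run_cost Gs Hs xs (Suc h) \<le> m * round_cost Gs Hs xs (h + 2 * m)"
    unfolding run_cost_def using m assms by (intro mult_le_mono round_cost_mono') auto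
  moreover have "stepc K Gs n \<le> stepc K Gs m"
    using assms(1) m by (intro stepc_mono frel_refl) auto
  ultimately show ?thesis by (simp add: go_cost_def Let_def m_def[symmetric])
qed

text \<open>This is \<open>run_cost\<close> for the empty history plus \<open>2\<close>: one unit
  for the \<open>pop\<close> that lays out the input, one for the strict decrease of the rule for
  \<open>F\<close>.\<close>

definition main_costP :: sopoly where
  "main_costP = (let B = sizeP clock; Z = PMul (PConst 2) B in
     PAdd (PMul (PAdd B (PConst 1)) (PAdd (PAdd (PAdd (stepP K k Z) (cthP Z clock)) B) (PConst 3))) (PConst 2))"

lemma main_costP_over: "sopoly_over (2 * k) l main_costP"
  by (simp add: main_costP_def Let_def sizeP_over stepP_over cthP_over clock_over)

lemma main_costP_eval:
  assumes "length Gs = k" "length Hs = k"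
  shows "sopoly_eval (concat (map2 (\<lambda>g h. [g, h]) Gs Hs)) xs main_costP = run_cost Gs Hs xs 0 + 2"
  using assms sizeP_eval[OF assms refl clock_over] stepP_eval[OF assms refl] cthP_eval[OF assms refl clock_over]
  by (simp add: main_costP_def Let_def run_cost_def round_cost_def bound_def)

text \<open>Stacks, cells, tapes and states fall under the final \<open>0\<close>, and a history
  counts only its entries. The size of \<open>go\<close> includes the fuel \<open>xs ! l\<close>
  because the final rule returns a word whose size is that of the fuel.\<close>

definition size_fun :: size_fun where
  "size_fun g Hs xs =
    (if g = SymCons then xs ! 0 + xs ! 1 + 1
     else if g = appS then xs ! 0 + xs ! 1
     else if g = mulS then xs ! 0 * xs ! 1
     else if g = mxS then max (xs ! 0) (xs ! 1)
     else if g = limS then min (xs ! 0) (xs ! 1)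
     else if g = drpS then xs ! 1 - xs ! 0
     else if g = tryS then (Hs ! 0) (xs ! 1)
     else if g = hconsS then xs ! 1 + 1
     else if g = readS then xs ! 0
     else if g = rewS then xs ! 0
     else if g = SymF then bound Hs xs
     else if g = runS then bound Hs (take l xs)
     else if g = goS then max (xs ! l) (bound Hs (take l xs))
     else 0)"

text \<open>Each unit of the first argument of \<open>mul\<close> pays for an \<open>app\<close> of
  cost \<open>n + 1\<close> and for the step itself. Each entry of the history in \<open>try\<close>
  pays for a truncation, an oracle call and a maximum, hence the three size-dependent
  summands.\<close>

definition cost_fun :: cost_fun where
  "cost_fun g Gs Hs xs =
    (if g = appS then xs ! 0 + 1
     else if g = mulS then xs ! 0 * (xs ! 1 + 2) + 1
     else if g = mxS then xs ! 0 + 1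
     else if g = limS then xs ! 1 + 1
     else if g = drpS then xs ! 1 + 1
     else if g = tryS then (xs ! 0 + 1) * ((Gs ! 0) (xs ! 1) + xs ! 1 + (Hs ! 0) (xs ! 1) + 5)
     else if g = popS then 1
     else if g = pullS then 1
     else if g = readS then xs ! 0 + 1
     else if g = rewS then xs ! 0 + xs ! 1 + 2
     else if g = SymF then run_cost Gs Hs xs 0 + 2
     else if g = runS then run_cost Gs Hs (take l xs) (xs ! l)
     else if g = goS then go_cost Gs Hs (take l xs) (xs ! l) (xs ! Suc l)
     else 0)"

abbreviation "tm_size \<equiv> psize size_fun"
abbreviation "tm_cost \<equiv> pcost size_fun cost_fun"
abbreviation "tm_total \<equiv> ptotal size_fun cost_fun"

section \<open>Monotonicity of the interpretation\<close>

lemma lrel_take: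
  assumes "lrel (replicate l WordB @ bs) xs xs'"
  shows "list_all2 (\<ge>) (take l xs) (take l xs')" "lrel bs (drop l xs) (drop l xs')"
proof -
  have *: "lrel (bs' @ bs) xs xs' \<Longrightarrow> lrel bs' (take (length bs') xs) (take (length bs') xs') \<and>
      lrel bs (drop (length bs') xs) (drop (length bs') xs')" for bs'
    by (induction bs' arbitrary: xs xs') fastforce+
  have **: "lrel (replicate n WordB) ys ys' \<Longrightarrow> list_all2 (\<ge>) ys ys'" for n ys ys'
    by (induction n arbitrary: ys ys') auto
  show "list_all2 (\<ge>) (take l xs) (take l xs')" "lrel bs (drop l xs) (drop l xs')"
    using *[of "replicate l WordB"] assms **[of l] by auto
qed

lemma lrel_word: "lrel (replicate l WordB) xs xs' \<Longrightarrow> list_all2 (\<ge>) xs xs' \<and> length xs = l"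
  using lrel_take(1)[of "[]" xs xs'] by (auto simp: lrel_iff)

lemma lrel_run:
  assumes "lrel (replicate l WordB @ [histB, stateB] @ replicate K tapeB) xs xs'"
  shows "list_all2 (\<ge>) (take l xs) (take l xs')" "length (take l xs) = l" "xs ! l = xs' ! l"
proof -
  have len: "length xs = l + 2 + K" "length xs' = l + 2 + K" using assms by (auto simp: lrel_iff)
  have "lrel ([histB, stateB] @ replicate K tapeB) (drop l xs) (drop l xs')"
    using lrel_take(2)[OF assms] .
  then have "drop l xs ! 0 = drop l xs' ! 0" by auto
  then show "xs ! l = xs' ! l" using len by simp
  show "list_all2 (\<ge>) (take l xs) (take l xs')" using lrel_take(1)[OF assms] .
  show "length (take l xs) = l" using len by simp
qed

lemma lrel_go:
  assumes "lrel (replicate l WordB @ [WordB, histB, stateB] @ replicate K tapeB) xs xs'"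
  shows "list_all2 (\<ge>) (take l xs) (take l xs')" "length (take l xs) = l" "xs ! l \<ge> xs' ! l"
    "xs ! Suc l = xs' ! Suc l"
proof -
  have len: "length xs = l + 3 + K" "length xs' = l + 3 + K" using assms by (auto simp: lrel_iff)
  have "lrel ([WordB, histB, stateB] @ replicate K tapeB) (drop l xs) (drop l xs')"
    using lrel_take(2)[OF assms] .
  then have "drop l xs ! 0 \<ge> drop l xs' ! 0" "drop l xs ! 1 = drop l xs' ! 1" by auto
  then show "xs ! l \<ge> xs' ! l" "xs ! Suc l = xs' ! Suc l" using len by simp_all
  show "list_all2 (\<ge>) (take l xs) (take l xs')" using lrel_take(1)[OF assms] .
  show "length (take l xs) = l" using len by simp
qed

lemma frel_single: "frel [h] Hs' \<longleftrightarrow> (\<exists>h'. Hs' = [h'] \<and> mono h \<and> mono h' \<and> (\<forall>n. h n \<ge> h' n))"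
  by (cases Hs') (auto simp: frel_def)

lemma size_fun_mono:
  assumes "ar g = Some (k', bs, b)" "length Hs = k'" "frel Hs Hs'" "lrel bs xs xs'"
  shows "relb b (size_fun g Hs xs) (size_fun g Hs' xs')"
proof -
  have bound: "bound Hs ys \<ge> bound Hs' ys'" if "length Hs = k" "list_all2 (\<ge>) ys ys'" "length ys = l" for ys ys'
    using bound_mono[OF assms(3,3) that(2)] that by simp
  show ?thesis
    using assms(1)
  proof (cases rule: ar_cases)
    case 1
    have mono: "(h::nat \<Rightarrow> nat) x \<ge> h' y" if "mono h" "\<forall>n. h n \<ge> h' n" "x \<ge> y" for h h' x y
      using that by (meson monoD order_trans)
    consider "g = SymF" "bs = replicate l WordB" "k' = k" "b = WordB"
      | "g = runS" "bs = replicate l WordB @ [histB, stateB] @ replicate K tapeB" "k' = k" "b = WordB"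
      | "g = goS" "bs = replicate l WordB @ [WordB, histB, stateB] @ replicate K tapeB" "k' = k" "b = WordB"
      | "g = tryS" "bs = [histB, WordB]" "k' = 1" "b = WordB"
      | "g \<notin> {SymF, runS, goS, tryS}" "k' = 0"
      using 1 unfolding fixed_ar_def by auto
    then show ?thesis
    proof cases
      case 1
      then show ?thesis using bound[of xs xs'] lrel_word[of xs xs'] assms by (simp add: size_fun_def)
    next
      case 2
      then show ?thesis using bound[of "take l xs" "take l xs'"] lrel_run[of xs xs'] assms
        by (simp add: size_fun_def)
    next
      case 3
      then show ?thesis using bound[of "take l xs" "take l xs'"] lrel_go[of xs xs'] assms
        by (auto simp: size_fun_def)
    next
      case 4
      then obtain h x y where xs: "xs = [h, x]" "xs' = [h, y]" "x \<ge> y" using assms(4) by auto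
      obtain H H' where H: "Hs = [H]" "Hs' = [H']" "mono H" "\<forall>n. H n \<ge> H' n"
        using assms(2,3) 4 by (auto simp: length_Suc_conv frel_single)
      have "H x \<ge> H' y" using mono H xs by auto
      then show ?thesis using 4 xs H by (simp add: size_fun_def)
    next
      case 5
      then have "size_fun g Hs xs = 0 \<and> size_fun g Hs' xs' = 0 \<or>
          (g, bs, b) \<in> {(SymCons, [BitB, WordB], WordB), (appS, [WordB, WordB], WordB),
            (mulS, [WordB, WordB], WordB), (mxS, [WordB, WordB], WordB), (limS, [WordB, WordB], WordB),
            (drpS, [histB, WordB], WordB), (hconsS, [WordB, histB], histB), (readS, [WordB, stkB], WordB),
            (rewS, [WordB, WordB, stkB, stkB], WordB)}"
        using 1 by (auto simp: fixed_ar_def size_fun_def)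
      then show ?thesis
        using assms(4) by (auto simp: size_fun_def mult_le_mono)
    qed
  qed (use assms(4) in \<open>auto simp: size_fun_def\<close>)
qed

lemma cost_fun_mono:
  assumes "ar g = Some (k', bs, b)" "length Gs = k'" "length Hs = k'" "frel Gs Gs'" "frel Hs Hs'" "lrel bs xs xs'"
  shows "cost_fun g Gs Hs xs \<ge> cost_fun g Gs' Hs' xs'"
  using assms(1)
proof (cases rule: ar_cases)
  case 1
  have mono: "(h::nat \<Rightarrow> nat) x \<ge> h' y" if "mono h" "\<forall>n. h n \<ge> h' n" "x \<ge> y" for h h' x y
    using that by (meson monoD order_trans)
  note rc = run_cost_mono[OF assms(4,5)] and gc = go_cost_mono[OF assms(4,5)]
  consider "g = SymF" "bs = replicate l WordB" "k' = k"
    | "g = runS" "bs = replicate l WordB @ [histB, stateB] @ replicate K tapeB" "k' = k"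
    | "g = goS" "bs = replicate l WordB @ [WordB, histB, stateB] @ replicate K tapeB" "k' = k"
    | "g = tryS" "bs = [histB, WordB]" "k' = 1"
    | "g \<notin> {SymF, runS, goS, tryS}" "k' = 0"
    using 1 unfolding fixed_ar_def by auto
  then show ?thesis
  proof cases
    case 1
    then show ?thesis using rc[of xs xs' 0] lrel_word[of xs xs'] assms by (simp add: cost_fun_def)
  next
    case 2
    then show ?thesis using rc[of "take l xs" "take l xs'"] lrel_run[of xs xs'] assms
      by (simp add: cost_fun_def)
  next
    case 3
    then show ?thesis using gc[of "take l xs" "take l xs'"] lrel_go[of xs xs'] assms
      by (simp add: cost_fun_def)
  next
    case 4
    then obtain h x y where xs: "xs = [h, x]" "xs' = [h, y]" "x \<ge> y" using assms(6) by auto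
    obtain G G' where G: "Gs = [G]" "Gs' = [G']" "mono G" "\<forall>n. G n \<ge> G' n"
      using assms(2,4) 4 by (auto simp: length_Suc_conv frel_single)
    obtain H H' where H: "Hs = [H]" "Hs' = [H']" "mono H" "\<forall>n. H n \<ge> H' n"
      using assms(3,5) 4 by (auto simp: length_Suc_conv frel_single)
    have "G x \<ge> G' y" "H x \<ge> H' y" using mono G H xs by auto
    then have "(h + 1) * (G x + x + H x + 5) \<ge> (h + 1) * (G' y + y + H' y + 5)"
      using xs(3) by (intro mult_le_mono add_mono) auto
    then show ?thesis using 4 xs G H by (simp add: cost_fun_def del: mult_Suc)
  next
    case 5
    then have "cost_fun g Gs Hs xs = cost_fun g Gs' Hs' xs' \<or>
        (g, bs) \<in> {(appS, [WordB, WordB]), (mulS, [WordB, WordB]), (mxS, [WordB, WordB]),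
          (limS, [WordB, WordB]), (drpS, [histB, WordB]), (readS, [WordB, stkB]),
          (rewS, [WordB, WordB, stkB, stkB])}"
      using 1 by (auto simp: fixed_ar_def cost_fun_def)
    then show ?thesis
      using assms(6) by (auto simp: cost_fun_def mult_le_mono simp del: mult_Suc_right add_2_eq_Suc')
  qed
qed (simp_all add: cost_fun_def)

abbreviation "J \<equiv> interp_of ar size_fun cost_fun"

lemma cost_size_interp_J: "cost_size_interp (sig_of ar) J"
  using size_fun_mono cost_fun_mono by (intro cost_size_interp_of)

section \<open>Every rule decreases cost and does not increase size\<close>

definition root_base :: "pt \<Rightarrow> base" where
  "root_base t = (case t of PS g js ts \<Rightarrow> (case ar g of Some (k, bs, b) \<Rightarrow> b))"

definition decreasing :: "prule \<Rightarrow> bool" where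
  "decreasing = (\<lambda>(\<l>, r). \<forall>G H V. (\<forall>i. mono (G i) \<and> mono (H i)) \<longrightarrow>
     tm_cost G H V \<l> > tm_total G H V r \<and>
     relb (root_base \<l>) (tm_size H V \<l>) (tm_size H V r))"

lemma root_base_PS [simp]: "root_base (PS g js ts) = (case ar g of Some (k, bs, b) \<Rightarrow> b)"
  by (simp add: root_base_def)

lemma root_base_go [simp]: "root_base (go_lhs q c) = WordB"
  and root_base_run [simp]: "root_base (runp h q' t) = WordB"
  by (simp_all add: go_lhs_def gop_def runp_def)

lemma cost_bitp [simp]: "tm_size H V (bitp b) = 0" "tm_total G H V (bitp b) = 0"
  by (simp_all add: bitp_def size_fun_def cost_fun_def)

lemma cost_cellp [simp]: "tm_size H V (cellp c) = 0" "tm_total G H V (cellp c) = 0"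
  "tm_size H V (statep q) = 0" "tm_total G H V (statep q) = 0"
  by (simp_all add: size_fun_def cost_fun_def)

text \<open>The rules of \<open>try\<close> are set apart because they alone among these groups
  contain a function variable and so require the monotonicity of \<open>G\<close> and
  \<open>H\<close>.\<close>

lemma decreasing_fixed:
  assumes "(g, G) \<in> set fixed_groups" "\<rho> \<in> G"
  shows "\<rho> \<in> try_rules \<or> decreasing \<rho>"
proof -
  \<comment> \<open>Cost and size of the recursive rule for \<open>mul\<close>, where the first word
    has a head bit of size \<open>y\<close> and a tail of size \<open>m\<close>, and the second word
    has size \<open>n\<close>.\<close>
  have "Suc (n + m * Suc (Suc n)) < Suc (m + y) * Suc (Suc n)" "n + m * n \<le> Suc (m + y) * n" for m n y :: nat
    by (simp_all add: algebra_simps)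
  then show ?thesis
    using assms unfolding fixed_groups_def
    by (auto simp: decreasing_def app_rules_def mul_rules_def mx_rules_def lim_rules_def drp_rules_def
        pop_rules_def pull_rules_def read_rules_def rew_rules_def size_fun_def cost_fun_def add_mult_distrib)
qed

text \<open>The truncated entry has size \<open>min m n\<close>, and by monotonicity
  \<open>G\<close> and \<open>H\<close> are at most their values at \<open>n\<close> there. So one
  entry is paid for by one of the equal shares in the cost of \<open>try\<close>.\<close>

lemma decreasing_try: "\<rho> \<in> try_rules \<Longrightarrow> decreasing \<rho>"
proof -
  { fix G H :: "nat \<Rightarrow> nat" and h m n :: nat
    assume m: "mono G" "mono H"
    have "G (min m n) \<le> G n" "H (min m n) \<le> H n" using m by (simp_all add: monoD)
    then have "Suc (Suc (H (min m n) + (G (min m n) + n + Suc h * (G n + n + H n + 5))))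
        < Suc (Suc h) * (G n + n + H n + 5)"
      by simp_all }
  moreover have "H (min m n) \<le> H n" if "mono H" for H :: "nat \<Rightarrow> nat" and m n
    using that by (simp add: monoD)
  ultimately show "\<rho> \<in> try_rules \<Longrightarrow> decreasing \<rho>"
    unfolding try_rules_def decreasing_def
    by (auto simp: size_fun_def cost_fun_def simp del: mult_Suc intro: monoD)
qed

lemma psize_lit [simp]: "tm_size H V (lit n) = n"
  and ptotal_lit [simp]: "tm_total G H V (lit n) = 0"
  by (induction n) (auto simp: size_fun_def cost_fun_def)

lemma psize_clock_ops:
  "tm_size H V (appp m n) = tm_size H V m + tm_size H V n"
  "tm_size H V (mulp m n) = tm_size H V m * tm_size H V n"
  "tm_size H V (tryp i h n) = H i (tm_size H V n)"
  by (simp_all add: size_fun_def)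

lemma ptotal_clock_ops:
  "tm_total G H V (appp m n) =
     tm_size H V m + 1 + (tm_total G H V m + tm_total G H V n)"
  "tm_total G H V (mulp m n) =
     tm_size H V m * (tm_size H V n + 2) + 1 +
     (tm_total G H V m + tm_total G H V n)"
  "tm_total G H V (tryp i h n) =
     (tm_size H V h + 1) *
       (G i (tm_size H V n) + tm_size H V n + H i (tm_size H V n) + 5) +
     (tm_total G H V h + tm_total G H V n)"
  by (simp_all add: cost_fun_def)

text \<open>The history does not appear on the right: \<open>try\<close> has the size
  \<open>H\<close> of its last argument. This makes the size of the clock the same in all
  rounds.\<close>

lemma psize_theta: "sopoly_over k l Q \<Longrightarrow>
    tm_size H V (theta Q) = sopoly_eval (map H Fvars) (map (tm_size H V) xvars) Q"
  by (induction Q) (auto simp: psize_clock_ops Fvars_def xvars_def simp del: psize.simps(3))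

lemma ptotal_theta: "sopoly_over k l Q \<Longrightarrow> tm_total G H V (theta Q) =
    cth (map G Fvars) (map H Fvars) (map (tm_size H V) xvars) (V 0 histB) Q"
  by (induction Q)
    (simp_all add: ptotal_clock_ops psize_theta del: psize.simps(3) ptotal.simps(3), simp add: Fvars_def)

context
  fixes G H :: "nat \<Rightarrow> nat \<Rightarrow> nat" and V :: "nat \<Rightarrow> base \<Rightarrow> nat"
begin

abbreviation "psz \<equiv> tm_size H V"
abbreviation "ptt \<equiv> tm_total G H V"
abbreviation "GG \<equiv> map G Fvars"
abbreviation "HH \<equiv> map H Fvars"
abbreviation "xx \<equiv> map psz xvars"

lemma size_runp: "psz (runp h q t) = bound HH xx"
  by (simp add: runp_def size_fun_def)

lemma size_gop: "psz (gop n h q t) = max (psz n) (bound HH xx)"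
  by (simp add: gop_def size_fun_def nth_append)

lemma total_xvars: "sum_list (map ptt xvars) = 0"
proof -
  have "map ptt xvars = map (\<lambda>_. 0) [0..<l]" by (simp add: xvars_def)
  then show ?thesis by (simp add: sum_list_triv)
qed

lemma total_runp: "ptt (runp h q t) = run_cost GG HH xx (psz h) + ptt h + ptt q + (\<Sum>j<K. ptt (t j))"
  by (simp add: runp_def cost_fun_def total_xvars tapes_of_def nth_append comp_def
      interv_sum_list_conv_sum_set_nat atLeast0LessThan)

lemma cost_runp: "tm_cost G H V (runp h q t) = run_cost GG HH xx (psz h)"
  by (simp add: runp_def cost_fun_def nth_append)

lemma total_gop: "ptt (gop n h q t) =
    go_cost GG HH xx (psz n) (psz h) + ptt n + ptt h + ptt q + (\<Sum>j<K. ptt (t j))"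
  by (simp add: gop_def cost_fun_def total_xvars tapes_of_def nth_append comp_def
      interv_sum_list_conv_sum_set_nat atLeast0LessThan)

lemma cost_gop: "tm_cost G H V (gop n h q t) = go_cost GG HH xx (psz n) (psz h)"
  by (simp add: gop_def cost_fun_def nth_append)

lemma size_input_stack: "psz input_stack = 0" "ptt input_stack = 0"
proof -
  have "psz (foldr inpp ts botp) = 0" for ts
    by (cases ts) (auto simp: size_fun_def)
  then show "psz input_stack = 0" by (simp add: input_stack_def)
  have "ptt (foldr inpp ts botp) = sum_list (map ptt ts)" for ts
    by (induction ts) (auto simp: cost_fun_def)
  then show "ptt input_stack = 0" using total_xvars by (simp add: input_stack_def)
qed

lemma size_extractp: "psz (extractp j) = V l WordB"
  by (simp add: extractp_def size_fun_def)

lemma total_extractp: "ptt (extractp j) = 2 * V l WordB + 2"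
  by (simp add: extractp_def cost_fun_def lvar_def rvar_def)

lemma total_actp: "ptt (actp j a) \<le> 1"
  by (cases a; cases "snd a") (auto simp: cost_fun_def lvar_def rvar_def)

lemma size_go_lhs: "psz (go_lhs q c) = max (V l WordB + V 0 BitB + 1) (bound HH xx)"
  by (simp add: go_lhs_def size_gop) (simp add: size_fun_def)

lemma cost_go_lhs: "tm_cost G H V (go_lhs q c) =
    go_cost GG HH xx (Suc (V l WordB + V 0 BitB)) (V 0 histB)"
  by (simp add: go_lhs_def cost_gop) (simp add: size_fun_def add.commute)

lemma F_rule_decrease:
  "tm_cost G H V (PS SymF Fvars xvars) > ptt (runp hnilp (statep q)
       (\<lambda>j. if j = 0 then popp botp input_stack else tapep botp (cellp Blank) botp))"
proof -
  have "(\<Sum>j<K. ptt (if j = 0 then popp botp input_stack else tapep botp (cellp Blank) botp))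
      = (\<Sum>j<K. if j = 0 then 1 else 0)"
    by (intro sum.cong) (auto simp: size_input_stack, auto simp: cost_fun_def)
  also have "\<dots> \<le> 1" by simp
  finally show ?thesis by (simp add: total_runp) (simp add: size_fun_def cost_fun_def)
qed

context
  assumes mono: "\<And>i. mono (G i)" "\<And>i. mono (H i)"
begin

lemma args: "\<And>h. h \<in> set GG \<union> set HH \<Longrightarrow> mono h" "length GG = k" "length HH = k" "length xx = l"
  using mono by auto

lemma run_rule_decrease:
  "run_cost GG HH xx (V 0 histB) > ptt (gop (drpp vh (theta clock)) vh (PV 0 stateB) (\<lambda>j. PV j tapeB))"
  using run_cost_decrease[OF args, of "V 0 histB"] ptotal_theta[OF clock_over, of G H V]
    psize_theta[OF clock_over, of H V]
  by (simp add: total_gop size_fun_def cost_fun_def bound_def)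

text \<open>Here \<open>n\<close> is the size of the fuel that remains visible on the right-hand
  side and \<open>y\<close> that of the bit removed from the clock.\<close>

lemma go_decrease: "go_cost GG HH xx (Suc (n + y)) h > run_cost GG HH xx (Suc h) + stepc K GG n"
proof -
  have "stepc K GG n \<le> stepc K GG (Suc (n + y))" by (intro stepc_mono frel_refl) (use args(1) in auto)
  then show ?thesis using go_cost_decrease[OF args, of "Suc (n + y)" h] by simp
qed

lemma step_rule_decrease:
  "go_cost GG HH xx (Suc (V l WordB + V 0 BitB)) (V 0 histB) >
    ptt (runp (hconsp nilp vh) (statep q) (\<lambda>j. actp j (acts ! j)))"
proof -
  have "(\<Sum>j<K. ptt (actp j (acts ! j))) \<le> (\<Sum>j<K. 1)"
    by (intro sum_mono total_actp)
  then show ?thesis using go_decrease[where n = "V l WordB" and y = "V 0 BitB" and h = "V 0 histB"]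
    by (simp add: total_runp size_fun_def cost_fun_def stepc_def)
qed

text \<open>With fuel of size \<open>v\<close>, each of the two extractions costs
  \<open>2 * v + 2\<close>, the oracle call at most \<open>G i v\<close>, and the \<open>pop\<close>
  for the answer one unit. This is the origin of \<open>4 * v\<close> and of the sum in
  \<open>stepc\<close>; its summand \<open>K\<close> stems from the moves in step rules.\<close>

lemma query_rule_decrease:
  assumes "i < k"
  shows "go_cost GG HH xx (Suc (V l WordB + V 0 BitB)) (V 0 histB) > ptt (snd (query_rule i))"
proof -
  define t where "t j = (if j = 2 * i + 1 then tapep botp (cellp Blank) botp
            else if j = 2 * i + 2 then popp botp (inpp (PF i (extractp (2 * i + 1))) botp)
            else tapep (lvar j) (PV j symB) (rvar j))" for j
  have t0: "ptt (t j) = (if j = 2 * i + 2 then G i (V l WordB) + 2 * V l WordB + 3 else 0)" for j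
    by (simp add: t_def total_extractp size_extractp) (simp add: cost_fun_def lvar_def rvar_def)
  have "(\<Sum>j<K. ptt (t j)) \<le> G i (V l WordB) + 2 * V l WordB + 3"
    unfolding t0 by (simp add: sum.delta)
  moreover have "G i (V l WordB) \<le> (\<Sum>F \<leftarrow> GG. F (V l WordB))"
    by (rule member_le_sum_list) (use assms in \<open>auto simp: Fvars_def\<close>)
  ultimately show ?thesis using go_decrease[where n = "V l WordB" and y = "V 0 BitB" and h = "V 0 histB"]
    unfolding query_rule_def snd_conv t_def[symmetric]
    by (simp add: total_runp total_extractp) (simp add: size_fun_def cost_fun_def stepc_def)
qed

lemma final_rule_decrease:
  "go_cost GG HH xx (Suc (V l WordB + V 0 BitB)) (V 0 histB) > ptt (extractp j)"
  using go_decrease[where n = "V l WordB" and y = "V 0 BitB" and h = "V 0 histB"]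
  by (simp add: total_extractp stepc_def)

end

end

lemma decreasing_go: "\<rho> \<in> go_rules \<Longrightarrow> decreasing \<rho>"
proof -
  have "decreasing (query_rule i)" if "i < k" for i
    using query_rule_decrease[OF _ _ that]
    by (simp add: query_rule_def decreasing_def cost_go_lhs size_go_lhs size_runp)
  moreover have "decreasing (step_rule q cs)" for q cs
    by (simp add: step_rule_def decreasing_def cost_go_lhs size_go_lhs size_runp step_rule_decrease)
  moreover have "decreasing (final_rule q)" for q
    by (simp add: final_rule_def decreasing_def cost_go_lhs size_go_lhs size_extractp final_rule_decrease le_max_iff_disj)
  ultimately show "\<rho> \<in> go_rules \<Longrightarrow> decreasing \<rho>" by (auto simp: go_rules_def)
qed

lemma decreasing_run: "\<rho> \<in> run_rules \<Longrightarrow> decreasing \<rho>"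
proof -
  have "tm_size H V (drpp vh (theta clock)) \<le> bound (map H Fvars) (map (tm_size H V) xvars)" for H V
    by (simp add: psize_theta[OF clock_over] bound_def) (simp add: size_fun_def)
  then show "\<rho> \<in> run_rules \<Longrightarrow> decreasing \<rho>"
    by (simp add: run_rules_def decreasing_def cost_runp run_rule_decrease size_runp size_gop)
qed

lemma decreasing_F: "\<rho> \<in> F_rules \<Longrightarrow> decreasing \<rho>"
proof -
  have "tm_size H V (PS SymF Fvars xvars) = bound (map H Fvars) (map (tm_size H V) xvars)" for H V
    by (simp add: size_fun_def)
  then show "\<rho> \<in> F_rules \<Longrightarrow> decreasing \<rho>"
    by (simp add: F_rules_def decreasing_def F_rule_decrease size_runp del: pcost.simps psize.simps)
qed

lemma decreasing_rules: "\<rho> \<in> rules \<Longrightarrow> decreasing \<rho>"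
  using decreasing_fixed[of _ _ \<rho>] decreasing_try[of \<rho>] decreasing_go[of \<rho>] decreasing_run[of \<rho>] decreasing_F[of \<rho>]
  unfolding rules_def groups_def by auto

lemma compatible_sys: "compatible (sig_of ar) sys J"
  unfolding sys_def
proof (rule compatible_interp_of)
  fix \<l> r assume lr: "(\<l>, r) \<in> rules"
  then obtain g G where "(g, G) \<in> set groups" "(\<l>, r) \<in> G" by (rule rules_cases)
  then have g: "good_rule g (\<l>, r)" by (rule good_rules)
  then obtain js ts where "\<l> = PS g js ts" by (auto simp: good_rule_def)
  then have "\<not> is_Var (tr \<l>)"
    by (cases "map (\<lambda>i. Var i funT) js @ map tr ts" rule: rev_cases) (simp_all del: map_append)
  then show "\<not> is_Var (tr \<l>) \<and> (\<exists>b. ptype ar \<l> = Some b \<and> ptype ar r = Some b)"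
    using g by (auto simp: good_rule_def)
next
  fix \<l> r b and G H :: "nat \<Rightarrow> nat \<Rightarrow> nat" and V
  assume lr: "(\<l>, r) \<in> rules" "ptype ar \<l> = Some b" "\<And>i. mono (G i)" "\<And>i. mono (H i)"
  moreover have "root_base \<l> = b"
  proof -
    obtain g G where "(g, G) \<in> set groups" "(\<l>, r) \<in> G" using lr(1) by (rule rules_cases)
    then have "good_rule g (\<l>, r)" by (rule good_rules)
    then show ?thesis using lr(2) by (auto simp: good_rule_def)
  qed
  ultimately show "tm_cost G H V \<l> > tm_total G H V r \<and>
      relb b (tm_size H V \<l>) (tm_size H V r)"
    using decreasing_rules[OF lr(1), unfolded decreasing_def prod.case, rule_format, of G H V] by blast
qed

lemma ar_SymF: "ar SymF = Some (k, replicate l WordB, WordB)"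
  by simp

lemma poly_bounded_sys: "poly_bounded k l (sig_of ar) sys J"
proof -
  have "main_cost (cost_of_sym J SymF) Gs Hs xs
             \<le> sopoly_eval (concat (map2 (\<lambda>g h. [g, h]) Gs Hs)) xs main_costP"
    if a: "length Gs = k" "length Hs = k" "length xs = l" "\<forall>h \<in> set Gs \<union> set Hs. mono h" for Gs Hs xs
  proof -
    have "main_cost (cost_of_sym J SymF) Gs Hs xs = run_cost Gs Hs xs 0 + 2"
      unfolding main_cost_def cost_of_sym_interp[where ar = ar and g = SymF, OF ar_SymF]
      using capp_costb[of Gs k Hs "map (\<lambda>x. (Val 0, Val x)) xs" "length (replicate l WordB)" xs "cost_fun SymF"] a
      by (simp add: comp_def) (simp add: cost_fun_def)
    then show ?thesis using main_costP_eval a by simp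
  qed
  moreover have "base_set J = bset" by (simp add: interp_of_def)
  moreover have "cost_of_sym J SymO = CLow (Val 0)" "cost_of_sym J SymI = CLow (Val 0)"
    "cost_of_sym J SymNil = CLow (Val 0)" "cost_of_sym J SymCons = CLow (Abs (\<lambda>x. Abs (\<lambda>y. Val 0)))"
    "size_of_sym J SymCons = SLow (Abs (\<lambda>x. Abs (\<lambda>y. Val (x + y + 1))))"
    by (simp_all add: interp_of_def cost_fun_def size_fun_def numeral_2_eq_2)
  ultimately show ?thesis
    unfolding poly_bounded_def using cost_size_interp_J compatible_sys main_costP_over
    by (auto simp: bset_def)
qed

end

subsection \<open>Evaluation of the auxiliary functions\<close>

text \<open>A substitution has to respect the types of all variables of order at most 1, so function
  variables of a type other than \<open>funT\<close> are mapped to themselves.\<close>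

definition asg :: "(nat \<Rightarrow> trm) \<Rightarrow> (nat \<Rightarrow> base \<Rightarrow> trm) \<Rightarrow> subst" where
  "asg \<phi> v n \<sigma> = (case \<sigma> of Base b \<Rightarrow> v n b | Arrow _ _ \<Rightarrow> if \<sigma> = funT then \<phi> n else Var n \<sigma>)"

definition inst :: "(nat \<Rightarrow> trm) \<Rightarrow> (nat \<Rightarrow> base \<Rightarrow> trm) \<Rightarrow> pt \<Rightarrow> trm" where
  "inst \<phi> v t = tr t \<cdot> asg \<phi> v"

lemma inst_simps [simp]:
  "inst \<phi> v (PV n b) = v n b"
  "inst \<phi> v (PF i t) = App (\<phi> i) (inst \<phi> v t)"
  "inst \<phi> v (PS g js ts) = apps (Sym g) (map \<phi> js @ map (inst \<phi> v) ts)"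
  by (simp_all add: inst_def asg_def subst_apps comp_def del: foldl_append)

definition vals :: "((nat \<times> base) \<times> trm) list \<Rightarrow> nat \<Rightarrow> base \<Rightarrow> trm" where
  "vals ts n b = (case map_of ts (n, b) of Some t \<Rightarrow> t | None \<Rightarrow> Var n (Base b))"

datatype stk = Bot | Push tsym stk | Inp word stk

primrec sem :: "stk \<Rightarrow> tsym list" where
  "sem Bot = []"
| "sem (Push a s) = a # sem s"
| "sem (Inp w s) = map Bit w @ Blank # sem s"

definition cell :: "tsym list \<Rightarrow> nat \<Rightarrow> tsym" where
  "cell cs j = (if j < length cs then cs ! j else Blank)"

definition is_bit :: "tsym \<Rightarrow> bool" where "is_bit a \<longleftrightarrow> (\<exists>b. a = Bit b)"

definition bits :: "tsym list \<Rightarrow> word" where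
  "bits cs = map (\<lambda>a. a = Bit True) (takeWhile is_bit cs)"

lemma bits_simps [simp]: "bits [] = []" "bits (Bit b # cs) = b # bits cs" "bits (Blank # cs) = []"
  "bits (Extra n # cs) = []"
  by (auto simp: bits_def is_bit_def)

fun popr :: "stk \<Rightarrow> tsym \<times> stk" where
  "popr Bot = (Blank, Bot)"
| "popr (Push a s) = (a, s)"
| "popr (Inp [] s) = (Blank, s)"
| "popr (Inp (b # w) s) = (Bit b, Inp w s)"

lemma cell_Cons [simp]: "cell (a # cs) 0 = a" "cell (a # cs) (Suc j) = cell cs j" "cell [] j = Blank"
  by (simp_all add: cell_def)

lemma popr_cell: "fst (popr s) = cell (sem s) 0" "cell (sem (snd (popr s))) j = cell (sem s) (Suc j)"
  by (cases s rule: popr.cases; simp)+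

definition pushes :: "tsym list \<Rightarrow> stk" where "pushes ls = foldr Push ls Bot"

lemma pushes_simps [simp]: "pushes [] = Bot" "pushes (a # ls) = Push a (pushes ls)"
  by (simp_all add: pushes_def)

primrec ench :: "word list \<Rightarrow> trm" where
  "ench [] = Sym hnilS"
| "ench (w # hs) = apps (Sym hconsS) [enc w, ench hs]"

primrec encs :: "stk \<Rightarrow> trm" where
  "encs Bot = Sym botS"
| "encs (Push a s) = apps (Sym pushS) [Sym (symS a), encs s]"
| "encs (Inp w s) = apps (Sym inpS) [enc w, encs s]"

definition enct :: "stk \<Rightarrow> tsym \<Rightarrow> stk \<Rightarrow> trm" where
  "enct s a r = apps (Sym tapeS) [encs s, Sym (symS a), encs r]"

abbreviation encb :: "bool \<Rightarrow> trm" where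
  "encb b \<equiv> Sym (if b then SymI else SymO)"

primrec max_answer :: "(word \<Rightarrow> word) \<Rightarrow> word list \<Rightarrow> nat \<Rightarrow> nat" where
  "max_answer f [] n = 0"
| "max_answer f (a # hs) n = max (length (f (take n a))) (max_answer f hs n)"

fun mxw :: "word \<Rightarrow> word \<Rightarrow> word" where
  "mxw [] n = n"
| "mxw (y # m) [] = y # m"
| "mxw (y # m) (z # n) = False # mxw m n"

lemma length_mxw [simp]: "length (mxw m n) = max (length m) (length n)"
  by (induction m n rule: mxw.induct) auto

section \<open>Innermost root steps in the presence of the oracle rules\<close>

locale machine_run = machine +
  fixes fs :: "(word \<Rightarrow> word) list"
  assumes length_fs: "length fs = k"
begin

abbreviation "\<Sigma>' \<equiv> oracle_signature (sig_of ar) fs"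
abbreviation "R' \<equiv> sys \<union> (\<Union>f \<in> set fs. oracle_rules f)"

text \<open>Constructors get \<open>None\<close>, so their applications to normal terms are normal.
  Oracle symbols need one argument, hence are normal when passed around unapplied.\<close>

definition D :: "symb \<Rightarrow> nat option" where
  "D g = (case g of Oracle f \<Rightarrow> Some 1 | _ \<Rightarrow>
     if g \<in> fst ` set groups then map_option (\<lambda>(k, bs, b). k + length bs) (ar g) else None)"

lemma D_simps [simp]: "D SymO = None" "D SymI = None" "D SymNil = None" "D SymCons = None"
  "D hnilS = None" "D hconsS = None" "D botS = None" "D pushS = None" "D inpS = None" "D tapeS = None"
  "D (symS a) = None" "D (stateS q) = None"
  by (auto simp: D_def groups_def fixed_groups_def split: symb.splits)

lemma D_Oracle [simp]: "D (Oracle f) = Some 1"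
  by (simp add: D_def)

sublocale fixed_arity \<Sigma>' R' D
proof
  fix \<l> r assume "(\<l>, r) \<in> R'"
  then show "\<exists>g args. \<l> = apps (Sym g) args \<and> D g = Some (length args)"
  proof
    assume "(\<l>, r) \<in> sys"
    then obtain l' r' g G where lr: "(l', r') \<in> G" "(g, G) \<in> set groups" "\<l> = tr l'"
      by (auto simp: sys_def elim!: rules_cases)
    have g: "good_rule g (l', r')" by (rule good_rules[OF lr(2,1)])
    then obtain js ts where l': "l' = PS g js ts" by (auto simp: good_rule_def)
    obtain k' bs b where ar: "ar g = Some (k', bs, b)" "length js = k'" "length ts = length bs"
      using g unfolding l' good_rule_def prod.case by (elim conjE) (erule ptype_PS)
    have "g \<in> fst ` set groups" using lr(2) by force
    moreover have "g \<noteq> Oracle f" for f using ar(1) by auto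
    ultimately have "D g = Some (length js + length ts)"
      using ar by (auto simp: D_def split: symb.splits)
    then show ?thesis using lr(3) l'
      by (intro exI[of _ g] exI[of _ "map (\<lambda>i. Var i funT) js @ map tr ts"]) (simp del: foldl_append)
  next
    assume "(\<l>, r) \<in> (\<Union>f \<in> set fs. oracle_rules f)"
    then obtain f u where "\<l> = App (Sym (Oracle f)) (enc u)" by (auto simp: oracle_rules_def)
    then show ?thesis by (intro exI[of _ "Oracle f"] exI[of _ "[enc u]"]) simp
  qed
qed

abbreviation red :: "trm \<Rightarrow> trm \<Rightarrow> bool" (infix "\<rightarrow>*" 50) where
  "s \<rightarrow>* t \<equiv> (innermost \<Sigma>' R')\<^sup>*\<^sup>* s t"

lemma sig_sub: "sig_of ar \<subseteq>\<^sub>m \<Sigma>'"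
  by (auto simp: map_le_def oracle_signature_def sig_of_def map_add_def)

lemma sig_Oracle: "f \<in> set fs \<Longrightarrow> \<Sigma>' (Oracle f) = Some funT"
  by (simp add: oracle_signature_def)

text \<open>Variables count as values as well: a substitution is total, and variables that do not
  occur in a rule are instantiated by themselves.\<close>

definition val :: "base \<Rightarrow> trm \<Rightarrow> bool" where
  "val b t \<longleftrightarrow> type_of \<Sigma>' t = Some (Base b) \<and> normal \<Sigma>' R' t"

lemma val_Var [simp]: "val b (Var n (Base b))"
  by (simp add: val_def)

lemma val_apps:
  assumes "ar g = Some (0, bs, b)" "D g = None" "list_all2 val bs ts"
  shows "val b (apps (Sym g) ts)"
proof -
  have "sig_of ar g = Some (first_ty bs b)" using assms(1) by (simp add: sig_of_def fun_ty_0)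
  then have "\<Sigma>' g = Some (foldr Arrow (map Base bs @ []) (Base b))"
    using sig_sub by (metis append_Nil2 domI map_le_def)
  moreover have "map (type_of \<Sigma>') ts = map Some (map Base bs)"
    using assms(3) by (induction rule: list_all2_induct) (auto simp: val_def)
  ultimately have "type_of \<Sigma>' (apps (Sym g) ts) = Some (Base b)"
    using type_of_apps[of \<Sigma>' "Sym g" "map Base bs" "[]" "Base b" ts] by simp
  moreover have "normal \<Sigma>' R' (apps (Sym g) ts)"
    using assms(2,3) by (intro normal_apps) (auto simp: val_def list_all2_conv_all_nth in_set_conv_nth)
  ultimately show ?thesis by (simp add: val_def)
qed

lemma val_const: "ar g = Some (0, [], b) \<Longrightarrow> D g = None \<Longrightarrow> val b (Sym g)"
  using val_apps[of g "[]" b "[]"] by simp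

lemma val_bit [simp]: "val BitB (encb b)"
  by (auto intro: val_const)

lemma val_cell [simp]: "a \<in> alphabet M \<Longrightarrow> val symB (Sym (symS a))"
  by (auto intro: val_const)

lemma val_state [simp]: "q \<in> states M \<Longrightarrow> val stateB (Sym (stateS q))"
  by (auto intro: val_const)

lemma val_enc [simp]: "val WordB (enc w)"
proof (induction w)
  case (Cons b w)
  then show ?case using val_apps[of SymCons "[BitB, WordB]" WordB "[encb b, enc w]"] by simp
qed (simp add: val_const)

lemma val_ench [simp]: "val histB (ench hs)"
proof (induction hs)
  case (Cons w hs)
  then show ?case using val_apps[of hconsS "[WordB, histB]" histB "[enc w, ench hs]"] by simp
qed (simp add: val_const)

primrec wf_stk :: "stk \<Rightarrow> bool" where
  "wf_stk Bot \<longleftrightarrow> True"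
| "wf_stk (Push a s) \<longleftrightarrow> a \<in> alphabet M \<and> wf_stk s"
| "wf_stk (Inp w s) \<longleftrightarrow> wf_stk s"

lemma val_encs [simp]: "wf_stk s \<Longrightarrow> val stkB (encs s)"
proof (induction s)
  case (Push a s)
  then show ?case using val_apps[of pushS "[symB, stkB]" stkB "[Sym (symS a), encs s]"] by simp
next
  case (Inp w s)
  then show ?case using val_apps[of inpS "[WordB, stkB]" stkB "[enc w, encs s]"] by simp
qed (simp add: val_const)

lemma val_enct [simp]: "wf_stk s \<Longrightarrow> a \<in> alphabet M \<Longrightarrow> wf_stk r \<Longrightarrow> val tapeB (enct s a r)"
  using val_apps[of tapeS "[stkB, symB, stkB]" tapeB "[encs s, Sym (symS a), encs r]"]
  by (simp add: enct_def)

lemma wf_pushes [simp]: "wf_stk (pushes ls) \<longleftrightarrow> set ls \<subseteq> alphabet M"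
  by (induction ls) auto

primrec cpat :: "pt \<Rightarrow> bool" where
  "cpat (PV n b) \<longleftrightarrow> True"
| "cpat (PF i t) \<longleftrightarrow> False"
| "cpat (PS g js ts) \<longleftrightarrow> js = [] \<and> D g = None \<and> list_all cpat ts"

lemma cpat_bitp [simp]: "cpat (bitp b)"
  by (simp add: bitp_def)

lemma cpat_go_lhs: "\<exists>ps. go_lhs q c = PS goS Fvars ps \<and> (list_all cpat ps \<longleftrightarrow> (\<forall>j < K. cpat (c j)))"
  by (auto simp: go_lhs_def gop_def list_all_iff ball_Un xvars_def tapes_of_def lvar_def rvar_def)

lemma rules_cpat:
  assumes "(\<l>, r) \<in> rules"
  shows "\<exists>g js ps. \<l> = PS g js ps \<and> list_all cpat ps"
proof -
  obtain g G where G: "(g, G) \<in> set groups" "(\<l>, r) \<in> G" using assms by (rule rules_cases)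
  have "(\<l>, r) \<in> go_rules \<Longrightarrow> ?thesis"
    using cpat_go_lhs by (fastforce simp: go_rules_def step_rule_def query_rule_def final_rule_def)
  moreover have "(\<l>, r) \<in> F_rules \<Longrightarrow> ?thesis" "(\<l>, r) \<in> run_rules \<Longrightarrow> ?thesis"
    by (auto simp: F_rules_def run_rules_def runp_def list_all_iff xvars_def tapes_of_def)
  moreover have "(g, G) \<in> set fixed_groups \<Longrightarrow> ?thesis"
    using G(2) by (auto simp: fixed_groups_def fixed_rule_defs)
  ultimately show ?thesis using G by (auto simp: groups_def)
qed

definition fun_val :: "trm \<Rightarrow> bool" where
  "fun_val t \<longleftrightarrow> type_of \<Sigma>' t = Some funT \<and> normal \<Sigma>' R' t"

lemma fun_val_Var [simp]: "fun_val (Var n funT)"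
  by (simp add: fun_val_def)

lemma fun_val_Oracle [simp]: "f \<in> set fs \<Longrightarrow> fun_val (Sym (Oracle f))"
  using normal_apps[of "[]" "Oracle f"] by (simp add: fun_val_def sig_Oracle)

lemma substitution_asg:
  assumes "\<And>n. fun_val (\<phi> n)" "\<And>n b. val b (v n b)"
  shows "substitution \<Sigma>' (asg \<phi> v)"
  unfolding substitution_def
proof (intro allI impI)
  fix n \<sigma> assume "ord \<sigma> \<le> 1"
  then show "type_of \<Sigma>' (asg \<phi> v n \<sigma>) = Some \<sigma>"
    using assms by (cases \<sigma>) (auto simp: asg_def val_def fun_val_def)
qed

lemma normal_inst:
  assumes "\<And>n b. val b (v n b)" "cpat t"
  shows "normal \<Sigma>' R' (inst \<phi> v t)"
  using assms(2)
proof (induction t)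
  case (PV n b)
  then show ?case using assms(1)[of b n] by (simp add: val_def)
next
  case (PS g js ts)
  then show ?case by (auto simp: list_all_iff intro!: normal_apps)
qed simp

text \<open>Left-hand sides apply a symbol to function variables and constructor patterns. Instances
  of the latter by values are normal, so the step at the root is innermost.\<close>

lemma rule_step:
  assumes "(\<l>, r) \<in> rules" "\<And>n. fun_val (\<phi> n)" "\<And>n b. val b (v n b)"
  shows "innermost \<Sigma>' R' (inst \<phi> v \<l>) (inst \<phi> v r)"
proof -
  obtain g js ps where \<l>: "\<l> = PS g js ps" "list_all cpat ps" using rules_cpat[OF assms(1)] by blast
  show ?thesis unfolding inst_def
  proof (rule innermost_rootI)
    show "(tr \<l>, tr r) \<in> R'" using assms(1) by (force simp: sys_def)
    show "substitution \<Sigma>' (asg \<phi> v)" by (rule substitution_asg[OF assms(2,3)])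
    show "tr \<l> = apps (Sym g) (map (\<lambda>i. Var i funT) js @ map tr ps)" by (simp add: \<l>)
    fix p assume "p \<in> set (map (\<lambda>i. Var i funT) js @ map tr ps)"
    then consider i where "p = Var i funT" | p' where "p' \<in> set ps" "p = tr p'" by auto
    then show "normal \<Sigma>' R' (p \<cdot> asg \<phi> v)"
    proof cases
      case 1
      then show ?thesis using assms(2)[of i] by (simp add: asg_def fun_val_def)
    next
      case 2
      then show ?thesis using normal_inst[OF assms(3), of p' \<phi>] \<l>(2) by (simp add: list_all_iff inst_def)
    qed
  qed
qed

lemma val_vals:
  assumes "list_all (\<lambda>((n, b), t). val b t) ts"
  shows "val b (vals ts n b)"
proof (cases "map_of ts (n, b)")
  case (Some t)
  then have "((n, b), t) \<in> set ts" by (rule map_of_SomeD)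
  then show ?thesis using assms Some by (auto simp: vals_def list_all_iff)
qed (simp add: vals_def)

text \<open>The first form is for rules without function variables, the second for those of
  \<open>try\<close>, where every function variable is instantiated by the oracle.\<close>

lemma vals_step:
  assumes "(\<l>, r) \<in> rules" "list_all (\<lambda>((n, b), t). val b t) ts"
  shows "innermost \<Sigma>' R' (inst (\<lambda>n. Var n funT) (vals ts) \<l>) (inst (\<lambda>n. Var n funT) (vals ts) r)"
    "f \<in> set fs \<Longrightarrow> innermost \<Sigma>' R' (inst (\<lambda>n. Sym (Oracle f)) (vals ts) \<l>) (inst (\<lambda>n. Sym (Oracle f)) (vals ts) r)"
  using assms by (auto intro!: rule_step val_vals)

lemma in_rules:
  "app_rules \<subseteq> rules" "mul_rules \<subseteq> rules" "mx_rules \<subseteq> rules" "lim_rules \<subseteq> rules" "drp_rules \<subseteq> rules"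
  "try_rules \<subseteq> rules" "pop_rules \<subseteq> rules" "pull_rules \<subseteq> rules" "read_rules (alphabet M) \<subseteq> rules"
  "rew_rules \<subseteq> rules" "F_rules \<subseteq> rules" "run_rules \<subseteq> rules" "go_rules \<subseteq> rules"
  by (auto simp: rules_def groups_def fixed_groups_def)

lemma red_step: "innermost \<Sigma>' R' s t \<Longrightarrow> t \<rightarrow>* u \<Longrightarrow> s \<rightarrow>* u"
  by (rule converse_rtranclp_into_rtranclp)

lemma red_apps: "list_all2 (\<rightarrow>*) ts ts' \<Longrightarrow> apps (Sym g) ts \<rightarrow>* apps (Sym g) ts'"
  by (rule innermost_apps_rtranclp) auto

lemma red_args:
  "s \<rightarrow>* s' \<Longrightarrow> t \<rightarrow>* t' \<Longrightarrow> App (App (Sym g) s) t \<rightarrow>* App (App (Sym g) s') t'"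
  using red_apps[of "[s, t]" "[s', t']" g] by simp

abbreviation "novars \<equiv> (\<lambda>n. Var n funT)"

section \<open>Results of the auxiliary symbols on encoded arguments\<close>

lemma red_app: "apps (Sym appS) [enc m, enc n] \<rightarrow>* enc (m @ n)"
proof (induction m)
  case Nil
  have "(appp nilp vn, vn) \<in> rules" using in_rules(1) by (auto simp: app_rules_def)
  from vals_step(1)[OF this, of "[((2, WordB), enc n)]"] show ?case
    by (auto simp: vals_def)
next
  case (Cons b m)
  have "(appp (consp vy vm) vn, consp vy (appp vm vn)) \<in> rules" using in_rules(1) by (auto simp: app_rules_def)
  from vals_step(1)[OF this, of "[((0, BitB), encb b), ((0, WordB), enc m), ((2, WordB), enc n)]"]
  have "innermost \<Sigma>' R' (apps (Sym appS) [enc (b # m), enc n])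
     (App (App (Sym SymCons) (encb b)) (apps (Sym appS) [enc m, enc n]))"
    by (simp add: vals_def)
  also have "\<dots> \<rightarrow>* enc ((b # m) @ n)"
    using red_args[OF rtranclp.rtrancl_refl Cons.IH] by simp
  finally (red_step) show ?case .
qed

lemma red_mul: "apps (Sym mulS) [enc m, enc n] \<rightarrow>* enc (concat (replicate (length m) n))"
proof (induction m)
  case Nil
  have "(mulp nilp vn, nilp) \<in> rules" using in_rules(2) by (auto simp: mul_rules_def)
  from vals_step(1)[OF this, of "[((2, WordB), enc n)]"] show ?case
    by (auto simp: vals_def)
next
  case (Cons b m)
  have "(mulp (consp vy vm) vn, appp vn (mulp vm vn)) \<in> rules" using in_rules(2) by (auto simp: mul_rules_def)
  from vals_step(1)[OF this, of "[((0, BitB), encb b), ((0, WordB), enc m), ((2, WordB), enc n)]"]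
  have "innermost \<Sigma>' R' (apps (Sym mulS) [enc (b # m), enc n])
     (apps (Sym appS) [enc n, apps (Sym mulS) [enc m, enc n]])"
    by (simp add: vals_def)
  also have "\<dots> \<rightarrow>*
      apps (Sym appS) [enc n, enc (concat (replicate (length m) n))]"
    using red_args[OF rtranclp.rtrancl_refl Cons.IH] by simp
  also have "\<dots> \<rightarrow>* enc (n @ concat (replicate (length m) n))" by (rule red_app)
  finally (rtranclp_trans) show ?case by simp
qed

lemma red_mx: "apps (Sym mxS) [enc m, enc n] \<rightarrow>* enc (mxw m n)"
proof (induction m n rule: mxw.induct)
  case (1 n)
  have "(mxp nilp vn, vn) \<in> rules" using in_rules(3) by (auto simp: mx_rules_def)
  from vals_step(1)[OF this, of "[((2, WordB), enc n)]"] show ?case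
    by (auto simp: vals_def)
next
  case (2 y m)
  have "(mxp (consp vy vm) nilp, consp vy vm) \<in> rules" using in_rules(3) by (auto simp: mx_rules_def)
  from vals_step(1)[OF this, of "[((0, BitB), encb y), ((0, WordB), enc m)]"]
  show ?case by (auto simp: vals_def)
next
  case (3 y m z n)
  have "(mxp (consp vy vm) (consp vz vn), consp (bitp False) (mxp vm vn)) \<in> rules"
    using in_rules(3) by (auto simp: mx_rules_def)
  from vals_step(1)[OF this, of "[((0, BitB), encb y), ((0, WordB), enc m), ((2, BitB), encb z), ((2, WordB), enc n)]"]
  have "innermost \<Sigma>' R' (apps (Sym mxS) [enc (y # m), enc (z # n)])
     (App (App (Sym SymCons) (encb False)) (apps (Sym mxS) [enc m, enc n]))"
    by (simp add: vals_def bitp_def)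
  also have "\<dots> \<rightarrow>* enc (mxw (y # m) (z # n))"
    using red_args[OF rtranclp.rtrancl_refl 3] by simp
  finally (red_step) show ?case .
qed

lemma red_lim: "apps (Sym limS) [enc m, enc n] \<rightarrow>* enc (take (length n) m)"
proof (induction m arbitrary: n)
  case Nil
  have "(limp nilp vn, nilp) \<in> rules" using in_rules(4) by (auto simp: lim_rules_def)
  from vals_step(1)[OF this, of "[((2, WordB), enc n)]"] show ?case
    by (auto simp: vals_def)
next
  case (Cons b m)
  show ?case
  proof (cases n)
    case Nil
    have "(limp (consp vy vm) nilp, nilp) \<in> rules" using in_rules(4) by (auto simp: lim_rules_def)
    from vals_step(1)[OF this, of "[((0, BitB), encb b), ((0, WordB), enc m)]"]
    show ?thesis using Nil by (auto simp: vals_def)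
  next
    case n: (Cons y n')
    have "(limp (consp (bitp b) vm) (consp vy vn), consp (bitp b) (limp vm vn)) \<in> rules"
      using in_rules(4) by (auto simp: lim_rules_def)
    from vals_step(1)[OF this, of "[((0, BitB), encb y), ((0, WordB), enc m), ((2, WordB), enc n')]"]
    have "innermost \<Sigma>' R' (apps (Sym limS) [enc (b # m), enc n])
       (App (App (Sym SymCons) (encb b)) (apps (Sym limS) [enc m, enc n']))"
      by (simp add: vals_def bitp_def n)
    also have "\<dots> \<rightarrow>* enc (take (length n) (b # m))"
      using red_args[OF rtranclp.rtrancl_refl Cons.IH[of n']] n by simp
    finally (red_step) show ?thesis .
  qed
qed

lemma red_drp: "apps (Sym drpS) [ench hs, enc n] \<rightarrow>* enc (drop (length hs) n)"
proof (induction hs arbitrary: n)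
  case Nil
  have "(drpp hnilp vn, vn) \<in> rules" using in_rules(5) by (auto simp: drp_rules_def)
  from vals_step(1)[OF this, of "[((2, WordB), enc n)]"] show ?case
    by (auto simp: vals_def)
next
  case (Cons w hs)
  show ?case
  proof (cases n)
    case Nil
    have "(drpp (hconsp vm vh) nilp, nilp) \<in> rules" using in_rules(5) by (auto simp: drp_rules_def)
    from vals_step(1)[OF this, of "[((0, WordB), enc w), ((0, histB), ench hs)]"]
    show ?thesis using Nil by (auto simp: vals_def)
  next
    case n: (Cons y n')
    have "(drpp (hconsp vm vh) (consp vy vn), drpp vh vn) \<in> rules" using in_rules(5) by (auto simp: drp_rules_def)
    from vals_step(1)[OF this, of "[((0, WordB), enc w), ((0, histB), ench hs), ((0, BitB), encb y), ((2, WordB), enc n')]"]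
    have "innermost \<Sigma>' R' (apps (Sym drpS) [ench (w # hs), enc n]) (apps (Sym drpS) [ench hs, enc n'])"
      by (simp add: vals_def n)
    also have "\<dots> \<rightarrow>* enc (drop (length (w # hs)) n)"
      using Cons.IH[of n'] n by simp
    finally (red_step) show ?thesis .
  qed
qed

lemma enc_subst [simp]: "enc w \<cdot> \<gamma> = enc w"
  by (induction w) auto

lemma red_Oracle:
  assumes "f \<in> set fs"
  shows "App (Sym (Oracle f)) (enc u) \<rightarrow>* enc (f u)"
proof -
  have "innermost \<Sigma>' R' (App (Sym (Oracle f)) (enc u) \<cdot> asg novars (vals [])) (enc (f u) \<cdot> asg novars (vals []))"
  proof (rule innermost_rootI)
    show "(App (Sym (Oracle f)) (enc u), enc (f u)) \<in> R'" using assms by (auto simp: oracle_rules_def)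
    show "substitution \<Sigma>' (asg novars (vals []))" by (rule substitution_asg) (auto intro: val_vals)
    show "App (Sym (Oracle f)) (enc u) = apps (Sym (Oracle f)) [enc u]" by simp
    fix p assume "p \<in> set [enc u]"
    then show "normal \<Sigma>' R' (p \<cdot> asg novars (vals []))" using val_enc[of u] by (simp add: val_def)
  qed
  then show ?thesis by auto
qed

text \<open>Only the length of the result is specified, because \<open>mx\<close> replaces bits by
  \<open>False\<close> and the clock uses words merely as lengths.\<close>

lemma red_try:
  assumes "f \<in> set fs"
  shows "\<exists>w. apps (Sym tryS) [Sym (Oracle f), ench hs, enc n] \<rightarrow>* enc w \<and> length w = max_answer f hs (length n)"
proof (induction hs)
  case Nil
  have "(tryp 0 hnilp vn, nilp) \<in> rules" using in_rules(6) by (auto simp: try_rules_def)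
  from vals_step(2)[OF this _ assms, of "[((2, WordB), enc n)]"] show ?case
    by (intro exI[of _ "[]"]) (auto simp: vals_def)
next
  case (Cons a hs)
  then obtain w where w: "apps (Sym tryS) [Sym (Oracle f), ench hs, enc n] \<rightarrow>* enc w"
    "length w = max_answer f hs (length n)" by blast
  have "(tryp 0 (hconsp vm vh) vn, mxp (PF 0 (limp vm vn)) (tryp 0 vh vn)) \<in> rules"
    using in_rules(6) by (auto simp: try_rules_def)
  from vals_step(2)[OF this _ assms, of "[((0, WordB), enc a), ((0, histB), ench hs), ((2, WordB), enc n)]"]
  have "innermost \<Sigma>' R' (apps (Sym tryS) [Sym (Oracle f), ench (a # hs), enc n])
      (apps (Sym mxS) [App (Sym (Oracle f)) (apps (Sym limS) [enc a, enc n]),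
         apps (Sym tryS) [Sym (Oracle f), ench hs, enc n]])"
    by (simp add: vals_def)
  also have "\<dots> \<rightarrow>*
       apps (Sym mxS) [enc (f (take (length n) a)), enc w]"
  proof (rule red_apps)
    have "App (Sym (Oracle f)) (apps (Sym limS) [enc a, enc n]) \<rightarrow>* App (Sym (Oracle f)) (enc (take (length n) a))"
      using innermost_App_rtranclp[OF rtranclp.rtrancl_refl red_lim] .
    also have "\<dots> \<rightarrow>* enc (f (take (length n) a))" by (rule red_Oracle[OF assms])
    finally show "list_all2 (\<rightarrow>*) [App (Sym (Oracle f)) (apps (Sym limS) [enc a, enc n]),
         apps (Sym tryS) [Sym (Oracle f), ench hs, enc n]] [enc (f (take (length n) a)), enc w]"
      using w by simp
  qed
  also have "\<dots> \<rightarrow>* enc (mxw (f (take (length n) a)) w)"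
    by (rule red_mx)
  finally (rtranclp_trans) show ?case using w by (intro exI[of _ "mxw (f (take (length n) a)) w"]) simp
qed

lemma red_pop:
  assumes "wf_stk s" "wf_stk r"
  shows "apps (Sym popS) [encs s, encs r] \<rightarrow>* enct s (fst (popr r)) (snd (popr r))"
  using assms(2)
proof (cases r rule: popr.cases)
  case 1
  have "(popp vs botp, tapep vs (cellp Blank) botp) \<in> rules" using in_rules(7) by (auto simp: pop_rules_def)
  from vals_step(1)[OF this, of "[((0, stkB), encs s)]"] show ?thesis
    using 1 assms by (auto simp: vals_def enct_def)
next
  case (2 a r')
  have "(popp vs (pushp vc vr), tapep vs vc vr) \<in> rules" using in_rules(7) by (auto simp: pop_rules_def)
  from vals_step(1)[OF this, of "[((0, stkB), encs s), ((0, symB), Sym (symS a)), ((2, stkB), encs r')]"] show ?thesis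
    using 2 assms by (auto simp: vals_def enct_def)
next
  case (3 r')
  have "(popp vs (inpp nilp vr), tapep vs (cellp Blank) vr) \<in> rules" using in_rules(7) by (auto simp: pop_rules_def)
  from vals_step(1)[OF this, of "[((0, stkB), encs s), ((2, stkB), encs r')]"] show ?thesis
    using 3 assms by (auto simp: vals_def enct_def)
next
  case (4 b w r')
  have "(popp vs (inpp (consp (bitp b) vm) vr), tapep vs (cellp (Bit b)) (inpp vm vr)) \<in> rules"
    using in_rules(7) by (auto simp: pop_rules_def)
  from vals_step(1)[OF this, of "[((0, stkB), encs s), ((0, WordB), enc w), ((2, stkB), encs r')]"] show ?thesis
    using 4 assms by (auto simp: vals_def enct_def bitp_def)
qed

lemma red_pull:
  assumes "set ls \<subseteq> alphabet M" "a \<in> alphabet M" "wf_stk r"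
  shows "apps (Sym pullS) [encs (pushes ls), Sym (symS a), encs r] \<rightarrow>*
    (case ls of [] \<Rightarrow> enct Bot a r | d # ls' \<Rightarrow> enct (pushes ls') d (Push a r))"
proof (cases ls)
  case Nil
  have "(pullp botp vc vr, tapep botp vc vr) \<in> rules" using in_rules(8) by (auto simp: pull_rules_def)
  from vals_step(1)[OF this, of "[((0, symB), Sym (symS a)), ((2, stkB), encs r)]"] show ?thesis
    using Nil assms by (auto simp: vals_def enct_def)
next
  case (Cons d ls')
  have "(pullp (pushp vd vs) vc vr, tapep vs vd (pushp vc vr)) \<in> rules" using in_rules(8) by (auto simp: pull_rules_def)
  from vals_step(1)[OF this, of "[((0, symB), Sym (symS a)), ((2, symB), Sym (symS d)),
    ((0, stkB), encs (pushes ls')), ((2, stkB), encs r)]"] show ?thesis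
    using Cons assms by (auto simp: vals_def enct_def)
qed

lemma red_read:
  assumes "wf_stk s"
  shows "apps (Sym readS) [enc n, encs s] \<rightarrow>* enc (take (length n) (bits (sem s)))"
  using assms
proof (induction n arbitrary: s)
  case Nil
  have "(readp nilp vs, nilp) \<in> rules" using in_rules(9) by (auto simp: read_rules_def)
  from vals_step(1)[OF this, of "[((0, stkB), encs s)]"] show ?case
    using Nil by (auto simp: vals_def)
next
  case (Cons y n)
  have bit: "App (App (Sym SymCons) (encb b)) (apps (Sym readS) [enc n, encs s']) \<rightarrow>*
     enc (b # take (length n) (bits (sem s')))" if "wf_stk s'" for b s'
    using red_args[OF rtranclp.rtrancl_refl Cons.IH[OF that]] by simp
  show ?case
  proof (cases s)
    case Bot
    have "(readp (consp vy vn) botp, nilp) \<in> rules" using in_rules(9) by (auto simp: read_rules_def)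
    from vals_step(1)[OF this, of "[((0, BitB), encb y), ((2, WordB), enc n)]"] show ?thesis
      using Bot by (auto simp: vals_def)
  next
    case (Push a s')
    show ?thesis
    proof (cases "is_bit a")
      case True
      then obtain b where a: "a = Bit b" by (auto simp: is_bit_def)
      have "(readp (consp vy vn) (pushp (cellp (Bit b)) vs), consp (bitp b) (readp vn vs)) \<in> rules"
        using in_rules(9) by (auto simp: read_rules_def)
      from vals_step(1)[OF this, of "[((0, BitB), encb y), ((2, WordB), enc n), ((0, stkB), encs s')]"]
      have "innermost \<Sigma>' R' (apps (Sym readS) [enc (y # n), encs s])
         (App (App (Sym SymCons) (encb b)) (apps (Sym readS) [enc n, encs s']))"
        using Push a Cons.prems by (simp add: vals_def bitp_def)
      also note bit[of s' b]
      finally (red_step) show ?thesis using Push a Cons.prems by simp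
    next
      case False
      then have "a \<in> alphabet M - range Bit" using Cons.prems Push by (auto simp: is_bit_def)
      then have "(readp (consp vy vn) (pushp (cellp a) vs), nilp) \<in> rules"
        using in_rules(9) by (auto simp: read_rules_def)
      from vals_step(1)[OF this, of "[((0, BitB), encb y), ((2, WordB), enc n), ((0, stkB), encs s')]"]
      show ?thesis using Push False Cons.prems by (auto simp: vals_def bits_def)
    qed
  next
    case (Inp w s')
    show ?thesis
    proof (cases w)
      case Nil
      have "(readp (consp vy vn) (inpp nilp vs), nilp) \<in> rules" using in_rules(9) by (auto simp: read_rules_def)
      from vals_step(1)[OF this, of "[((0, BitB), encb y), ((2, WordB), enc n), ((0, stkB), encs s')]"]
      show ?thesis using Inp Nil Cons.prems by (auto simp: vals_def)
    next
      case w: (Cons b w')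
      have "(readp (consp vy vn) (inpp (consp (bitp b) vm) vs), consp (bitp b) (readp vn (inpp vm vs))) \<in> rules"
        using in_rules(9) by (auto simp: read_rules_def)
      from vals_step(1)[OF this, of "[((0, BitB), encb y), ((2, WordB), enc n), ((0, WordB), enc w'), ((0, stkB), encs s')]"]
      have "innermost \<Sigma>' R' (apps (Sym readS) [enc (y # n), encs s])
         (App (App (Sym SymCons) (encb b)) (apps (Sym readS) [enc n, encs (Inp w' s')]))"
        using Inp w Cons.prems by (simp add: vals_def bitp_def)
      also note bit[of "Inp w' s'" b]
      finally (red_step) show ?thesis using Inp w Cons.prems by simp
    qed
  qed
qed

text \<open>The inequality for the fuel is strict because the rule that meets the bottom of the
  stack consumes a unit, too.\<close>

lemma red_rew:
  assumes "set ls \<subseteq> alphabet M" "wf_stk r" "length ls < length n"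
  shows "apps (Sym rewS) [enc m, enc n, encs (pushes ls), encs r] \<rightarrow>*
    enc (take (length m) (bits (rev ls @ sem r)))"
  using assms
proof (induction ls arbitrary: n r)
  case Nil
  then obtain y n' where n: "n = y # n'" by (cases n) auto
  have "(rewp vm (consp vy vn) botp vr, readp vm vr) \<in> rules" using in_rules(10) by (auto simp: rew_rules_def)
  from vals_step(1)[OF this, of "[((0, WordB), enc m), ((0, BitB), encb y), ((2, WordB), enc n'), ((2, stkB), encs r)]"]
  have "innermost \<Sigma>' R' (apps (Sym rewS) [enc m, enc n, encs (pushes []), encs r]) (apps (Sym readS) [enc m, encs r])"
    using Nil n by (simp add: vals_def)
  also have "\<dots> \<rightarrow>* enc (take (length m) (bits (sem r)))"
    by (rule red_read) (use Nil in simp)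
  finally (red_step) show ?case by simp
next
  case (Cons a ls)
  then obtain y n' where n: "n = y # n'" by (cases n) auto
  have "(rewp vm (consp vy vn) (pushp vc vs) vr, rewp vm vn vs (pushp vc vr)) \<in> rules"
    using in_rules(10) by (auto simp: rew_rules_def)
  from vals_step(1)[OF this, of "[((0, WordB), enc m), ((0, BitB), encb y), ((2, WordB), enc n'),
     ((0, symB), Sym (symS a)), ((0, stkB), encs (pushes ls)), ((2, stkB), encs r)]"]
  have "innermost \<Sigma>' R' (apps (Sym rewS) [enc m, enc n, encs (pushes (a # ls)), encs r])
      (apps (Sym rewS) [enc m, enc n', encs (pushes ls), encs (Push a r)])"
    using Cons.prems n by (simp add: vals_def)
  also have "\<dots> \<rightarrow>*
      enc (take (length m) (bits (rev ls @ sem (Push a r))))"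
    by (rule Cons.IH) (use Cons.prems n in auto)
  finally (red_step) show ?case by simp
qed

lemma length_concat_replicate: "length (concat (replicate m n)) = m * length n"
  by (induction m) auto

abbreviation recorded_value :: "word list \<Rightarrow> word list \<Rightarrow> sopoly \<Rightarrow> nat" where
  "recorded_value hs ws \<equiv> sopoly_eval (map (\<lambda>f. max_answer f hs) fs) (map length ws)"

lemma red_theta:
  assumes "sopoly_over k (length ws) Q"
    and "\<And>i. i < k \<Longrightarrow> \<phi> i = Sym (Oracle (fs ! i))" "\<And>j. j < length ws \<Longrightarrow> v j WordB = enc (ws ! j)"
    "v 0 histB = ench hs"
  shows "\<exists>w. inst \<phi> v (theta Q) \<rightarrow>* enc w \<and>
    length w = recorded_value hs ws Q"
  using assms(1)
proof (induction Q)
  case (PConst n)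
  have "inst \<phi> v (lit n) = enc (replicate n False)"
    by (induction n) (auto simp: bitp_def)
  then show ?case by (intro exI[of _ "replicate n False"]) simp
next
  case (PVar j)
  then show ?case using assms(3) by (intro exI[of _ "ws ! j"]) simp
next
  case (PAdd P Q)
  then obtain u w where u: "inst \<phi> v (theta P) \<rightarrow>* enc u" "length u = recorded_value hs ws P"
    and w: "inst \<phi> v (theta Q) \<rightarrow>* enc w" "length w = recorded_value hs ws Q" by auto
  have "inst \<phi> v (theta (PAdd P Q)) \<rightarrow>* apps (Sym appS) [enc u, enc w]" using red_args[OF u(1) w(1)] by simp
  also note red_app
  finally show ?case using u w by (intro exI[of _ "u @ w"]) simp
next
  case (PMul P Q)
  then obtain u w where u: "inst \<phi> v (theta P) \<rightarrow>* enc u" "length u = recorded_value hs ws P"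
    and w: "inst \<phi> v (theta Q) \<rightarrow>* enc w" "length w = recorded_value hs ws Q" by auto
  have "inst \<phi> v (theta (PMul P Q)) \<rightarrow>* apps (Sym mulS) [enc u, enc w]" using red_args[OF u(1) w(1)] by simp
  also note red_mul
  finally show ?case using u w
    by (intro exI[of _ "concat (replicate (length u) w)"]) (simp add: length_concat_replicate)
next
  case (PApp i Q)
  then obtain u where u: "inst \<phi> v (theta Q) \<rightarrow>* enc u" "length u = recorded_value hs ws Q"
    by auto
  have i: "i < k" "fs ! i \<in> set fs" using PApp.prems length_fs by auto
  obtain w where w: "apps (Sym tryS) [Sym (Oracle (fs ! i)), ench hs, enc u] \<rightarrow>* enc w"
    "length w = max_answer (fs ! i) hs (length u)" using red_try[OF i(2)] by blast
  have "inst \<phi> v (theta (PApp i Q)) \<rightarrow>* apps (Sym tryS) [Sym (Oracle (fs ! i)), ench hs, enc u]"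
    using red_apps[of "[\<phi> i, v 0 histB, inst \<phi> v (theta Q)]" "[Sym (Oracle (fs ! i)), ench hs, enc u]" tryS]
      u(1) assms(2)[OF i(1)] assms(4) by simp
  also note w(1)
  finally show ?case using u w i length_fs by (intro exI[of _ w]) simp
qed

end

subsection \<open>Time bounds from the recorded queries\<close>

lemma finite_words_le: "finite {y :: word. length y \<le> n}"
  using finite_lists_length_le[of "UNIV :: bool set" n] by simp

lemma fun_length_mono: "mono (fun_length f)"
proof (rule monoI)
  fix m n :: nat assume "m \<le> n"
  then have "(\<lambda>y. length (f y)) ` {y. length y \<le> m} \<subseteq> (\<lambda>y. length (f y)) ` {y. length y \<le> n}"
    by auto
  moreover have "[] \<in> {y :: word. length y \<le> m}" by simp
  then have "(\<lambda>y. length (f y)) ` {y. length y \<le> m} \<noteq> {}" by blast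
  ultimately show "fun_length f m \<le> fun_length f n"
    unfolding fun_length_def by (intro Max_mono finite_imageI finite_words_le)
qed

lemma max_answer_ge: "a \<in> set hs \<Longrightarrow> length (f (take n a)) \<le> max_answer f hs n"
  by (induction hs) auto

definition restrict_to :: "word list \<Rightarrow> (word \<Rightarrow> word) \<Rightarrow> word \<Rightarrow> word" where
  "restrict_to hs f u = (if u \<in> set hs then f u else [])"

text \<open>A recorded word \<open>y\<close> of length at most \<open>n\<close> equals
  \<open>take n y\<close>, so its answer is among those maximized; all other words are answered by
  the empty word.\<close>

lemma fun_length_restrict: "fun_length (restrict_to hs f) n \<le> max_answer f hs n"
proof -
  have "length (restrict_to hs f y) \<le> max_answer f hs n" if "length y \<le> n" for y
    using max_answer_ge[of y hs f n] that by (simp add: restrict_to_def)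
  moreover have "[] \<in> {y :: word. length y \<le> n}" by simp
  then have "{y :: word. length y \<le> n} \<noteq> {}" by blast
  ultimately show ?thesis
    unfolding fun_length_def using finite_words_le by (subst Max_le_iff) auto
qed

text \<open>Monotonicity is demanded of the smaller functions only. The larger ones will be
  \<open>max_answer f hs\<close>, which can fail to be monotone, since a longer prefix may have a
  shorter answer.\<close>

lemma sopoly_eval_le:
  assumes "\<And>i. i < length Gs \<Longrightarrow> mono (Gs ! i)" "\<And>i n. i < length Gs \<Longrightarrow> (Gs ! i) n \<le> (Hs ! i) n"
    "sopoly_over (length Gs) l Q"
  shows "sopoly_eval Gs xs Q \<le> sopoly_eval Hs xs Q"
  using assms(3)
proof (induction Q)
  case (PApp i Q)
  then have "sopoly_eval Gs xs Q \<le> sopoly_eval Hs xs Q" by simp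
  then have "(Gs ! i) (sopoly_eval Gs xs Q) \<le> (Gs ! i) (sopoly_eval Hs xs Q)"
    using assms(1) PApp.prems by (simp add: monoD)
  also have "\<dots> \<le> (Hs ! i) (sopoly_eval Hs xs Q)" using assms(2) PApp.prems by simp
  finally show ?case by simp
qed (auto intro: add_mono mult_le_mono)

subsection \<open>Tapes as zippers\<close>

type_synonym zipper = "tsym list \<times> tsym \<times> stk"

text \<open>The left list is exactly the part before the head, nearest cell first. The right stack
  is finite and \<open>cell\<close> supplies blanks beyond its end, so several stacks may represent
  the same tape.\<close>

definition rep :: "tape \<Rightarrow> zipper \<Rightarrow> bool" where
  "rep = (\<lambda>(c, h) (ls, a, r). ls = map c (rev [0..<h]) \<and> a = c h \<and> (\<forall>j. cell (sem r) j = c (Suc (h + j))))"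

fun zact :: "zipper \<Rightarrow> tsym \<times> move \<Rightarrow> zipper" where
  "zact (ls, _, r) (a, MLeft) = (case ls of [] \<Rightarrow> ([], a, r) | d # ls' \<Rightarrow> (ls', d, Push a r))"
| "zact (ls, _, r) (a, MRight) = (a # ls, fst (popr r), snd (popr r))"
| "zact (ls, _, r) (a, MStay) = (ls, a, r)"

lemma rep_act:
  assumes "rep t z" shows "rep (act t a) (zact z a)"
proof -
  obtain c h where t: "t = (c, h)" by fastforce
  obtain ls d r where z: "z = (ls, d, r)" by (cases z) auto
  obtain b m where a: "a = (b, m)" by fastforce
  have 1: "ls = map c (rev [0..<h])" "d = c h" "\<And>j. cell (sem r) j = c (Suc (h + j))"
    using assms by (auto simp: rep_def t z)
  have upd: "map (c(h := b)) (rev [0..<h]) = map c (rev [0..<h])" by auto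
  show ?thesis
  proof (cases m)
    case MLeft
    show ?thesis
    proof (cases h)
      case 0
      then show ?thesis using 1 by (simp add: rep_def t z a MLeft)
    next
      case (Suc h')
      have "cell (b # sem r) j = (c(h := b)) (Suc (h' + j))" for j
        using 1(3) Suc by (cases j) auto
      moreover have "ls = c h' # map (c(h := b)) (rev [0..<h'])" using 1 Suc by auto
      ultimately show ?thesis using Suc by (simp add: rep_def t z a MLeft)
    qed
  next
    case MRight
    have "fst (popr r) = c (Suc h)" "\<And>j. cell (sem (snd (popr r))) j = c (Suc (Suc (h + j)))"
      using popr_cell[of r] 1(3) by auto
    then show ?thesis using 1 upd by (simp add: rep_def t z a MRight)
  next
    case MStay
    then show ?thesis using 1 upd by (simp add: rep_def t z a)
  qed
qed

definition ztop :: "stk \<Rightarrow> zipper" where "ztop s = ([], fst (popr s), snd (popr s))"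

lemma rep_written:
  assumes "\<And>j. cell (sem s) j = cell cs j"
  shows "rep (written cs) (ztop s)"
proof -
  have "written cs = (cell cs, 0)" by (auto simp: written_def cell_def)
  then show ?thesis using popr_cell[of s] assms by (simp add: rep_def ztop_def)
qed

text \<open>Past the end of \<open>cs\<close> every cell is blank, so a first non-bit cell exists,
  and its position is the length of the longest prefix of bits.\<close>

lemma bits_cell:
  assumes "\<And>j. cell cs j = c j"
  shows "tape_word (c, h) = bits cs"
proof -
  let ?m = "length (takeWhile is_bit cs)"
  have least: "(LEAST n. \<forall>b. c n \<noteq> Bit b) = ?m"
  proof (rule Least_equality)
    show "\<forall>b. c ?m \<noteq> Bit b"
    proof (cases "?m < length cs")
      case True
      then have "\<not> is_bit (cs ! ?m)" by (rule nth_length_takeWhile)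
      then show ?thesis using assms[of ?m, symmetric] True by (auto simp: cell_def is_bit_def)
    next
      case False
      then show ?thesis using assms[of ?m, symmetric] by (simp add: cell_def)
    qed
    fix n assume n: "\<forall>b. c n \<noteq> Bit b"
    show "?m \<le> n"
    proof (rule ccontr)
      assume "\<not> ?m \<le> n"
      then have "n < ?m" by simp
      then have "is_bit (cs ! n)" "n < length cs"
        using nth_mem[of n "takeWhile is_bit cs"] takeWhile_nth[of n is_bit cs] length_takeWhile_le[of is_bit cs]
        by (auto dest: set_takeWhileD)
      then show False using n assms[of n, symmetric] by (auto simp: cell_def is_bit_def)
    qed
  qed
  have "c n = takeWhile is_bit cs ! n" if "n < ?m" for n
    using assms[of n, symmetric] takeWhile_nth[of n is_bit cs] length_takeWhile_le[of is_bit cs] that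
    by (simp add: cell_def)
  then show ?thesis
    unfolding tape_word_def fst_conv least bits_def by (intro nth_equalityI) auto
qed

lemma rep_word:
  assumes "rep t (ls, a, r)"
  shows "tape_word t = bits (rev ls @ a # sem r)" "length ls = snd t"
proof -
  obtain c h where t: "t = (c, h)" by fastforce
  have 1: "ls = map c (rev [0..<h])" "a = c h" "\<And>j. cell (sem r) j = c (Suc (h + j))"
    using assms by (auto simp: rep_def t)
  have "cell (rev ls @ a # sem r) j = c j" for j
  proof (cases "j < h")
    case True
    then show ?thesis by (simp add: cell_def 1(1) nth_append rev_map)
  next
    case False
    then obtain i where j: "j = h + i" using le_Suc_ex not_less by blast
    show ?thesis
    proof (cases i)
      case 0
      then show ?thesis using j 1 by (simp add: cell_def nth_append)
    next
      case (Suc i')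
      have "cell (rev ls @ a # sem r) j = cell (sem r) i'"
        using j Suc 1(1) by (auto simp: cell_def nth_append)
      then show ?thesis using 1(3)[of i'] j Suc by simp
    qed
  qed
  then show "tape_word t = bits (rev ls @ a # sem r)" using bits_cell t by blast
  show "length ls = snd t" by (simp add: 1 t)
qed

lemma tape_word_le:
  assumes "fst t n = Blank"
  shows "length (tape_word t) \<le> n"
  using Least_le[of "\<lambda>n. \<forall>b. fst t n \<noteq> Bit b" n] assms by (simp add: tape_word_def)

definition encz :: "zipper \<Rightarrow> trm" where
  "encz = (\<lambda>(ls, a, r). enct (pushes ls) a r)"

subsection \<open>Runs of the machine\<close>

locale computation = machine_run +
  fixes ws :: "word list" and \<Psi> :: functional2
  assumes length_ws: "length ws = l"
    and computes: "otm_computes k l M \<Psi>"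
    and time: "\<And>fs xs. length fs = k \<Longrightarrow> length xs = l \<Longrightarrow>
        otm_time M fs xs \<le> sopoly_eval (map fun_length fs) (map length xs) P"
begin

definition conf :: "nat \<Rightarrow> config" where "conf t = otm_run M fs ws t"

abbreviation "state t \<equiv> fst (conf t)"
abbreviation "tps t \<equiv> snd (conf t)"

definition T :: nat where "T = otm_time M fs ws"

lemma conf_Suc: "conf (Suc t) = otm_step M fs (conf t)"
  by (simp add: conf_def otm_run_def)

text \<open>\<open>computes\<close> yields the output at some halting time, while \<open>T\<close>
  is the least one. A halted configuration is a fixed point of \<open>otm_step\<close>, so the
  output is already there at time \<open>T\<close>.\<close>

lemma halts: "halted_at M fs ws T" "tape_word (tps T ! 0) = \<Psi> fs ws"
proof -
  obtain t where t: "halted_at M fs ws t" "tape_word (snd (otm_run M fs ws t) ! 0) = \<Psi> fs ws"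
    using computes length_fs length_ws unfolding otm_computes_def by blast
  show h: "halted_at M fs ws T" unfolding T_def otm_time_def using t(1) by (rule LeastI)
  have "T \<le> t" unfolding T_def otm_time_def using t(1) by (rule Least_le)
  moreover have "otm_run M fs ws (T + d) = otm_run M fs ws T" for d
    using h by (induction d) (auto simp: otm_run_def halted_at_def otm_step_def split_def)
  ultimately have "otm_run M fs ws t = otm_run M fs ws T" by (metis le_add_diff_inverse)
  then show "tape_word (tps T ! 0) = \<Psi> fs ws" using t(2) by (simp add: conf_def)
qed

lemma not_final: "t < T \<Longrightarrow> state t \<notin> final M"
  unfolding T_def otm_time_def conf_def using not_less_Least by (fastforce simp: halted_at_def)

lemma find_query:
  "i < k \<Longrightarrow> find (\<lambda>i'. query M i' = query M i) [0..<k] = Some i"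
proof -
  assume i: "i < k"
  have "inj_on (query M) {..<k}" using M by (simp add: otm_def)
  then have "query M j \<noteq> query M i" if "j < i" for j
    using i that by (auto simp: inj_on_def)
  then show ?thesis using i by (auto simp: find_Some_iff)
qed

lemma find_no_query: "q \<notin> queries \<Longrightarrow> find (\<lambda>i. query M i = q) [0..<k] = None"
  by (auto simp: find_None_iff queries_def)

lemma step_query:
  assumes "i < k" "length gs = k"
  shows "otm_step M gs (query M i, ts) = (answer M i,
     ts[2 * i + 1 := written [], 2 * i + 2 := written (map Bit ((gs ! i) (tape_word (ts ! (2 * i + 1)))))])"
  using assms machine_simps(9)[OF assms(1)] find_query[OF assms(1)]
  by (simp add: otm_step_def)

lemma step_no_query:
  assumes "q \<notin> queries" "q \<notin> final M" "length gs = k"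
  shows "otm_step M gs (q, ts) = (let (q', acts) = delta M q (map (\<lambda>(c, h). c h) ts) in (q', map2 act ts acts))"
  using assms find_no_query[OF assms(1)] by (simp add: otm_step_def Let_def)

section \<open>Restricted oracles and the value of the clock\<close>

definition recorded :: "nat \<Rightarrow> word list \<Rightarrow> bool" where
  "recorded t hs \<longleftrightarrow> (\<forall>s < t. \<forall>i < k. state s = query M i \<longrightarrow> tape_word (tps s ! (2 * i + 1)) \<in> set hs)"

text \<open>Oracles are consulted only in query states, and there the word on the query tape has
  been recorded, so both families of oracles answer alike.\<close>

lemma run_restricted:
  assumes "recorded t hs" "s \<le> t"
  shows "otm_run M (map (restrict_to hs) fs) ws s = conf s"
  using assms(2)
proof (induction s)
  case 0
  then show ?case by (simp add: conf_def otm_run_def)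
next
  case (Suc s)
  let ?gs = "map (restrict_to hs) fs"
  obtain q ts where qt: "conf s = (q, ts)" by fastforce
  have gs: "length ?gs = k" using length_fs by simp
  have "otm_step M ?gs (q, ts) = otm_step M fs (q, ts)"
  proof (cases "q \<in> final M")
    case True
    then show ?thesis by (simp add: otm_step_def)
  next
    case False
    show ?thesis
    proof (cases "q \<in> queries")
      case True
      then obtain i where i: "i < k" "q = query M i" by (auto simp: queries_def)
      then have "tape_word (ts ! (2 * i + 1)) \<in> set hs"
        using assms(1)[unfolded recorded_def, rule_format, of s i] Suc.prems qt by simp
      then show ?thesis using i step_query[OF i(1) gs] step_query[OF i(1) length_fs] length_fs
        by (simp add: restrict_to_def)
    next
      case nq: False
      show ?thesis using step_no_query[OF nq False gs] step_no_query[OF nq False length_fs] by simp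
    qed
  qed
  then show ?case using Suc qt by (simp add: conf_Suc) (simp add: otm_run_def conf_def)
qed

text \<open>
  Up to time \<open>t\<close> the machine cannot distinguish the oracles from the oracles restricted to the
  recorded queries, so the time bound for the latter applies.
\<close>

lemma time_le:
  assumes "recorded t hs" "t \<le> T"
  shows "t \<le> recorded_value hs ws P"
proof -
  let ?gs = "map (restrict_to hs) fs"
  have gs: "length ?gs = k" using length_fs by simp
  have "\<not> halted_at M ?gs ws s" if "s < t" for s
    using run_restricted[OF assms(1), of s] not_final[of s] that assms(2) by (simp add: halted_at_def)
  moreover obtain t' where "halted_at M ?gs ws t'"
    using computes gs length_ws unfolding otm_computes_def by blast
  then have "halted_at M ?gs ws (otm_time M ?gs ws)" unfolding otm_time_def by (rule LeastI)
  ultimately have "t \<le> otm_time M ?gs ws" using not_less by blast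
  also have "\<dots> \<le> sopoly_eval (map fun_length ?gs) (map length ws) P" by (rule time[OF gs length_ws])
  also have "\<dots> \<le> recorded_value hs ws P"
    by (rule sopoly_eval_le[where l = l]) (use P length_fs fun_length_mono fun_length_restrict in auto)
  finally show ?thesis .
qed

definition input_length :: nat where
  "input_length = (\<Sum>w \<leftarrow> ws. length w + 1)"

text \<open>The word lengths together with \<open>l\<close> give the length of the input, in which
  each word is followed by a blank. Of the final \<open>2\<close>, one unit is removed by the rule
  for \<open>go\<close>, the other provides the strict inequality needed for rewinding.\<close>

lemma clock_value:
  "sopoly_eval Fs (map length ws) clock = 2 * sopoly_eval Fs (map length ws) P + input_length + 2"
proof -
  have "(\<Sum>i<l. map length ws ! i) = (\<Sum>w \<leftarrow> ws. length w)"
    using length_ws by (simp add: sum_list_sum_nth atLeast0LessThan)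
  moreover have "(\<Sum>w \<leftarrow> us. length w + 1) = (\<Sum>w \<leftarrow> us. length w) + length us" for us :: "word list"
    by (induction us) auto
  then have "input_length = (\<Sum>w \<leftarrow> ws. length w) + l"
    using length_ws by (simp add: input_length_def)
  ultimately show ?thesis by (simp add: clock_def sum_vars_eval)
qed

text \<open>Each step moves a head by at most one cell and writes one cell per tape, apart from a
  query, which erases the query tape and fills the answer tape. The bound on the nonblank part is
  therefore claimed for the main tape and the odd tapes, which include the query tapes; an answer
  tape may hold a word longer than any such bound.\<close>

lemma conf_inv:
  assumes "t \<le> T"
  shows "state t \<in> states M \<and> length (tps t) = K \<and>
    (\<forall>i < K. snd (tps t ! i) \<le> t \<and> (\<forall>j. fst (tps t ! i) j \<in> alphabet M) \<and>
      (i = 0 \<or> odd i \<longrightarrow> (\<forall>j \<ge> input_length + t. fst (tps t ! i) j = Blank)))"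
  using assms
proof (induction t)
  case 0
  let ?c = "concat (map (\<lambda>x. map Bit x @ [Blank]) ws)"
  have K: "0 < K" using machine_simps(5) by simp
  have len: "length ?c = input_length"
    by (simp add: input_length_def length_concat comp_def)
  have "set ?c \<subseteq> alphabet M" using machine_simps(3,4) by auto
  then have al: "?c ! j \<in> alphabet M" if "j < length ?c" for j using that nth_mem by blast
  have c: "conf 0 = (start M, written ?c # replicate (K - 1) (written []))"
    by (simp add: conf_def otm_run_def otm_init_def)
  have "snd (tps 0 ! i) \<le> 0 \<and> (\<forall>j. fst (tps 0 ! i) j \<in> alphabet M) \<and>
      (\<forall>j \<ge> input_length + 0. fst (tps 0 ! i) j = Blank)" if "i < K" for i
  proof (cases i)
    case 0
    then show ?thesis using len al machine_simps(3) by (simp add: c written_def)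
  next
    case (Suc i')
    then show ?thesis using that machine_simps(3) by (simp add: c written_def)
  qed
  moreover have "state 0 \<in> states M \<and> length (tps 0) = K" using K machine_simps(6) by (simp add: c)
  ultimately show ?case by blast
next
  case (Suc t)
  obtain q ts where qt: "conf t = (q, ts)" by fastforce
  have IH: "q \<in> states M" "length ts = K" "\<And>i. i < K \<Longrightarrow> snd (ts ! i) \<le> t"
    "\<And>i j. i < K \<Longrightarrow> fst (ts ! i) j \<in> alphabet M"
    "\<And>i j. i < K \<Longrightarrow> i = 0 \<or> odd i \<Longrightarrow> j \<ge> input_length + t \<Longrightarrow> fst (ts ! i) j = Blank"
    using Suc qt by auto
  have nf: "q \<notin> final M" using not_final[of t] Suc.prems qt by simp
  show ?case
  proof (cases "q \<in> queries")
    case True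
    then obtain i where i: "i < k" "q = query M i" by (auto simp: queries_def)
    have c: "conf (Suc t) = (answer M i, ts[2 * i + 1 := written [],
      2 * i + 2 := written (map Bit ((fs ! i) (tape_word (ts ! (2 * i + 1)))))])"
      using step_query[OF i(1) length_fs] by (simp add: conf_Suc qt i(2))
    have iK: "2 * i + 1 < K" "2 * i + 2 < K" using i machine_simps(5) by auto
    have "snd (tps (Suc t) ! i') \<le> Suc t \<and> (\<forall>j. fst (tps (Suc t) ! i') j \<in> alphabet M) \<and>
      (i' = 0 \<or> odd i' \<longrightarrow> (\<forall>j \<ge> input_length + Suc t. fst (tps (Suc t) ! i') j = Blank))" if "i' < K" for i'
    proof (cases "i' = 2 * i + 2")
      case True
      then show ?thesis using iK IH(2) machine_simps(3,4) by (auto simp: c written_def)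
    next
      case n2: False
      show ?thesis
      proof (cases "i' = 2 * i + 1")
        case True
        then show ?thesis using iK IH(2) machine_simps(3) by (auto simp: c written_def)
      next
        case False
        then have "tps (Suc t) ! i' = ts ! i'" using n2 by (simp add: c)
        then show ?thesis using IH(3-5)[OF that] by (auto simp: le_SucI)
      qed
    qed
    then show ?thesis using machine_simps(10)[OF i(1)] IH(2) by (simp add: c)
  next
    case False
    let ?cs = "map (\<lambda>(c, h). c h) ts"
    obtain q' acts where d: "delta M q ?cs = (q', acts)" by fastforce
    have "?cs ! i \<in> alphabet M" if "i < K" for i
      using IH(2) IH(4)[OF that, of "snd (ts ! i)"] that by (simp add: split_def)
    then have cs: "length ?cs = K" "set ?cs \<subseteq> alphabet M"
      using IH(2) by (simp_all only: length_map) (metis in_set_conv_nth length_map subsetI)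
    have wf: "q' \<in> states M" "length acts = K" "fst ` set acts \<subseteq> alphabet M"
      using delta_wf[of q ?cs] IH(1) nf False cs d by auto
    have c: "conf (Suc t) = (q', map2 act ts acts)"
      using step_no_query[OF False nf length_fs] d by (simp add: conf_Suc qt)
    have "snd (tps (Suc t) ! i) \<le> Suc t \<and> (\<forall>j. fst (tps (Suc t) ! i) j \<in> alphabet M) \<and>
      (i = 0 \<or> odd i \<longrightarrow> (\<forall>j \<ge> input_length + Suc t. fst (tps (Suc t) ! i) j = Blank))" if "i < K" for i
    proof -
      obtain c' h where ch: "ts ! i = (c', h)" by fastforce
      obtain a m where am: "acts ! i = (a, m)" by fastforce
      have "tps (Suc t) ! i = act (c', h) (a, m)" using that IH(2) wf(2) ch am by (simp add: c)
      moreover have "a \<in> alphabet M" using wf(2,3) am that nth_mem[of i acts] by force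
      moreover have "h \<le> t" "\<And>j. c' j \<in> alphabet M" using IH(3,4)[OF that] ch by auto
      moreover have "\<And>j. i = 0 \<or> odd i \<Longrightarrow> j \<ge> input_length + t \<Longrightarrow> c' j = Blank"
        using IH(5)[OF that] ch by simp
      ultimately show ?thesis by (cases m) auto
    qed
    then show ?thesis using wf IH(2) by (simp add: c)
  qed
qed

section \<open>Simulation of a run by rewriting\<close>

definition Fargs :: "trm list" where "Fargs = map (\<lambda>f. Sym (Oracle f)) fs @ map enc ws"

definition run_term :: "word list \<Rightarrow> nat \<Rightarrow> zipper list \<Rightarrow> trm" where
  "run_term hs q zs = apps (Sym runS) (Fargs @ [ench hs, Sym (stateS q)] @ map encz zs)"

definition go_term :: "word \<Rightarrow> word list \<Rightarrow> nat \<Rightarrow> zipper list \<Rightarrow> trm" where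
  "go_term n hs q zs = apps (Sym goS) (Fargs @ [enc n, ench hs, Sym (stateS q)] @ map encz zs)"

definition phi :: "nat \<Rightarrow> trm" where
  "phi i = (if i < k then Sym (Oracle (fs ! i)) else Var i funT)"

text \<open>One assignment serves the rules for \<open>F\<close>, \<open>run\<close> and
  \<open>go\<close>. Word variables below \<open>l\<close> are the arguments and \<open>l\<close> is
  the fuel; the stack variables \<open>2 * j\<close> and \<open>2 * j + 1\<close> are the two sides
  of tape \<open>j\<close>.\<close>

definition env :: "word \<Rightarrow> bool \<Rightarrow> word list \<Rightarrow> nat \<Rightarrow> zipper list \<Rightarrow> nat \<Rightarrow> base \<Rightarrow> trm" where
  "env n y hs q zs j b =
    (if b = WordB \<and> j < l then enc (ws ! j)
     else if b = WordB \<and> j = l then enc n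
     else if b = BitB \<and> j = 0 then encb y
     else if b = histB \<and> j = 0 then ench hs
     else if b = stateB \<and> j = 0 then Sym (stateS q)
     else if b = stkB \<and> j div 2 < K then
       encs (if even j then pushes (fst (zs ! (j div 2))) else snd (snd (zs ! (j div 2))))
     else if b = symB \<and> j < K then Sym (symS (fst (snd (zs ! j))))
     else if b = tapeB \<and> j < K then encz (zs ! j)
     else Var j (Base b))"

abbreviation "ins n y hs q zs \<equiv> inst phi (env n y hs q zs)"

definition wfz :: "zipper \<Rightarrow> bool" where
  "wfz = (\<lambda>(ls, a, r). set ls \<subseteq> alphabet M \<and> a \<in> alphabet M \<and> wf_stk r)"

lemma wf_stk_iff: "wf_stk s \<longleftrightarrow> set (sem s) \<subseteq> alphabet M"
  using machine_simps(3,4) by (induction s) auto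

lemma rep_wfz:
  assumes "rep t z" "\<And>j. fst t j \<in> alphabet M"
  shows "wfz z"
proof -
  obtain c h where t: "t = (c, h)" by fastforce
  obtain ls a r where z: "z = (ls, a, r)" by (cases z) auto
  have 1: "ls = map c (rev [0..<h])" "a = c h" "\<And>j. cell (sem r) j = c (Suc (h + j))"
    using assms(1) by (auto simp: rep_def t z)
  have "sem r ! j \<in> alphabet M" if "j < length (sem r)" for j
    using 1(3)[of j] assms(2)[of "Suc (h + j)"] that by (simp add: cell_def t)
  then have "wf_stk r" by (auto simp: wf_stk_iff in_set_conv_nth)
  then show ?thesis using 1 assms(2) by (auto simp: wfz_def z t)
qed

lemma fun_val_phi: "fun_val (phi i)"
  using length_fs by (simp add: phi_def)

lemma val_env:
  assumes "length zs = K" "\<And>j. j < K \<Longrightarrow> wfz (zs ! j)" "q \<in> states M"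
  shows "val b (env n y hs q zs j b)"
proof -
  have "val tapeB (encz z)" if "wfz z" for z
    using that by (cases z) (simp add: wfz_def encz_def)
  moreover have "wf_stk (pushes (fst z))" "wf_stk (snd (snd z))" "fst (snd z) \<in> alphabet M" if "wfz z" for z
    using that by (auto simp: wfz_def)
  ultimately show ?thesis using assms by (auto simp: env_def)
qed

lemma map_phi: "map phi Fvars = map (\<lambda>f. Sym (Oracle f)) fs"
  by (rule nth_equalityI) (simp_all add: length_fs Fvars_def phi_def)

lemma map_env: "map (ins n y hs q zs) xvars = map enc ws"
  by (rule nth_equalityI) (simp_all add: length_ws xvars_def env_def)

lemma inst_runp: "ins n y hs q zs (runp h q' t) =
    apps (Sym runS) (Fargs @ [ins n y hs q zs h, ins n y hs q zs q'] @
      map (\<lambda>j. ins n y hs q zs (t j)) [0..<K])"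
  by (simp add: runp_def tapes_of_def comp_def map_phi map_env Fargs_def del: foldl_append)

lemma inst_gop: "ins n y hs q zs (gop m h q' t) =
    apps (Sym goS) (Fargs @ [ins n y hs q zs m, ins n y hs q zs h,
      ins n y hs q zs q'] @ map (\<lambda>j. ins n y hs q zs (t j)) [0..<K])"
  by (simp add: gop_def tapes_of_def comp_def map_phi map_env Fargs_def del: foldl_append)

lemma inst_lrvar: "j < K \<Longrightarrow> ins n y hs q zs (lvar j) = encs (pushes (fst (zs ! j)))"
  "j < K \<Longrightarrow> ins n y hs q zs (rvar j) = encs (snd (snd (zs ! j)))"
  by (simp_all add: lvar_def rvar_def env_def)

lemma inst_env [simp]:
  "ins n y hs q zs vh = ench hs"
  "ins n y hs q zs fuelp = enc n"
  "ins n y hs q zs vy = encb y"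
  "j < K \<Longrightarrow> ins n y hs q zs (PV j symB) = Sym (symS (fst (snd (zs ! j))))"
  "j < K \<Longrightarrow> ins n y hs q zs (PV j tapeB) = encz (zs ! j)"
  "ins n y hs q zs (PV 0 stateB) = Sym (stateS q)"
  by (simp_all add: env_def)

lemma inst_tapep: "j < K \<Longrightarrow> ins n y hs q zs (tapep (lvar j) (PV j symB) (rvar j)) = encz (zs ! j)"
  using inst_lrvar[of j n y hs q zs] inst_env(4)[of j n y hs q zs]
  by (cases "zs ! j") (simp add: encz_def enct_def del: inst_simps(1))

lemma inst_go_lhs:
  assumes "length zs = K"
    and "\<And>j. j < K \<Longrightarrow> ins n y hs q zs (c j) = Sym (symS (fst (snd (zs ! j))))"
  shows "ins n y hs q zs (go_lhs q c) = go_term (y # n) hs q zs"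
proof -
  have "ins n y hs q zs (tapep (lvar j) (c j) (rvar j)) = encz (zs ! j)" if "j < K" for j
    using inst_lrvar[OF that, of n y hs q zs] assms(2)[OF that]
    by (cases "zs ! j") (simp add: encz_def enct_def)
  then have "map (\<lambda>j. ins n y hs q zs (tapep (lvar j) (c j) (rvar j))) [0..<K] = map encz zs"
    using assms(1) by (auto intro!: nth_equalityI simp del: inst_simps)
  then show ?thesis
    unfolding go_lhs_def inst_gop go_term_def
    using inst_env(1,2,3)[of n y hs q zs] by (simp del: inst_simps(1) foldl_append)
qed

lemma red_run_args:
  assumes "h \<rightarrow>* h'" "\<And>j. j < K \<Longrightarrow> t j \<rightarrow>* encz (zs ! j)" "length zs = K"
  shows "apps (Sym runS) (Fargs @ [h, q] @ map t [0..<K]) \<rightarrow>* apps (Sym runS) (Fargs @ [h', q] @ map encz zs)"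
proof (intro red_apps list_all2_appendI)
  show "list_all2 (\<rightarrow>*) [h, q] [h', q]" using assms(1) by simp
  show "list_all2 (\<rightarrow>*) (map t [0..<K]) (map encz zs)"
    using assms(2,3) by (auto simp: list_all2_conv_all_nth)
qed (auto intro: list_all2_refl)

lemma run_to_go:
  assumes "length zs = K" "\<And>j. j < K \<Longrightarrow> wfz (zs ! j)" "q \<in> states M"
  obtains n where "run_term hs q zs \<rightarrow>* go_term n hs q zs"
    "length n = recorded_value hs ws clock - length hs"
proof -
  \<comment> \<open>\<open>[]\<close> and \<open>False\<close> are placeholders for fuel and clock
    bit, which have no variable in the rule for \<open>run\<close>.\<close>
  let ?v = "env [] False hs q zs"
  obtain w where w: "inst phi ?v (theta clock) \<rightarrow>* enc w"
    "length w = recorded_value hs ws clock"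
    using red_theta[of ws clock phi ?v hs] clock_over length_ws by (auto simp: phi_def env_def)
  have tapes: "map (\<lambda>j. inst phi ?v (PV j tapeB)) [0..<K] = map encz zs"
    using assms(1) by (auto intro!: nth_equalityI simp del: inst_simps)
  have rule: "(runp vh (PV 0 stateB) (\<lambda>j. PV j tapeB),
     gop (drpp vh (theta clock)) vh (PV 0 stateB) (\<lambda>j. PV j tapeB)) \<in> rules"
    using in_rules(12) by (auto simp: run_rules_def)
  have "innermost \<Sigma>' R' (inst phi ?v (runp vh (PV 0 stateB) (\<lambda>j. PV j tapeB)))
      (inst phi ?v (gop (drpp vh (theta clock)) vh (PV 0 stateB) (\<lambda>j. PV j tapeB)))"
    by (rule rule_step[OF rule fun_val_phi val_env[OF assms]])
  then have "innermost \<Sigma>' R' (run_term hs q zs)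
    (apps (Sym goS) (Fargs @ [apps (Sym drpS) [ench hs, inst phi ?v (theta clock)], ench hs, Sym (stateS q)] @ map encz zs))"
    unfolding inst_runp inst_gop tapes run_term_def
    by (simp del: foldl_append inst_simps(1))
  also have "\<dots> \<rightarrow>* go_term (drop (length hs) w) hs q zs"
    unfolding go_term_def
  proof (intro red_apps list_all2_appendI)
    have "apps (Sym drpS) [ench hs, inst phi ?v (theta clock)] \<rightarrow>* apps (Sym drpS) [ench hs, enc w]"
      using red_args[OF rtranclp.rtrancl_refl w(1)] by simp
    also note red_drp
    finally show "list_all2 (\<rightarrow>*) [apps (Sym drpS) [ench hs, inst phi ?v (theta clock)], ench hs, Sym (stateS q)]
       [enc (drop (length hs) w), ench hs, Sym (stateS q)]" by simp
  qed (auto intro: list_all2_refl)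
  finally (red_step) show ?thesis using that w by simp
qed

lemma red_actp:
  assumes "j < K" "wfz (zs ! j)" "fst a \<in> alphabet M"
  shows "ins n y hs q zs (actp j a) \<rightarrow>* encz (zact (zs ! j) a)"
proof -
  obtain b m where a: "a = (b, m)" by fastforce
  obtain ls d r where z: "zs ! j = (ls, d, r)" by (cases "zs ! j") auto
  have wf: "set ls \<subseteq> alphabet M" "d \<in> alphabet M" "wf_stk r" "b \<in> alphabet M"
    using assms(2,3) by (auto simp: wfz_def z a)
  note lr = inst_lrvar[OF assms(1), of n y hs q zs, unfolded z, simplified]
  show ?thesis
  proof (cases m)
    case MLeft
    then show ?thesis using red_pull[OF wf(1,4,3)] lr
      by (cases ls) (auto simp: a z encz_def)
  next
    case MRight
    then show ?thesis using red_pop[of "pushes (b # ls)" r] wf lr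
      by (auto simp: a z encz_def case_prod_unfold)
  next
    case MStay
    then show ?thesis using lr by (simp add: a z encz_def enct_def)
  qed
qed

text \<open>The fuel has to exceed the head position for rewinding and to reach the length of the
  word for reading; the second condition makes the truncation in \<open>red_rew\<close>
  vanish.\<close>

lemma red_extractp:
  assumes "j < K" "wfz (zs ! j)" "rep t (zs ! j)" "snd t < length n" "length (tape_word t) \<le> length n"
  shows "ins n y hs q zs (extractp j) \<rightarrow>* enc (tape_word t)"
proof -
  obtain ls d r where z: "zs ! j = (ls, d, r)" by (cases "zs ! j") auto
  have wf: "set ls \<subseteq> alphabet M" "wf_stk (Push d r)" using assms(2) by (auto simp: wfz_def z)
  have w: "tape_word t = bits (rev ls @ d # sem r)" "length ls = snd t" using rep_word assms(3) z by auto
  have "ins n y hs q zs (extractp j) = apps (Sym rewS) [enc n, enc n, encs (pushes ls), encs (Push d r)]"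
    using inst_lrvar[OF assms(1), of n y hs q zs] inst_env(2)[of n y hs q zs]
      inst_env(4)[OF assms(1), of n y hs q zs]
    by (simp add: extractp_def z del: inst_simps(1))
  also have "\<dots> \<rightarrow>* enc (take (length n) (bits (rev ls @ sem (Push d r))))"
    by (rule red_rew) (use wf w assms in auto)
  finally show ?thesis using w assms(5) by simp
qed

definition simulated :: "nat \<Rightarrow> word list \<Rightarrow> zipper list \<Rightarrow> bool" where
  "simulated t hs zs \<longleftrightarrow> length hs = t \<and> recorded t hs \<and> list_all2 rep (tps t) zs"

lemma simulated_wfz:
  assumes "simulated t hs zs" "t \<le> T"
  shows "length zs = K" "\<And>j. j < K \<Longrightarrow> wfz (zs ! j)" "\<And>j. j < K \<Longrightarrow> rep (tps t ! j) (zs ! j)"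
proof -
  show len: "length zs = K" using assms conf_inv[of t] by (auto simp: simulated_def dest: list_all2_lengthD)
  show r: "rep (tps t ! j) (zs ! j)" if "j < K" for j
    using assms len that by (auto simp: simulated_def list_all2_conv_all_nth)
  show "wfz (zs ! j)" if "j < K" for j
    using rep_wfz[OF r[OF that]] conf_inv[OF assms(2)] that by blast
qed

text \<open>By \<open>time_le\<close> the recorded value of \<open>P\<close> is at least
  \<open>t\<close>. One of the two copies of \<open>P\<close> in the clock pays for the
  \<open>t\<close> units dropped, the other leaves \<open>t\<close> units beyond the input length as
  fuel for this round.\<close>

lemma simulated_go:
  assumes "simulated t hs zs" "t \<le> T"
  obtains n y where "run_term hs (state t) zs \<rightarrow>* go_term (y # n) hs (state t) zs"
    "length n > input_length + t"
proof -
  note wfz = simulated_wfz[OF assms]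
  have st: "state t \<in> states M" using conf_inv[OF assms(2)] by blast
  obtain w where w: "run_term hs (state t) zs \<rightarrow>* go_term w hs (state t) zs"
    "length w = recorded_value hs ws clock - length hs"
    using run_to_go[OF wfz(1,2) st] by blast
  have "t \<le> recorded_value hs ws P" "length hs = t"
    using time_le[OF _ assms(2)] assms(1) by (auto simp: simulated_def)
  then have "length w \<ge> input_length + t + 2" using w(2) by (simp add: clock_value)
  then obtain y n where "w = y # n" "length n > input_length + t" by (cases w) auto
  with w(1) that show ?thesis by blast
qed

lemma word_fits:
  assumes "t \<le> T" "i < K" "i = 0 \<or> odd i"
  shows "snd (tps t ! i) \<le> t" "length (tape_word (tps t ! i)) \<le> input_length + t"
  using conf_inv[OF assms(1)] assms(2,3) by (auto intro!: tape_word_le)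

text \<open>In a query step the extracted word enters the history, which is what keeps
  \<open>recorded\<close> true at \<open>Suc t\<close>. In the other steps the state at time
  \<open>t\<close> is no query state, so the entry \<open>[]\<close> preserves it.\<close>

lemma simulated_Suc:
  assumes "simulated t hs zs" "t < T"
  obtains hs' zs' where "simulated (Suc t) hs' zs'"
    "run_term hs (state t) zs \<rightarrow>* run_term hs' (state (Suc t)) zs'"
proof -
  have t: "t \<le> T" using assms by simp
  note wfz = simulated_wfz[OF assms(1) t]
  obtain n y where n: "run_term hs (state t) zs \<rightarrow>* go_term (y # n) hs (state t) zs"
    "length n > input_length + t" using simulated_go[OF assms(1) t] by blast
  obtain q ts where qt: "conf t = (q, ts)" by fastforce
  have q: "q \<in> states M" "length ts = K" using conf_inv[OF t] qt by auto
  have nf: "q \<notin> final M" using not_final[OF assms(2)] qt by simp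
  let ?v = "env n y hs q zs"
  note step = rule_step[OF _ fun_val_phi val_env[OF wfz(1,2) q(1), of _ n y hs]]
  have hs: "length hs = t" "recorded t hs" using assms(1) by (auto simp: simulated_def)
  have rep: "rep (ts ! j) (zs ! j)" if "j < K" for j using wfz(3)[OF that] qt by simp
  show thesis
  proof (cases "q \<in> queries")
    case True
    then obtain i where i: "i < k" "q = query M i" by (auto simp: queries_def)
    have iK: "2 * i + 1 < K" "2 * i + 2 < K" using i machine_simps(5) by auto
    let ?u = "tape_word (ts ! (2 * i + 1))" and ?f = "fs ! i"
    have f: "?f \<in> set fs" using i length_fs by simp
    define zs' where "zs' = zs[2 * i + 1 := ztop Bot, 2 * i + 2 := ztop (Inp (?f ?u) Bot)]"
    have c: "conf (Suc t) = (answer M i, ts[2 * i + 1 := written [],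
        2 * i + 2 := written (map Bit (?f ?u))])"
      using step_query[OF i(1) length_fs] by (simp add: conf_Suc qt i(2))
    have ext: "inst phi ?v (extractp (2 * i + 1)) \<rightarrow>* enc ?u"
      using word_fits[OF t iK(1)] n(2) qt
      by (intro red_extractp[OF iK(1) wfz(2)[OF iK(1)] rep[OF iK(1)]]) auto
    have lhs: "inst phi ?v (fst (query_rule i)) = go_term (y # n) hs q zs"
      unfolding query_rule_def fst_conv i(2)[symmetric]
      by (rule inst_go_lhs[OF wfz(1) inst_env(4)])
    have "query_rule i \<in> rules" using in_rules(13) i(1) by (auto simp: go_rules_def)
    then have "innermost \<Sigma>' R' (inst phi ?v (fst (query_rule i))) (inst phi ?v (snd (query_rule i)))"
      by (intro step) simp
    then have "innermost \<Sigma>' R' (go_term (y # n) hs q zs) (inst phi ?v (snd (query_rule i)))"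
      unfolding lhs .
    moreover have "inst phi ?v (snd (query_rule i)) \<rightarrow>* run_term (?u # hs) (answer M i) zs'"
      unfolding query_rule_def snd_conv inst_runp run_term_def inst_simps(3)
    proof (simp only: list.map append_Nil foldl.simps(1), rule red_run_args)
      show "apps (Sym hconsS) [inst phi ?v (extractp (2 * i + 1)), inst phi ?v vh] \<rightarrow>* ench (?u # hs)"
        using red_args[OF ext rtranclp.rtrancl_refl] inst_env(1)[of n y hs q zs] by (simp del: inst_simps(1))
      show "length zs' = K" by (simp add: zs'_def wfz(1))
      fix j assume j: "j < K"
      let ?t = "if j = 2 * i + 1 then tapep botp (cellp Blank) botp
            else if j = 2 * i + 2 then popp botp (inpp (PF i (extractp (2 * i + 1))) botp)
            else tapep (lvar j) (PV j symB) (rvar j)"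
      show "inst phi ?v ?t \<rightarrow>* encz (zs' ! j)"
      proof (cases "j = 2 * i + 2")
        case True
        have "App (phi i) (inst phi ?v (extractp (2 * i + 1))) \<rightarrow>* App (Sym (Oracle ?f)) (enc ?u)"
          using innermost_App_rtranclp[OF rtranclp.rtrancl_refl ext] i(1) by (simp add: phi_def)
        also have "\<dots> \<rightarrow>* enc (?f ?u)" by (rule red_Oracle[OF f])
        finally have "inst phi ?v ?t \<rightarrow>* apps (Sym popS) [encs Bot, encs (Inp (?f ?u) Bot)]"
          using True by (auto intro!: red_args)
        also have "\<dots> \<rightarrow>* enct Bot (fst (popr (Inp (?f ?u) Bot))) (snd (popr (Inp (?f ?u) Bot)))"
          by (rule red_pop) auto
        finally show ?thesis using True iK wfz(1) by (simp add: zs'_def encz_def ztop_def case_prod_unfold)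
      next
        case n2: False
        show ?thesis
        proof (cases "j = 2 * i + 1")
          case True
          then show ?thesis using iK wfz(1) by (simp add: zs'_def encz_def ztop_def enct_def)
        next
          case False
          then have "zs' ! j = zs ! j" using n2 by (simp add: zs'_def)
          then show ?thesis using False n2 inst_tapep[OF j, of n y hs q zs] by (simp del: inst_simps)
        qed
      qed
    qed
    ultimately have "go_term (y # n) hs q zs \<rightarrow>* run_term (?u # hs) (answer M i) zs'" by (rule red_step)
    then have "run_term hs (state t) zs \<rightarrow>* run_term (?u # hs) (state (Suc t)) zs'"
      using n(1) qt c by simp
    moreover have "simulated (Suc t) (?u # hs) zs'"
      unfolding simulated_def
    proof (intro conjI)
      show "recorded (Suc t) (?u # hs)"
        unfolding recorded_def
      proof (intro allI impI)
        fix s i' assume s: "s < Suc t" "i' < k" "state s = query M i'"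
        show "tape_word (tps s ! (2 * i' + 1)) \<in> set (?u # hs)"
        proof (cases "s = t")
          case True
          have "inj_on (query M) {..<k}" using M by (simp add: otm_def)
          then have "i' = i" using s i True qt by (auto simp: inj_on_def)
          then show ?thesis using True qt by simp
        next
          case False
          then show ?thesis using hs(2) s by (auto simp: recorded_def)
        qed
      qed
      show "list_all2 rep (tps (Suc t)) zs'"
        unfolding zs'_def c snd_conv using rep q(2) wfz(1)
        by (intro list_all2_update_cong list_all2_all_nthI rep_written) (auto simp: cell_def nth_append)
    qed (simp add: hs)
    ultimately show ?thesis using that by blast
  next
    case False
    let ?cs = "map (\<lambda>(c, h). c h) ts"
    obtain q' acts where d: "delta M q ?cs = (q', acts)" by fastforce
    have al: "fst (ts ! j) i \<in> alphabet M" if "j < K" for i j using conf_inv[OF t] qt that by auto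
    have "?cs ! i \<in> alphabet M" if "i < K" for i
      using q(2) al[OF that, of "snd (ts ! i)"] that by (simp add: split_def)
    then have cs: "set ?cs \<subseteq> alphabet M" "length ?cs = K"
      using q(2) by (simp_all only: length_map) (metis in_set_conv_nth length_map subsetI)
    have wf: "length acts = K" "fst ` set acts \<subseteq> alphabet M"
      using delta_wf[of q ?cs] q nf False cs d by auto
    have csj: "?cs ! j = fst (snd (zs ! j))" if "j < K" for j
      using rep[OF that] q(2) that by (cases "zs ! j"; cases "ts ! j") (simp add: rep_def)
    have c: "conf (Suc t) = (q', map2 act ts acts)"
      using step_no_query[OF False nf length_fs] d by (simp add: conf_Suc qt)
    define zs' where "zs' = map2 zact zs acts"
    have "step_rule q ?cs \<in> rules"
      using in_rules(13) q nf False cs unfolding go_rules_def by blast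
    then have "innermost \<Sigma>' R' (inst phi ?v (fst (step_rule q ?cs))) (inst phi ?v (snd (step_rule q ?cs)))"
      by (intro step) simp
    moreover have "inst phi ?v (fst (step_rule q ?cs)) = go_term (y # n) hs q zs"
      unfolding step_rule_def fst_conv by (rule inst_go_lhs[OF wfz(1)]) (use csj in simp)
    moreover have "inst phi ?v (snd (step_rule q ?cs)) \<rightarrow>* run_term ([] # hs) q' zs'"
      unfolding step_rule_def snd_conv inst_runp run_term_def inst_simps(3) d fst_conv
    proof (simp only: list.map append_Nil inst_simps(3) foldl.simps(1), rule red_run_args)
      show "apps (Sym hconsS) [Sym SymNil, inst phi ?v vh] \<rightarrow>* ench ([] # hs)"
        using inst_env(1)[of n y hs q zs] by (simp del: inst_simps(1))
      show "length zs' = K" by (simp add: zs'_def wfz(1) wf(1))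
      fix j assume j: "j < K"
      have "acts ! j \<in> set acts" using wf(1) j by simp
      then have "fst (acts ! j) \<in> alphabet M" by (rule subsetD[OF wf(2) imageI])
      then show "inst phi ?v (actp j (acts ! j)) \<rightarrow>* encz (zs' ! j)"
        using red_actp[OF j wfz(2)[OF j]] j wf(1) wfz(1) by (simp add: zs'_def)
    qed
    ultimately have "go_term (y # n) hs q zs \<rightarrow>* run_term ([] # hs) q' zs'" by (metis red_step)
    then have "run_term hs (state t) zs \<rightarrow>* run_term ([] # hs) (state (Suc t)) zs'"
      using n(1) qt c by simp
    moreover have "simulated (Suc t) ([] # hs) zs'"
      unfolding simulated_def
    proof (intro conjI)
      show "recorded (Suc t) ([] # hs)"
        unfolding recorded_def
      proof (intro allI impI)
        fix s i' assume s: "s < Suc t" "i' < k" "state s = query M i'"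
        then have "s \<noteq> t" using False qt by (auto simp: queries_def)
        then show "tape_word (tps s ! (2 * i' + 1)) \<in> set ([] # hs)"
          using hs(2) s by (auto simp: recorded_def)
      qed
      show "list_all2 rep (tps (Suc t)) zs'"
        unfolding zs'_def c snd_conv using rep q(2) wfz(1) wf(1)
        by (intro list_all2_all_nthI) (auto intro: rep_act)
    qed (simp add: hs)
    ultimately show ?thesis using that by blast
  qed
qed

lemma encs_input: "encs (foldr Inp us Bot) = foldr (\<lambda>w s. apps (Sym inpS) [enc w, s]) us (Sym botS)"
  by (induction us) auto

lemma sem_input: "sem (foldr Inp us Bot) = concat (map (\<lambda>x. map Bit x @ [Blank]) us)"
  by (induction us) auto

text \<open>The root step with the rule for \<open>F\<close> is kept separate from the layout of the
  tapes that follows, because it makes the whole reduction nonempty, as the transitive closure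
  demands.\<close>

lemma start_simulation:
  obtains zs s where "simulated 0 [] zs" "innermost \<Sigma>' R' (apps (Sym SymF) Fargs) s"
    "s \<rightarrow>* run_term [] (state 0) zs"
proof -
  define zs where "zs = ztop (foldr Inp ws Bot) # replicate (K - 1) (ztop Bot)"
  have K: "0 < K" using machine_simps(5) by simp
  have len: "length zs = K" using K by (simp add: zs_def)
  have c: "conf 0 = (start M, written (concat (map (\<lambda>x. map Bit x @ [Blank]) ws)) # replicate (K - 1) (written []))"
    by (simp add: conf_def otm_run_def otm_init_def)
  have "list_all2 rep (replicate n (written [])) (replicate n (ztop Bot))" for n
    by (induction n) (auto intro!: rep_written)
  then have sim: "simulated 0 [] zs"
    unfolding simulated_def recorded_def c zs_def by (auto simp: sem_input intro!: rep_written)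
  let ?v = "env [] False [] (start M) zs"
  note wfz = simulated_wfz[OF sim le0]
  have foldr: "inst phi ?v (foldr inpp xs botp) = foldr (\<lambda>w s. apps (Sym inpS) [w, s]) (map (inst phi ?v) xs) (Sym botS)" for xs
    by (induction xs) auto
  have inp: "inst phi ?v input_stack = encs (foldr Inp ws Bot)"
    unfolding input_stack_def foldr map_env encs_input by (simp add: foldr_map comp_def)
  let ?t = "\<lambda>j. if j = 0 then popp botp input_stack else tapep botp (cellp Blank) botp"
  have rule: "(PS SymF Fvars xvars, runp hnilp (statep (start M)) ?t) \<in> rules"
    using in_rules(11) by (auto simp: F_rules_def)
  have "innermost \<Sigma>' R' (inst phi ?v (PS SymF Fvars xvars)) (inst phi ?v (runp hnilp (statep (start M)) ?t))"
    by (rule rule_step[OF rule fun_val_phi val_env[OF wfz(1,2) machine_simps(6)]])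
  then have "innermost \<Sigma>' R' (apps (Sym SymF) Fargs) (inst phi ?v (runp hnilp (statep (start M)) ?t))"
    by (simp add: map_phi map_env Fargs_def del: foldl_append)
  moreover have "inst phi ?v (runp hnilp (statep (start M)) ?t) \<rightarrow>* run_term [] (state 0) zs"
    unfolding inst_runp run_term_def inst_simps(3) c fst_conv
  proof (simp only: list.map append_Nil foldl.simps(1), rule red_run_args)
    show "Sym hnilS \<rightarrow>* ench []" by simp
    show "length zs = K" by (rule len)
    fix j assume j: "j < K"
    show "inst phi ?v (if j = 0 then popp botp input_stack else tapep botp (cellp Blank) botp) \<rightarrow>* encz (zs ! j)"
    proof (cases j)
      case 0
      have "wf_stk (foldr Inp us Bot)" for us by (induction us) auto
      then have "apps (Sym popS) [encs Bot, encs (foldr Inp ws Bot)] \<rightarrow>*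
          enct Bot (fst (popr (foldr Inp ws Bot))) (snd (popr (foldr Inp ws Bot)))"
        by (intro red_pop) auto
      moreover have "zs ! 0 = ztop (foldr Inp ws Bot)" by (simp add: zs_def)
      ultimately show ?thesis using 0 by (simp add: inp encz_def ztop_def case_prod_unfold)
    next
      case (Suc j')
      then show ?thesis using j by (simp add: zs_def encz_def ztop_def enct_def)
    qed
  qed
  ultimately show ?thesis using that sim by blast
qed

lemma simulation:
  assumes "t \<le> T"
  shows "\<exists>hs zs. simulated t hs zs \<and> (innermost \<Sigma>' R')\<^sup>+\<^sup>+ (apps (Sym SymF) Fargs) (run_term hs (state t) zs)"
  using assms
proof (induction t)
  case 0
  show ?case using start_simulation rtranclp_into_tranclp2 by metis
next
  case (Suc t)
  then obtain hs zs where 1: "simulated t hs zs"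
    "(innermost \<Sigma>' R')\<^sup>+\<^sup>+ (apps (Sym SymF) Fargs) (run_term hs (state t) zs)" by auto
  obtain hs' zs' where "simulated (Suc t) hs' zs'" "run_term hs (state t) zs \<rightarrow>* run_term hs' (state (Suc t)) zs'"
    using simulated_Suc[OF 1(1)] Suc.prems by auto
  then show ?case using tranclp_rtranclp_tranclp[OF 1(2)] by blast
qed

lemma computes_result: "(innermost \<Sigma>' R')\<^sup>+\<^sup>+ (apps (Sym SymF) Fargs) (enc (\<Psi> fs ws))"
proof -
  obtain hs zs where sim: "simulated T hs zs"
    "(innermost \<Sigma>' R')\<^sup>+\<^sup>+ (apps (Sym SymF) Fargs) (run_term hs (state T) zs)" using simulation by blast
  note wfz = simulated_wfz[OF sim(1) order.refl]
  obtain n y where n: "run_term hs (state T) zs \<rightarrow>* go_term (y # n) hs (state T) zs"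
    "length n > input_length + T" using simulated_go[OF sim(1) order.refl] by blast
  have q: "state T \<in> final M" using halts(1) by (simp add: halted_at_def conf_def)
  have K: "0 < K" using machine_simps(5) by simp
  let ?v = "env n y hs (state T) zs"
  have "final_rule (state T) \<in> rules" using in_rules(13) q by (auto simp: go_rules_def)
  then have "innermost \<Sigma>' R' (inst phi ?v (fst (final_rule (state T)))) (inst phi ?v (snd (final_rule (state T))))"
    by (intro rule_step fun_val_phi val_env wfz(1,2) machine_simps(7)[OF q]) simp
  moreover have "inst phi ?v (fst (final_rule (state T))) = go_term (y # n) hs (state T) zs"
    unfolding final_rule_def fst_conv by (rule inst_go_lhs[OF wfz(1) inst_env(4)])
  moreover have "inst phi ?v (snd (final_rule (state T))) \<rightarrow>* enc (tape_word (tps T ! 0))"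
    unfolding final_rule_def snd_conv using word_fits[OF order.refl K] n(2)
    by (intro red_extractp[OF K wfz(2)[OF K] wfz(3)[OF K]]) auto
  ultimately have "go_term (y # n) hs (state T) zs \<rightarrow>* enc (\<Psi> fs ws)"
    using halts(2) by (metis red_step)
  with n(1) have "run_term hs (state T) zs \<rightarrow>* enc (\<Psi> fs ws)" by simp
  with sim(2) show ?thesis by (rule tranclp_rtranclp_tranclp)
qed

end

theorem theorem6p3:
  fixes k l :: nat and \<Psi> :: functional2
  assumes "\<Psi> \<in> BFF2 k l"
  shows "\<exists>\<Sigma> R. finite (dom \<Sigma>) \<and> finite R \<and> type2_signature k l \<Sigma> \<and>
           STRS \<Sigma> R \<and> orthogonal \<Sigma> R \<and>
           STRS_computes k l \<Sigma> R \<Psi> \<and>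
           (\<exists>J. poly_bounded k l \<Sigma> R J)"
proof -
  obtain M P where MP: "otm k M" "sopoly_over k l P" "otm_computes k l M \<Psi>"
    "\<And>fs xs. length fs = k \<Longrightarrow> length xs = l \<Longrightarrow>
      otm_time M fs xs \<le> sopoly_eval (map fun_length fs) (map length xs) P"
    using assms unfolding BFF2_def by blast
  interpret machine k l M P using MP by unfold_locales
  have "STRS_computes k l (sig_of ar) sys \<Psi>"
    unfolding STRS_computes_def
  proof (intro allI impI)
    fix fs :: "(word \<Rightarrow> word) list" and ws :: "word list"
    assume "length fs = k \<and> length ws = l"
    then interpret computation k l M P fs ws \<Psi> using MP by unfold_locales auto
    show "(innermost (oracle_signature (sig_of ar) fs) (sys \<union> (\<Union>f\<in>set fs. oracle_rules f)))\<^sup>+\<^sup>+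
        (apps (Sym SymF) (map (\<lambda>f. Sym (Oracle f)) fs @ map enc ws)) (enc (\<Psi> fs ws))"
      using computes_result by (simp only: Fargs_def)
  qed
  then show ?thesis
    using finite_dom_sig finite_sys type2_signature_sys STRS_sys orthogonal_sys poly_bounded_sys by blast
qed

end
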